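(* Let $f:N\to\mathbb{R}^{n+1}$ be a closed orientable immersed $C^2$ hypersurface of Euclidean space, with unit normal $\vec n$ and mean curvatures $H_0,\ldots,H_n$. Let $P$ be the position vector field of $\mathbb{R}^{n+1}$, $P_x=x$. Then, for any $0\le i\le n-1$, $$\int_N\bigl(H_i-\langle P,\vec n\rangle H_{i+1}\bigr)\,\mathrm{vol}_N=0 .$$
   Context: $N$ is an $n$-dimensional closed (compact, without boundary) manifold with the metric induced by $f$ and volume form $\mathrm{vol}_N$. $\vec n$ is the unit normal along $f$ determined by the orientations, and the functions $P$ and $\langle P,\vec n\rangle$ are evaluated along $f$. Convention for the second fundamental form: $A=\nabla\vec n$, i.e. $A(Y)=\nabla_Y\vec n$ for $Y$ tangent to $N$ ($\nabla$ the Levi-Civita connection of the ambient space; no minus sign). The $i$-th mean curvature $H_i$ is defined by $\binom{n}{i}H_i=\sum_{1\le j_1<\cdots<j_i\le n}\lambda_{j_1}\cdots\lambda_{j_i}$, where $\lambda_1,\ldots,\lambda_n$ are the eigenvalues of $A$ (principal curvatures), and $H_0=1$. *)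

theory Defs
  imports "HOL-Analysis.Analysis"
begin

subsection \<open>Maps of class C1 and C2 (used on open sets only)\<close>

definition C1_on :: "'a::real_normed_vector set \<Rightarrow> ('a \<Rightarrow> 'b::real_normed_vector) \<Rightarrow> bool" where
  "C1_on S g \<longleftrightarrow> (\<exists>g' :: 'a \<Rightarrow> 'a \<Rightarrow>\<^sub>L 'b.
     (\<forall>x\<in>S. (g has_derivative blinfun_apply (g' x)) (at x)) \<and> continuous_on S g')"

definition C2_on :: "'a::real_normed_vector set \<Rightarrow> ('a \<Rightarrow> 'b::real_normed_vector) \<Rightarrow> bool" where
  "C2_on S g \<longleftrightarrow> (\<exists>g' :: 'a \<Rightarrow> 'a \<Rightarrow>\<^sub>L 'b.
     (\<forall>x\<in>S. (g has_derivative blinfun_apply (g' x)) (at x)) \<and> C1_on S g')"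


subsection \<open>Closed oriented manifolds\<close>

text \<open>A chart is a pair of its domain and its coordinate map into \<open>real ^ 'n\<close>; the
  dimension of the manifold is the cardinality of \<open>'n\<close>.\<close>

type_synonym ('a, 'n) chart = "'a set \<times> ('a \<Rightarrow> real ^ 'n)"

abbreviation dom_chart :: "('a, 'n::finite) chart \<Rightarrow> 'a set" where
  "dom_chart c \<equiv> fst c"

abbreviation coord :: "('a, 'n::finite) chart \<Rightarrow> 'a \<Rightarrow> real ^ 'n" where
  "coord c \<equiv> snd c"

abbreviation image_chart :: "('a, 'n::finite) chart \<Rightarrow> (real ^ 'n) set" where
  "image_chart c \<equiv> coord c ` dom_chart c"

definition param :: "('a, 'n::finite) chart \<Rightarrow> real ^ 'n \<Rightarrow> 'a" where
  "param c = inv_into (dom_chart c) (coord c)"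

definition is_chart :: "'a topology \<Rightarrow> ('a, 'n::finite) chart \<Rightarrow> bool" where
  "is_chart N c \<longleftrightarrow> openin N (dom_chart c) \<and> open (image_chart c) \<and>
     homeomorphic_map (subtopology N (dom_chart c)) (top_of_set (image_chart c)) (coord c)"

definition oriented_C2_atlas :: "'a topology \<Rightarrow> ('a, 'n::finite) chart set \<Rightarrow> bool" where
  "oriented_C2_atlas N \<A> \<longleftrightarrow>
     (\<forall>c\<in>\<A>. is_chart N c) \<and>
     topspace N = (\<Union>c\<in>\<A>. dom_chart c) \<and>
     (\<forall>c\<in>\<A>. \<forall>d\<in>\<A>.
        C2_on (coord c ` (dom_chart c \<inter> dom_chart d)) (coord d \<circ> param c) \<and>
        (\<forall>x \<in> coord c ` (dom_chart c \<inter> dom_chart d).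
           det (matrix (frechet_derivative (coord d \<circ> param c) (at x))) > 0))"

definition closed_oriented_manifold :: "'a topology \<Rightarrow> ('a, 'n::finite) chart set \<Rightarrow> bool" where
  "closed_oriented_manifold N \<A> \<longleftrightarrow>
     Hausdorff_space N \<and> second_countable N \<and> compact_space N \<and> oriented_C2_atlas N \<A>"


subsection \<open>Immersed hypersurfaces and their curvatures\<close>

text \<open>The differential at \<open>p\<close> of a map \<open>g\<close> on the manifold, applied to the tangent vector
  with components \<open>v\<close> in the chart \<open>c\<close>. Tangent vectors at \<open>p\<close> are throughout represented
  by their components in a chart around \<open>p\<close>.\<close>

definition differential ::
  "('a, 'n::finite) chart \<Rightarrow> ('a \<Rightarrow> 'b::real_normed_vector) \<Rightarrow> 'a \<Rightarrow> real ^ 'n \<Rightarrow> 'b" where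
  "differential c g p = frechet_derivative (g \<circ> param c) (at (coord c p))"

definition C2_immersion ::
  "('a, 'n::finite) chart set \<Rightarrow> ('a \<Rightarrow> 'b::real_normed_vector) \<Rightarrow> bool" where
  "C2_immersion \<A> f \<longleftrightarrow>
     (\<forall>c\<in>\<A>. C2_on (image_chart c) (f \<circ> param c) \<and>
            (\<forall>p\<in>dom_chart c. inj (differential c f p)))"

text \<open>Euclidean space of dimension \<open>n + 1\<close> is \<open>real ^ ('n option)\<close>. The frame consisting
  of \<open>w\<close> (in position \<open>None\<close>) and \<open>u j\<close> (in position \<open>Some j\<close>) is positively oriented
  iff the following determinant is positive.\<close>

definition frame_det ::
  "real ^ ('n::finite option) \<Rightarrow> ('n \<Rightarrow> real ^ ('n option)) \<Rightarrow> real" where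
  "frame_det w u = det (\<chi> a b. (case b of None \<Rightarrow> w | Some j \<Rightarrow> u j) $ a)"

text \<open>The unit normal determined by the orientations: the normal followed by a positive
  frame of the tangent space is a positive frame of the ambient space. (The opposite normal is
  the one determined by the opposite orientation of the manifold.)\<close>

definition oriented_unit_normal ::
  "('a, 'n::finite) chart set \<Rightarrow> ('a \<Rightarrow> real ^ ('n option)) \<Rightarrow> ('a \<Rightarrow> real ^ ('n option)) \<Rightarrow> bool"
  where
  "oriented_unit_normal \<A> f \<nu> \<longleftrightarrow>
     (\<forall>c\<in>\<A>. \<forall>p\<in>dom_chart c.
        norm (\<nu> p) = 1 \<and> (\<forall>v. \<nu> p \<bullet> differential c f p v = 0) \<and>
        frame_det (\<nu> p) (\<lambda>j. differential c f p (axis j 1)) > 0)"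

text \<open>The second fundamental form \<open>A = \<nabla>\<nu>\<close> as an endomorphism of the tangent space. The
  ambient connection is flat, so \<open>\<nabla>\<^sub>Y \<nu>\<close> is the derivative of \<open>\<nu>\<close> along \<open>Y\<close>; it is tangent,
  and \<open>A Y\<close> is the tangent vector mapped to it by the differential of \<open>f\<close>.\<close>

definition second_fundamental_form ::
  "('a, 'n::finite) chart \<Rightarrow> ('a \<Rightarrow> real ^ ('n option)) \<Rightarrow> ('a \<Rightarrow> real ^ ('n option)) \<Rightarrow> 'a
     \<Rightarrow> real ^ 'n \<Rightarrow> real ^ 'n" where
  "second_fundamental_form c f \<nu> p Y = (THE Z. differential c f p Z = differential c \<nu> p Y)"

text \<open>\<open>\<kappa>\<close> lists the eigenvalues of the linear map \<open>L\<close>, with multiplicities, \<open>L\<close> being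
  diagonalisable: there is a basis of eigenvectors \<open>e j\<close> with eigenvalues \<open>\<kappa> j\<close>.\<close>

definition eigenvalue_list :: "(real ^ 'n \<Rightarrow> real ^ 'n::finite) \<Rightarrow> ('n \<Rightarrow> real) \<Rightarrow> bool" where
  "eigenvalue_list L \<kappa> \<longleftrightarrow>
     (\<exists>e :: 'n \<Rightarrow> real ^ 'n. inj e \<and> independent (range e) \<and> (\<forall>j. L (e j) = \<kappa> j *\<^sub>R e j))"

text \<open>Only the chart around \<open>p\<close> and the numbering of the principal curvatures are chosen.\<close>

definition principal_curvatures ::
  "('a, 'n::finite) chart set \<Rightarrow> ('a \<Rightarrow> real ^ ('n option)) \<Rightarrow> ('a \<Rightarrow> real ^ ('n option)) \<Rightarrow> 'a
     \<Rightarrow> 'n \<Rightarrow> real" where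
  "principal_curvatures \<A> f \<nu> p =
     (SOME \<kappa>. \<exists>c\<in>\<A>. p \<in> dom_chart c \<and> eigenvalue_list (second_fundamental_form c f \<nu> p) \<kappa>)"

definition mean_curvature ::
  "('a, 'n::finite) chart set \<Rightarrow> ('a \<Rightarrow> real ^ ('n option)) \<Rightarrow> ('a \<Rightarrow> real ^ ('n option))
     \<Rightarrow> nat \<Rightarrow> 'a \<Rightarrow> real" where
  "mean_curvature \<A> f \<nu> i p =
     (\<Sum>J | J \<subseteq> (UNIV :: 'n set) \<and> card J = i. \<Prod>j\<in>J. principal_curvatures \<A> f \<nu> p j)
       / real (CARD('n) choose i)"


subsection \<open>Integration against the induced volume form\<close>

definition induced_metric ::
  "('a, 'n::finite) chart \<Rightarrow> ('a \<Rightarrow> 'b::real_inner) \<Rightarrow> 'a \<Rightarrow> real ^ 'n \<Rightarrow> real ^ 'n \<Rightarrow> real" where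
  "induced_metric c f p v w = differential c f p v \<bullet> differential c f p w"

text \<open>The coefficient of the volume form of the induced metric with respect to
  \<open>dx\<^sub>1 \<and> \<dots> \<and> dx\<^sub>n\<close> in the (positively oriented) chart \<open>c\<close>.\<close>

definition volume_coeff ::
  "('a, 'n::finite) chart \<Rightarrow> ('a \<Rightarrow> 'b::real_inner) \<Rightarrow> 'a \<Rightarrow> real" where
  "volume_coeff c f p =
     sqrt (det (\<chi> i j. induced_metric c f p (axis i 1) (axis j 1) :: real ^ 'n ^ 'n))"

definition partition_of_unity ::
  "'a topology \<Rightarrow> ('a, 'n::finite) chart set \<Rightarrow> ('a, 'n) chart set
     \<Rightarrow> (('a, 'n) chart \<Rightarrow> 'a \<Rightarrow> real) \<Rightarrow> bool" where
  "partition_of_unity N \<A> B \<rho> \<longleftrightarrow>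
     finite B \<and> B \<subseteq> \<A> \<and>
     (\<forall>c\<in>B. continuous_map N euclideanreal (\<rho> c) \<and> (\<forall>p\<in>topspace N. 0 \<le> \<rho> c p) \<and>
            N closure_of {p \<in> topspace N. \<rho> c p \<noteq> 0} \<subseteq> dom_chart c) \<and>
     (\<forall>p\<in>topspace N. (\<Sum>c\<in>B. \<rho> c p) = 1)"

text \<open>The integral of \<open>h vol\<^sub>N\<close>: the value obtained from any partition of unity subordinate
  to the oriented atlas.\<close>

definition volume_integral ::
  "'a topology \<Rightarrow> ('a, 'n::finite) chart set \<Rightarrow> ('a \<Rightarrow> 'b::real_inner) \<Rightarrow> ('a \<Rightarrow> real) \<Rightarrow> real"
  where
  "volume_integral N \<A> f h =
     (THE I. \<exists>B \<rho>. partition_of_unity N \<A> B \<rho> \<and>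
        (\<forall>c\<in>B. set_integrable lborel (image_chart c)
                 ((\<lambda>p. \<rho> c p * h p * volume_coeff c f p) \<circ> param c)) \<and>
        I = (\<Sum>c\<in>B. set_lebesgue_integral lborel (image_chart c)
                 ((\<lambda>p. \<rho> c p * h p * volume_coeff c f p) \<circ> param c)))"

end

theory Submission
  imports Defs
begin

text \<open>
  \<^bold>\<open>Why the formula holds.\<close> For maps \<open>a\<close> and \<open>h = f + t \<nu>\<close> from the manifold to Euclidean space,
  the formula is Stokes' theorem for the \<open>(n - 1)\<close>-form \<open>det (a, \<nu>, dh, \<dots>, dh)\<close>. Formally its exterior
  derivative is a constant multiple of
    \<open>det (\<nu>, da, dh, \<dots>, dh) - det (a, d\<nu>, dh, \<dots>, dh)\<close>,
  called \<open>minkowski_form\<close> below. If \<open>\<kappa>\<^sub>j\<close> are the principal curvatures, then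
  \<open>det (\<nu>, r df + t d\<nu>, \<dots>, r df + t d\<nu>)\<close> is \<open>\<Prod>\<^sub>j (r + t \<kappa>\<^sub>j)\<close> times the volume form, and for \<open>a = f\<close> the
  two terms above are the derivatives of this product in \<open>r\<close> and (after splitting off the normal
  component \<open>\<langle>f, \<nu>\<rangle>\<close>, the only one that the determinant sees) in \<open>t\<close>. Hence
  (\<open>minkowski_form_curvatures\<close>) the Minkowski form of \<open>f\<close> is
    \<open>(\<Sum>i < n. (n - i) (n choose i) (H\<^sub>i - \<langle>f, \<nu>\<rangle> H\<^sub>i\<^sub>+\<^sub>1) t\<^sup>i) vol\<close>,
  and if its integral vanishes for every \<open>t\<close>, then so does the integral of each coefficient.

  \<^bold>\<open>Stokes' theorem for merely continuous forms.\<close> As \<open>f\<close> is of class C2, its normal is only of class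
  C1 and the form above is only continuous, so it cannot be differentiated. The substitute is
  \<open>integral_det_derivative_zero\<close>: \<open>\<integral> det Dw = 0\<close> for every compactly supported C1 map \<open>w\<close> of a Euclidean
  space to itself. For large \<open>r\<close> the map \<open>x \<mapsto> r x + w x\<close> is a bijection of a large ball onto its
  dilation by \<open>r\<close>; so \<open>\<integral> det (r I + Dw) = r\<^sup>n vol\<close> by the change of variables formula, both sides are
  polynomials in \<open>r\<close>, and \<open>r = 0\<close> gives the claim. Polarising it yields the integration by parts
  formula \<open>integral_polar_det_by_parts\<close>: the Minkowski form of a map \<open>a\<close> supported in a small ball of one
  chart has integral zero.

  \<^bold>\<open>Globalisation.\<close> The Minkowski form is linear in \<open>a\<close>, so with C1 functions \<open>\<eta>\<^sub>i\<close> of small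
  support and sum 1 (\<open>exists_C1_partition\<close>) the form of \<open>f\<close> is the sum of the forms of the
  \<open>\<eta>\<^sub>i f\<close>. The integral is computed with an arbitrary continuous partition of unity; by the change
  of variables formula a density supported in one chart has the same integral for all of them
  (\<open>partition_integral_localized\<close>). So every partition of unity gives the value 0, and since
  partitions of unity exist, 0 is the value of the integral.

  \<^bold>\<open>Geometry.\<close> That the normal is of class C1 follows from the formula for it as a normalised cross
  product (\<open>unit_normal_cross_product\<close>). That a basis of principal directions exists follows from the
  spectral theorem (\<open>simultaneous_diagonalisation\<close>), the second fundamental form being symmetric by
  Schwarz' theorem (\<open>second_derivative_symmetric\<close>).
\<close>

section \<open>Determinants of frames\<close>

lemma permutes_range_map_permutation:
  fixes h :: "'m \<Rightarrow> 'n"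
  assumes "inj h"
  shows "bij_betw (map_permutation UNIV h) {q. q permutes UNIV} {p. p permutes range h}"
proof (rule bij_betwI[where g = "map_permutation (range h) (inv h)"])
  show "map_permutation UNIV h \<in> {q. q permutes UNIV} \<rightarrow> {p. p permutes range h}"
    using assms by (auto intro!: map_permutation_permutes simp: bij_betw_def)
  show "map_permutation (range h) (inv h) \<in> {p. p permutes range h} \<rightarrow> {q. q permutes UNIV}"
    using assms by (auto intro!: map_permutation_permutes simp: bij_betw_def inj_on_inv_into image_comp)
  fix p assume "p \<in> {q. q permutes (UNIV::'m set)}"
  then show "map_permutation (range h) (inv h) (map_permutation UNIV h p) = p"
    using assms by (intro map_permutation_compose_inv) (auto simp: bij_betw_def)
next
  fix p assume "p \<in> {p. p permutes range h}"
  then show "map_permutation UNIV h (map_permutation (range h) (inv h) p) = p"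
    using assms by (intro map_permutation_compose_inv)
      (auto simp: bij_betw_def inj_on_inv_into image_comp f_inv_into_f)
qed

text \<open>In the Leibniz expansion only the permutations that fix every index outside the range of \<open>h\<close>
contribute, and these are the permutations of the index type of the minor. The lemma serves twice:
with a bijection \<open>h\<close> it renames indices, and with \<open>h = Some\<close> it reduces a frame determinant to the
tangential block.\<close>

lemma det_restrict_to_range:
  fixes A :: "'a::comm_ring_1^'n^'n" and h :: "'m::finite \<Rightarrow> 'n"
  assumes h: "inj h" and A: "\<And>i j. i \<notin> range h \<Longrightarrow> A $ i $ j = (if i = j then 1 else 0)"
  shows "det A = det (\<chi> i j. A $ h i $ h j)"
proof -
  let ?t = "\<lambda>p. of_int (sign p) * (\<Prod>i\<in>UNIV. A $ i $ p i)"
  have "det A = sum ?t {p. p permutes UNIV}"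
    by (simp add: det_def)
  also have "\<dots> = sum ?t {p. p permutes range h}"
  proof (rule sum.mono_neutral_right)
    show "{p. p permutes range h} \<subseteq> {p. p permutes UNIV}"
      by (auto intro: permutes_subset)
    show "\<forall>p\<in>{p. p permutes UNIV} - {p. p permutes range h}. ?t p = 0"
    proof
      fix p assume p: "p \<in> {p. p permutes (UNIV::'n set)} - {p. p permutes range h}"
      then obtain i where i: "i \<notin> range h" "p i \<noteq> i"
        using permutes_superset[of p UNIV "range h"] by blast
      then have "A $ i $ p i = 0" using A by simp
      then have "(\<Prod>i\<in>UNIV. A $ i $ p i) = 0" by (intro prod_zero) auto
      then show "?t p = 0" by simp
    qed
  qed (simp add: finite_permutations)
  also have "\<dots> = (\<Sum>q\<in>{q. q permutes UNIV}. ?t (map_permutation UNIV h q))"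
    by (rule sum.reindex_bij_betw[OF permutes_range_map_permutation[OF h], symmetric])
  also have "\<dots> = det (\<chi> i j. A $ h i $ h j)"
    unfolding det_def
  proof (rule sum.cong[OF refl])
    fix q assume q: "q \<in> {q. q permutes (UNIV::'m set)}"
    let ?p = "map_permutation UNIV h q"
    have "(\<Prod>i\<in>UNIV. A $ i $ ?p i) = (\<Prod>i\<in>range h. A $ i $ ?p i)"
    proof (rule prod.mono_neutral_right)
      show "\<forall>i\<in>UNIV - range h. A $ i $ ?p i = 1"
        using A by (auto simp: map_permutation_def restrict_id_def)
    qed auto
    also have "\<dots> = (\<Prod>i\<in>UNIV. A $ h i $ ?p (h i))"
      by (simp add: prod.reindex[OF h] o_def)
    also have "\<dots> = (\<Prod>i\<in>UNIV. A $ h i $ h (q i))"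
      using h by (simp add: map_permutation_apply)
    finally show "?t ?p = of_int (sign q) * (\<Prod>i\<in>UNIV. (\<chi> i j. A $ h i $ h j) $ i $ q i)"
      using q h by (simp add: sign_map_permutation)
  qed
  finally show ?thesis .
qed

lemma frame_det_rows: "frame_det w u = det (\<chi> b. case b of None \<Rightarrow> w | Some j \<Rightarrow> u j)"
proof -
  have "(\<chi> a b. (case b of None \<Rightarrow> w | Some j \<Rightarrow> u j) $ a)
     = transpose (\<chi> b. case b of None \<Rightarrow> w | Some j \<Rightarrow> u j)"
    by (simp add: transpose_def vec_eq_iff)
  then show ?thesis unfolding frame_det_def by simp
qed

lemma linear_det_row:
  fixes A :: "real^'n^'n"
  shows "linear (\<lambda>x. det (\<chi> i. if i = k then x else A $ i))"
proof (rule linearI)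
  fix x y :: "real^'n" and c :: real
  show "det (\<chi> i. if i = k then x + y else A $ i)
      = det (\<chi> i. if i = k then x else A $ i) + det (\<chi> i. if i = k then y else A $ i)"
    by (rule det_row_add)
  show "det (\<chi> i. if i = k then c *\<^sub>R x else A $ i) = c *\<^sub>R det (\<chi> i. if i = k then x else A $ i)"
    using det_row_mul[of k c "\<lambda>_. x" "\<lambda>i. A $ i"] unfolding scalar_mult_eq_scaleR real_scaleR_def .
qed

lemma linear_frame_det: "linear (\<lambda>w. frame_det w u)"
proof -
  let ?A = "\<chi> b. case b of None \<Rightarrow> 0 | Some j \<Rightarrow> u j"
  have "(\<lambda>w. frame_det w u) = (\<lambda>w. det (\<chi> b. if b = None then w else ?A $ b))"
    unfolding frame_det_rows
    by (intro ext arg_cong[of _ _ det]) (simp add: vec_eq_iff split: option.split)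
  then show ?thesis using linear_det_row by simp
qed

lemma linear_frame_det_slot: "linear (\<lambda>x. frame_det w (u(j := x)))"
proof -
  let ?A = "\<chi> b. case b of None \<Rightarrow> w | Some j \<Rightarrow> u j"
  have "(\<lambda>x. frame_det w (u(j := x))) = (\<lambda>x. det (\<chi> b. if b = Some j then x else ?A $ b))"
    unfolding frame_det_rows
    by (intro ext arg_cong[of _ _ det]) (simp add: vec_eq_iff split: option.split)
  then show ?thesis using linear_det_row by simp
qed

lemma frame_det_repeated: "frame_det (u j) u = 0"
  unfolding frame_det_rows
  by (rule det_identical_rows[of None "Some j"]) (auto simp: row_def)

lemma frame_det_swap: "frame_det w (u(j := x)) = - frame_det x (u(j := w))"
proof -
  have rep: "frame_det v (u(j := v)) = 0" for v
    using frame_det_repeated[of "u(j := v)" j] by simp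
  have "0 = frame_det (w + x) (u(j := w + x))" using rep by simp
  also have "\<dots> = frame_det w (u(j := x)) + frame_det x (u(j := w))"
    using rep by (simp add: linear_add[OF linear_frame_det] linear_add[OF linear_frame_det_slot])
  finally show ?thesis by simp
qed

text \<open>The multiplicativity that makes frame determinants of differentials transform like \<open>n\<close>-forms under
a change of chart: the frame matrix of \<open>K \<circ> T\<close> is that of \<open>K\<close> times the block matrix of \<open>1\<close> and \<open>T\<close>.\<close>

lemma frame_det_compose:
  fixes K :: "real^'n \<Rightarrow> real^('n::finite option)" and T :: "real^'n \<Rightarrow> real^'n"
  assumes K: "linear K"
  shows "frame_det w (\<lambda>j. K (T (axis j 1))) = det (matrix T) * frame_det w (\<lambda>j. K (axis j 1))"
proof -
  let ?R = "\<lambda>u. \<chi> b. case b of None \<Rightarrow> w | Some j \<Rightarrow> u j"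
  define D :: "real^('n option)^('n option)" where
    "D = (\<chi> a b. case a of None \<Rightarrow> (if b = None then 1 else 0)
        | Some j \<Rightarrow> (case b of None \<Rightarrow> 0 | Some i \<Rightarrow> T (axis j 1) $ i))"
  have "det D = det (\<chi> i j. D $ Some i $ Some j)"
    by (rule det_restrict_to_range) (auto simp: D_def split: option.splits)
  also have "(\<chi> i j. D $ Some i $ Some j) = transpose (matrix T)"
    by (simp add: D_def transpose_def matrix_def vec_eq_iff)
  finally have D: "det D = det (matrix T)" by simp
  have KT: "K (T (axis j 1)) = (\<Sum>i\<in>UNIV. T (axis j 1) $ i *\<^sub>R K (axis i 1))" for j
  proof -
    have "T (axis j 1) = (\<Sum>i\<in>UNIV. T (axis j 1) $ i *\<^sub>R axis i 1)"
      using basis_expansion[of "T (axis j 1)"] by (simp add: scalar_mult_eq_scaleR)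
    then have "K (T (axis j 1)) = K (\<Sum>i\<in>UNIV. T (axis j 1) $ i *\<^sub>R axis i 1)" by simp
    also have "\<dots> = (\<Sum>i\<in>UNIV. T (axis j 1) $ i *\<^sub>R K (axis i 1))"
      by (simp add: linear_sum[OF K] linear_scale[OF K])
    finally show ?thesis .
  qed
  have "?R (\<lambda>j. K (T (axis j 1))) = D ** ?R (\<lambda>j. K (axis j 1))"
    by (auto simp: vec_eq_iff matrix_matrix_mult_def D_def KT UNIV_option_conv sum.reindex
        split: option.split)
  then show ?thesis by (simp add: frame_det_rows det_mul D)
qed

text \<open>Exchanging the coordinates \<open>None\<close> and \<open>k\<close> moves the basis vector \<open>axis k 1\<close> to the first place, where
it splits off. Through this lemma statements on determinants of maps of an \<open>n\<close>-dimensional space to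
itself become statements on frame determinants.\<close>

lemma frame_det_axis:
  fixes k :: "'n::finite option"
  shows "frame_det (axis k 1) u =
    of_int (sign (Transposition.transpose None k)) *
      det (\<chi> j i. u j $ Transposition.transpose None k (Some i))"
proof -
  let ?\<tau> = "Transposition.transpose None k"
  let ?A = "(\<chi> b. case b of None \<Rightarrow> axis k 1 | Some j \<Rightarrow> u j) :: real^('n option)^('n option)"
  have p: "?\<tau> permutes UNIV" by (simp add: permutes_swap_id)
  have "det (\<chi> a b. ?A $ a $ ?\<tau> b) = of_int (sign ?\<tau>) * det ?A"
    using det_permute_columns[OF p, of ?A] by simp
  moreover have "det (\<chi> a b. ?A $ a $ ?\<tau> b) = det (\<chi> j i. u j $ ?\<tau> (Some i))"
  proof (subst det_restrict_to_range[where h = Some])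
    fix a b :: "'n option" assume "a \<notin> range Some"
    then have "a = None" by (metis notin_range_Some)
    moreover have "(?\<tau> b = k) = (b = None)" by (metis transpose_apply_first transpose_involutory)
    ultimately show "(\<chi> a b. ?A $ a $ ?\<tau> b) $ a $ b = (if a = b then 1 else 0)"
      by (auto simp: axis_def)
  qed auto
  moreover have "of_int (sign ?\<tau>) * (of_int (sign ?\<tau>) * det ?A) = det ?A"
    by (simp add: mult.assoc[symmetric] of_int_mult[symmetric] sign_idempotent del: of_int_mult)
  ultimately show ?thesis by (simp add: frame_det_rows)
qed

lemma frame_det_zero:
  assumes "w \<noteq> 0" and "w \<bullet> v = 0" and "\<And>j. w \<bullet> u j = 0"
  shows "frame_det v u = 0"
proof (rule ccontr)
  let ?A = "(\<chi> b. case b of None \<Rightarrow> v | Some j \<Rightarrow> u j)"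
  assume "frame_det v u \<noteq> 0"
  then have "inj ((*v) ?A)"
    unfolding frame_det_rows by (metis det_nz_iff_inj matrix_vector_mul_linear matrix_of_matrix_vector_mul)
  moreover have "?A *v w = 0"
    using assms by (auto simp: vec_eq_iff matrix_vector_mult_def inner_vec_def mult.commute split: option.split)
  ultimately show False using \<open>w \<noteq> 0\<close> by (metis injD matrix_vector_mult_0_right)
qed

lemma frame_det_unit_normal_sq:
  assumes "norm w = 1" and "\<And>j. w \<bullet> u j = 0"
  shows "(frame_det w u)\<^sup>2 = det (\<chi> i j. u i \<bullet> u j)"
proof -
  let ?A = "(\<chi> b. case b of None \<Rightarrow> w | Some j \<Rightarrow> u j)"
  have e: "(?A ** transpose ?A) $ a $ b = ?A $ a \<bullet> ?A $ b" for a b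
    by (simp add: matrix_matrix_mult_def transpose_def inner_vec_def)
  have "(frame_det w u)\<^sup>2 = det (?A ** transpose ?A)"
    by (simp add: frame_det_rows det_mul power2_eq_square)
  also have "\<dots> = det (\<chi> i j. (?A ** transpose ?A) $ Some i $ Some j)"
  proof (rule det_restrict_to_range)
    fix a b :: "'a option" assume "a \<notin> range Some"
    then have "a = None" by (metis notin_range_Some)
    then show "(?A ** transpose ?A) $ a $ b = (if a = b then 1 else 0)"
      unfolding e using assms by (auto simp: norm_eq_1 split: option.split)
  qed simp
  finally show ?thesis by (simp add: e)
qed

text \<open>The polarisation of the determinant of a frame in its \<open>n\<close> last columns: the value at
\<open>(w, u, \<dots>, u, v)\<close> of the corresponding mixed determinant, up to the factor \<open>n\<close>. For the differentials
\<open>dh\<close> and \<open>da\<close> it is, up to a constant, the coefficient of \<open>det (w, dh, \<dots>, dh, da)\<close>.\<close>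

definition polar_det ::
  "real ^ ('n::finite option) \<Rightarrow> ('n \<Rightarrow> real ^ ('n option)) \<Rightarrow> ('n \<Rightarrow> real ^ ('n option)) \<Rightarrow> real" where
  "polar_det w u v = (\<Sum>j\<in>UNIV. frame_det w (u(j := v j)))"

text \<open>The Leibniz rule for the product in each term of the determinant; it is the reason for which
\<open>polar_det\<close> inherits the transformation law and the eigenvalue formula of \<open>frame_det\<close>.\<close>

lemma has_derivative_frame_det:
  assumes "\<And>j. ((\<lambda>s. u s j) has_vector_derivative v j) (at t)"
  shows "((\<lambda>s. frame_det w (u s)) has_real_derivative polar_det w (u t) v) (at t)"
proof -
  define R where "R = (\<lambda>u (b::'a option). case b of None \<Rightarrow> w | Some j \<Rightarrow> u j)"
  define v' where "v' = (\<lambda>(b::'a option). case b of None \<Rightarrow> 0 | Some j \<Rightarrow> v j)"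
  have d: "((\<lambda>s. R (u s) b $ c) has_real_derivative v' b $ c) (at t)" for b c
  proof (cases b)
    case (Some j)
    have "bounded_linear (\<lambda>x::real^('a option). x $ c)" by (rule bounded_linear_vec_nth)
    from bounded_linear.has_vector_derivative[OF this assms[of j]]
    show ?thesis using Some by (simp add: R_def v'_def has_real_derivative_iff_has_vector_derivative)
  qed (simp add: R_def v'_def)
  have "((\<lambda>s. \<Sum>p\<in>{p. p permutes UNIV}. of_int (sign p) * (\<Prod>b\<in>UNIV. R (u s) b $ p b))
    has_real_derivative (\<Sum>p\<in>{p. p permutes UNIV}. of_int (sign p) *
      (\<Sum>b\<in>UNIV. v' b $ p b * (\<Prod>c\<in>UNIV-{b}. R (u t) c $ p c)))) (at t)"
    by (intro DERIV_sum DERIV_cmult has_field_derivative_prod d)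
  moreover have "(\<lambda>s. frame_det w (u s)) =
      (\<lambda>s. \<Sum>p\<in>{p. p permutes UNIV}. of_int (sign p) * (\<Prod>b\<in>UNIV. R (u s) b $ p b))"
    by (simp add: fun_eq_iff frame_det_rows det_def R_def)
  moreover have "(\<Sum>p\<in>{p. p permutes UNIV}. of_int (sign p) *
      (\<Sum>b\<in>UNIV. v' b $ p b * (\<Prod>c\<in>UNIV-{b}. R (u t) c $ p c))) = polar_det w (u t) v"
  proof -
    have e: "v' (Some j) $ p (Some j) * (\<Prod>c\<in>UNIV-{Some j}. R (u t) c $ p c)
       = (\<Prod>c\<in>UNIV. R ((u t)(j := v j)) c $ p c)" for j p
    proof -
      have "(\<Prod>c\<in>UNIV-{Some j}. R (u t) c $ p c) = (\<Prod>c\<in>UNIV-{Some j}. R ((u t)(j := v j)) c $ p c)"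
        by (intro prod.cong) (auto simp: R_def split: option.split)
      then show ?thesis
        by (simp add: prod.remove[of UNIV "Some j"] v'_def R_def)
    qed
    have "(\<Sum>b\<in>UNIV. v' b $ p b * (\<Prod>c\<in>UNIV-{b}. R (u t) c $ p c))
      = (\<Sum>j\<in>UNIV. \<Prod>c\<in>UNIV. R ((u t)(j := v j)) c $ p c)" for p
    proof -
      have opt: "(\<Sum>b\<in>UNIV. g b) = g None + (\<Sum>j\<in>UNIV. g (Some j))" for g :: "'a option \<Rightarrow> real"
        by (simp add: UNIV_option_conv sum.reindex)
      show ?thesis unfolding opt e by (simp add: v'_def)
    qed
    then show ?thesis
      unfolding polar_det_def frame_det_rows det_def
      by (subst sum.swap) (simp add: sum_distrib_left R_def)
  qed
  ultimately show ?thesis by simp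
qed

section \<open>Change of variables\<close>

text \<open>A copy of a finite type, ordered by an enumeration. The change of variables formula is
obtained first for coordinates indexed by a well-ordered type and then transported to an arbitrary finite
index type along the permutation of coordinates, which preserves Lebesgue measure.\<close>

typedef 'n ordered = "UNIV :: 'n set" by simp

lemma bij_Rep_ordered: "bij Rep_ordered"
  by (metis (mono_tags) Abs_ordered_inverse Rep_ordered_inject UNIV_I bijI' )

instance ordered :: (finite) finite
proof
  show "finite (UNIV :: 'a ordered set)"
    using bij_betw_finite[OF bij_Rep_ordered[where ?'a = 'a]] by simp
qed

instantiation ordered :: (finite) wellorder
begin

definition less_eq_ordered :: "'a ordered \<Rightarrow> 'a ordered \<Rightarrow> bool" where
  "x \<le> y \<longleftrightarrow> to_nat (Rep_ordered x) \<le> to_nat (Rep_ordered y)"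

definition less_ordered :: "'a ordered \<Rightarrow> 'a ordered \<Rightarrow> bool" where
  "x < y \<longleftrightarrow> to_nat (Rep_ordered x) < to_nat (Rep_ordered y)"

instance
proof
  fix P :: "'a ordered \<Rightarrow> bool" and a
  assume step: "\<And>x. (\<And>y. y < x \<Longrightarrow> P y) \<Longrightarrow> P x"
  show "P a"
    by (induction a rule: measure_induct_rule[of "\<lambda>x. to_nat (Rep_ordered x)"])
      (rule step, simp add: less_ordered_def)
qed (auto simp: less_eq_ordered_def less_ordered_def Rep_ordered_inject)

end

text \<open>A permutation of the coordinates maps boxes to boxes with the same side lengths.\<close>

lemma lborel_distr_reindex:
  fixes h :: "'m::finite \<Rightarrow> 'n::finite"
  assumes h: "bij h"
  shows "distr lborel borel (\<lambda>x::real^'n. (\<chi> i. x $ h i) :: real^'m) = lborel"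
proof (rule lborel_eqI[symmetric])
  let ?E = "\<lambda>x::real^'n. (\<chi> i. x $ h i) :: real^'m"
  have meas: "?E \<in> borel_measurable lborel"
    by (simp, intro borel_measurable_continuous_onI continuous_intros)
  fix l u :: "real^'m" assume lu: "\<And>b. b \<in> Basis \<Longrightarrow> l \<bullet> b \<le> u \<bullet> b"
  let ?l = "(\<chi> j. l $ inv h j) :: real^'n" and ?u = "(\<chi> j. u $ inv h j) :: real^'n"
  have lu': "l $ i \<le> u $ i" for i
    using lu[of "axis i 1"] by (simp add: inner_axis axis_in_Basis_iff)
  have "?E -` box l u = box ?l ?u"
    using h by (auto simp: mem_box_cart bij_is_surj surj_f_inv_f) (metis bij_inv_eq_iff)+
  then have "emeasure (distr lborel borel ?E) (box l u) = emeasure lborel (box ?l ?u)"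
    using meas by (subst emeasure_distr) auto
  also have "\<dots> = (\<Prod>b\<in>Basis. (?u - ?l) \<bullet> b)"
    by (rule emeasure_lborel_box) (use lu' in \<open>auto simp: Basis_vec_def inner_axis\<close>)
  also have "(\<Prod>b\<in>Basis. (?u - ?l) \<bullet> b) = (\<Prod>j\<in>UNIV. (u - l) $ inv h j)"
    by (simp add: Basis_vec_def UNION_singleton_eq_range prod.reindex axis_eq_axis inj_on_def inner_axis)
  also have "\<dots> = (\<Prod>i\<in>UNIV. (u - l) $ i)"
    by (rule prod.reindex_bij_betw[of "inv h"]) (use h in \<open>simp add: bij_imp_bij_inv\<close>)
  also have "\<dots> = (\<Prod>b\<in>Basis. (u - l) \<bullet> b)"
    by (simp add: Basis_vec_def UNION_singleton_eq_range prod.reindex axis_eq_axis inj_on_def inner_axis)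
  finally show "emeasure (distr lborel borel ?E) (box l u) = (\<Prod>b\<in>Basis. (u - l) \<bullet> b)" .
qed simp

lemma set_integral_reindex:
  fixes h :: "'m::finite \<Rightarrow> 'n::finite" and F :: "real^'m \<Rightarrow> real"
  assumes h: "bij h" and F: "set_integrable lborel T F"
  defines "E \<equiv> (\<lambda>x::real^'n. (\<chi> i. x $ h i) :: real^'m)"
  assumes ST: "\<And>x. E x \<in> T \<longleftrightarrow> x \<in> S"
  shows "set_integrable lborel S (\<lambda>x. F (E x))"
    and "(LINT x:S|lborel. F (E x)) = (LINT y:T|lborel. F y)"
proof -
  have meas: "E \<in> borel_measurable lborel"
    unfolding E_def by (simp, intro borel_measurable_continuous_onI continuous_intros)
  have ind: "indicator T (E x) = (indicator S x :: real)" for x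
    using ST by (simp add: indicator_def)
  have F': "integrable (distr lborel borel E) (\<lambda>y. indicator T y *\<^sub>R F y)"
    using F unfolding set_integrable_def E_def lborel_distr_reindex[OF h] .
  show "set_integrable lborel S (\<lambda>x. F (E x))"
    using integrable_distr[OF _ F'] meas unfolding set_integrable_def ind by simp
  have "(LINT y:T|lborel. F y) = (LINT y|distr lborel borel E. indicator T y *\<^sub>R F y)"
    unfolding set_lebesgue_integral_def E_def lborel_distr_reindex[OF h] ..
  also have "\<dots> = (LINT x|lborel. indicator T (E x) *\<^sub>R F (E x))"
    using F' meas by (intro integral_distr) auto
  finally show "(LINT x:S|lborel. F (E x)) = (LINT y:T|lborel. F y)"
    unfolding set_lebesgue_integral_def ind by simp
qed

lemma set_integral_change_of_variables_wellorder:
  fixes g :: "real^'m::{finite,wellorder} \<Rightarrow> real^'m::_" and f :: "real^'m::_ \<Rightarrow> real"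
  assumes S: "open S"
    and der: "\<And>x. x \<in> S \<Longrightarrow> (g has_derivative g' x) (at x)"
    and inj: "inj_on g S"
    and f: "set_integrable lborel (g ` S) f"
    and fg: "set_integrable lborel S (\<lambda>x. \<bar>det (matrix (g' x))\<bar> * f (g x))"
  shows "(LINT x:S|lborel. \<bar>det (matrix (g' x))\<bar> * f (g x)) = (LINT y:g ` S|lborel. f y)"
proof -
  let ?f = "\<lambda>y. vec (f y) :: real^1"
  have S': "S \<in> sets lebesgue" using S by simp
  have "?f absolutely_integrable_on g ` S"
    unfolding absolutely_integrable_on_1_iff using f
    unfolding set_integrable_def by (simp add: integrable_completion)
  then have "integral (g ` S) ?f = integral S (\<lambda>x. \<bar>det (matrix (g' x))\<bar> *\<^sub>R ?f (g x))"
    by (intro integral_change_of_variables[OF S' has_derivative_at_withinI[OF der] inj disjI1])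
  then have "integral (g ` S) f = integral S (\<lambda>x. \<bar>det (matrix (g' x))\<bar> * f (g x))"
    by (simp add: integral_on_1_eq)
  then show ?thesis
    by (simp add: set_borel_integral_eq_integral(2)[OF f] set_borel_integral_eq_integral(2)[OF fg])
qed

text \<open>Conjugate \<open>g\<close> with the relabelling \<open>?E\<close> of coordinates and its inverse \<open>?D\<close>; the Jacobian
determinant does not change because rows and columns are renamed alike.\<close>

lemma set_integral_change_of_variables:
  fixes g :: "real^'n::finite \<Rightarrow> real^'n::_" and f :: "real^'n \<Rightarrow> real"
  assumes S: "open S"
    and der: "\<And>x. x \<in> S \<Longrightarrow> (g has_derivative g' x) (at x)"
    and inj: "inj_on g S"
    and f: "set_integrable lborel (g ` S) f"
    and fg: "set_integrable lborel S (\<lambda>x. \<bar>det (matrix (g' x))\<bar> * f (g x))"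
  shows "(LINT x:S|lborel. \<bar>det (matrix (g' x))\<bar> * f (g x)) = (LINT y:g ` S|lborel. f y)"
proof -
  let ?E = "\<lambda>x::real^'n. (\<chi> i. x $ Rep_ordered i) :: real^('n ordered)"
  let ?D = "\<lambda>y::real^('n ordered). (\<chi> i. y $ Abs_ordered i) :: real^'n"
  have bR: "bij (Rep_ordered :: 'n ordered \<Rightarrow> 'n)" by (rule bij_Rep_ordered)
  have bA: "bij (Abs_ordered :: 'n \<Rightarrow> 'n ordered)"
    by (metis Abs_ordered_inverse Rep_ordered_inverse UNIV_I bij_betw_def bijI')
  have DE [simp]: "?D (?E x) = x" and ED [simp]: "?E (?D y) = y" for x y
    by (simp_all add: vec_eq_iff Abs_ordered_inverse Rep_ordered_inverse)
  have lE: "bounded_linear ?E" and lD: "bounded_linear ?D"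
    by (auto intro!: linear_conv_bounded_linear[THEN iffD1] linearI simp: vec_eq_iff)
  define G where "G = (\<lambda>y. ?E (g (?D y)))"
  define G' where "G' = (\<lambda>y v. ?E (g' (?D y) (?D v)))"
  define T where "T = ?D -` S"
  have T: "open T"
    unfolding T_def using S lD by (intro continuous_open_vimage linear_continuous_at) auto
  have ET: "?E x \<in> T \<longleftrightarrow> x \<in> S" for x unfolding T_def vimage_eq DE ..
  have DS: "?D y \<in> S \<longleftrightarrow> y \<in> T" for y by (simp add: T_def)
  have DgS: "?D y \<in> g ` S \<longleftrightarrow> y \<in> G ` T" for y
  proof
    assume "?D y \<in> g ` S"
    then obtain x where x: "x \<in> S" "?D y = g x" by blast
    have "y = ?E (?D y)" by (rule ED[symmetric])
    also have "\<dots> = G (?E x)" unfolding G_def x(2) DE ..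
    finally show "y \<in> G ` T" using x(1) ET by blast
  next
    assume "y \<in> G ` T"
    then obtain z where z: "z \<in> T" "y = G z" by blast
    have "?D y = g (?D z)" unfolding z(2) G_def by (rule DE)
    then show "?D y \<in> g ` S" using z(1) DS by blast
  qed
  have det: "det (matrix (G' y)) = det (matrix (g' (?D y)))" for y
  proof -
    have ax: "?D (axis j 1) = axis (Rep_ordered j) 1" for j
      by (auto simp: vec_eq_iff axis_def Abs_ordered_inverse Rep_ordered_inverse)
    have "det (matrix (g' (?D y))) = det (\<chi> i j. matrix (g' (?D y)) $ Rep_ordered i $ Rep_ordered j)"
      by (rule det_restrict_to_range) (use bR in \<open>auto simp: bij_def\<close>)
    also have "(\<chi> i j. matrix (g' (?D y)) $ Rep_ordered i $ Rep_ordered j) = matrix (G' y)"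
      by (simp only: vec_eq_iff matrix_def G'_def ax vec_lambda_beta simp_thms)
    finally show ?thesis ..
  qed
  have derG: "(G has_derivative G' y) (at y)" if "y \<in> T" for y
  proof -
    have "(g has_derivative g' (?D y)) (at (?D y))" using that der by (simp add: T_def)
    then have "((\<lambda>y. g (?D y)) has_derivative (\<lambda>v. g' (?D y) (?D v))) (at y)"
      by (rule has_derivative_compose[OF bounded_linear_imp_has_derivative[OF lD]])
    then show ?thesis
      unfolding G_def G'_def by (rule bounded_linear.has_derivative[OF lE])
  qed
  have injG: "inj_on G T"
  proof (rule inj_onI)
    fix y z assume "y \<in> T" "z \<in> T" "G y = G z"
    then have "?D y \<in> S" "?D z \<in> S" "g (?D y) = g (?D z)" by (metis T_def vimageE G_def DE)+
    then have "?D y = ?D z" using inj_onD[OF inj] by blast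
    then show "y = z" by (metis ED)
  qed
  have fD: "set_integrable lborel (G ` T) (\<lambda>y. f (?D y))"
      "(LINT y:G ` T|lborel. f (?D y)) = (LINT x:g ` S|lborel. f x)"
    using set_integral_reindex[OF bA f DgS] by simp_all
  have eq: "\<bar>det (matrix (g' (?D y)))\<bar> * f (g (?D y)) = \<bar>det (matrix (G' y))\<bar> * f (?D (G y))" for y
    unfolding det G_def DE ..
  have gD: "set_integrable lborel T (\<lambda>y. \<bar>det (matrix (G' y))\<bar> * f (?D (G y)))"
     "(LINT y:T|lborel. \<bar>det (matrix (G' y))\<bar> * f (?D (G y)))
        = (LINT x:S|lborel. \<bar>det (matrix (g' x))\<bar> * f (g x))"
    using set_integral_reindex[OF bA fg DS] unfolding eq by simp_all
  show ?thesis
    using set_integral_change_of_variables_wellorder[OF T derG injG fD(1) gD(1)] fD(2) gD(2) by simp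
qed

section \<open>Continuously differentiable maps\<close>

text \<open>A reformulation of \<open>C1_on\<close> with the canonical derivative in place of an existential one. It is
checked locally, and continuity of the derivative is only asked in each direction, which in finite
dimension amounts to continuity in the operator norm.\<close>

definition C1_diff_on :: "'a::real_normed_vector set \<Rightarrow> ('a \<Rightarrow> 'b::real_normed_vector) \<Rightarrow> bool" where
  "C1_diff_on S g \<longleftrightarrow> (\<forall>x\<in>S. g differentiable (at x)) \<and>
     (\<forall>v. continuous_on S (\<lambda>x. frechet_derivative g (at x) v))"

lemma C1_diff_onI:
  assumes "\<And>x. x \<in> S \<Longrightarrow> (g has_derivative g' x) (at x)" and "\<And>v. continuous_on S (\<lambda>x. g' x v)"
  shows "C1_diff_on S g"
proof -
  have "frechet_derivative g (at x) = g' x" if "x \<in> S" for x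
    using assms(1)[OF that] by (metis frechet_derivative_at)
  then show ?thesis
    using assms unfolding C1_diff_on_def differentiable_def
    by (auto cong: continuous_on_cong)
qed

lemma C1_diff_on_has_derivative:
  "C1_diff_on S g \<Longrightarrow> x \<in> S \<Longrightarrow> (g has_derivative frechet_derivative g (at x)) (at x)"
  by (simp add: C1_diff_on_def frechet_derivative_works)

lemma C1_diff_on_deriv_continuous:
  "C1_diff_on S g \<Longrightarrow> continuous_on S (\<lambda>x. frechet_derivative g (at x) v)"
  by (simp add: C1_diff_on_def)

lemma C1_diff_on_differentiable: "C1_diff_on S g \<Longrightarrow> x \<in> S \<Longrightarrow> g differentiable (at x)"
  by (simp add: C1_diff_on_def)

lemma C1_diff_on_continuous: "C1_diff_on S g \<Longrightarrow> continuous_on S g"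
  by (meson C1_diff_on_has_derivative continuous_at_imp_continuous_on has_derivative_continuous)

lemma C1_on_imp_C1_diff_on: "C1_on S g \<Longrightarrow> C1_diff_on S g"
  unfolding C1_on_def
  by (auto intro!: C1_diff_onI continuous_intros)

lemma C1_diff_on_const [simp]: "C1_diff_on S (\<lambda>x. c)"
  by (rule C1_diff_onI[where g' = "\<lambda>x v. 0"]) auto

lemma C1_diff_on_linear:
  assumes "bounded_linear l" and "C1_diff_on S g" shows "C1_diff_on S (\<lambda>x. l (g x))"
  by (rule C1_diff_onI[OF bounded_linear.has_derivative[OF assms(1) C1_diff_on_has_derivative[OF assms(2)]]])
    (auto intro: bounded_linear.continuous_on[OF assms(1)] C1_diff_on_deriv_continuous[OF assms(2)])

lemma C1_diff_on_bilinear: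
  assumes "bounded_bilinear p" and f: "C1_diff_on S f" and g: "C1_diff_on S g"
  shows "C1_diff_on S (\<lambda>x. p (f x) (g x))"
proof (rule C1_diff_onI)
  fix x assume "x \<in> S"
  then show "((\<lambda>x. p (f x) (g x)) has_derivative
      (\<lambda>v. p (f x) (frechet_derivative g (at x) v) + p (frechet_derivative f (at x) v) (g x))) (at x)"
    by (intro bounded_bilinear.FDERIV[OF assms(1)] C1_diff_on_has_derivative[OF f]
        C1_diff_on_has_derivative[OF g])
next
  fix v show "continuous_on S
      (\<lambda>x. p (f x) (frechet_derivative g (at x) v) + p (frechet_derivative f (at x) v) (g x))"
    by (intro continuous_on_add bounded_bilinear.continuous_on[OF assms(1)]
        C1_diff_on_deriv_continuous f g C1_diff_on_continuous[OF f] C1_diff_on_continuous[OF g])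
qed

lemmas C1_diff_on_scaleR = C1_diff_on_bilinear[OF bounded_bilinear_scaleR]
  and C1_diff_on_mult = C1_diff_on_bilinear[OF bounded_bilinear_mult]
  and C1_diff_on_inner = C1_diff_on_bilinear[OF bounded_bilinear_inner]

lemma C1_diff_on_add:
  assumes f: "C1_diff_on S f" and g: "C1_diff_on S g"
  shows "C1_diff_on S (\<lambda>x. f x + g x)"
  by (rule C1_diff_onI[OF has_derivative_add[OF C1_diff_on_has_derivative[OF f] C1_diff_on_has_derivative[OF g]]])
    (auto intro!: continuous_intros C1_diff_on_deriv_continuous f g)

lemma C1_diff_on_sum:
  assumes "\<And>i. i \<in> I \<Longrightarrow> C1_diff_on S (f i)"
  shows "C1_diff_on S (\<lambda>x. \<Sum>i\<in>I. f i x)"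
  using assms by (induction I rule: infinite_finite_induct) (auto intro: C1_diff_on_add)

lemma C1_diff_on_prod:
  fixes f :: "'i \<Rightarrow> 'a::real_normed_vector \<Rightarrow> real"
  assumes "\<And>i. i \<in> I \<Longrightarrow> C1_diff_on S (f i)"
  shows "C1_diff_on S (\<lambda>x. \<Prod>i\<in>I. f i x)"
  using assms by (induction I rule: infinite_finite_induct) (auto intro: C1_diff_on_mult)

lemma C1_diff_on_cong:
  assumes S: "open S" and f: "C1_diff_on S f" and eq: "\<And>x. x \<in> S \<Longrightarrow> f x = g x"
  shows "C1_diff_on S g"
  by (rule C1_diff_onI[OF has_derivative_transform_within_open[OF C1_diff_on_has_derivative[OF f] S _ eq]])
    (auto intro: C1_diff_on_deriv_continuous f)

lemma C1_diff_on_local: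
  assumes "\<And>x. x \<in> S \<Longrightarrow> \<exists>T. open T \<and> x \<in> T \<and> C1_diff_on T g"
  shows "C1_diff_on S g"
  unfolding C1_diff_on_def
proof (intro conjI ballI allI)
  fix x assume "x \<in> S"
  then show "g differentiable at x" using assms by (meson C1_diff_on_differentiable)
next
  fix v show "continuous_on S (\<lambda>x. frechet_derivative g (at x) v)"
  proof (rule continuous_at_imp_continuous_on, rule ballI)
    fix x assume "x \<in> S"
    then obtain T where T: "open T" "x \<in> T" "C1_diff_on T g" using assms by blast
    then show "isCont (\<lambda>x. frechet_derivative g (at x) v) x"
      using C1_diff_on_deriv_continuous continuous_on_eq_continuous_at by blast
  qed
qed

text \<open>The outer derivative is evaluated on a direction that moves with the point; expanding this direction in the
standard basis reduces its continuity to that of finitely many directional derivatives.\<close>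

lemma C1_diff_on_compose:
  fixes g :: "'a::euclidean_space \<Rightarrow> 'b::real_normed_vector"
  assumes f: "C1_diff_on S f" and g: "C1_diff_on T g" and ST: "f ` S \<subseteq> T"
  shows "C1_diff_on S (\<lambda>x. g (f x))"
proof (rule C1_diff_onI)
  fix x assume "x \<in> S"
  then show "((\<lambda>x. g (f x)) has_derivative
     (\<lambda>v. frechet_derivative g (at (f x)) (frechet_derivative f (at x) v))) (at x)"
    using ST by (intro has_derivative_compose[OF C1_diff_on_has_derivative[OF f]]
        C1_diff_on_has_derivative[OF g]) auto
next
  fix v
  have lin: "linear (frechet_derivative g (at (f x)))" if "x \<in> S" for x
    using that ST C1_diff_on_has_derivative[OF g, of "f x"] has_derivative_linear by blast
  have "continuous_on S (\<lambda>x. \<Sum>b\<in>Basis. (frechet_derivative f (at x) v \<bullet> b) *\<^sub>R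
      frechet_derivative g (at (f x)) b)"
    by (intro continuous_intros C1_diff_on_deriv_continuous[OF f]
        continuous_on_compose2[OF C1_diff_on_deriv_continuous[OF g] C1_diff_on_continuous[OF f] ST])
  moreover have "frechet_derivative g (at (f x)) (frechet_derivative f (at x) v) =
     (\<Sum>b\<in>Basis. (frechet_derivative f (at x) v \<bullet> b) *\<^sub>R frechet_derivative g (at (f x)) b)" if "x \<in> S" for x
  proof -
    have "frechet_derivative g (at (f x)) (\<Sum>b\<in>Basis. (frechet_derivative f (at x) v \<bullet> b) *\<^sub>R b)
      = (\<Sum>b\<in>Basis. (frechet_derivative f (at x) v \<bullet> b) *\<^sub>R frechet_derivative g (at (f x)) b)"
      by (simp only: linear_sum[OF lin[OF that]] linear_scale[OF lin[OF that]])
    then show ?thesis by (simp only: euclidean_representation)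
  qed
  ultimately show "continuous_on S (\<lambda>x. frechet_derivative g (at (f x)) (frechet_derivative f (at x) v))"
    by (simp cong: continuous_on_cong)
qed

lemma C1_diff_on_real_compose:
  fixes f :: "'a::real_normed_vector \<Rightarrow> real"
  assumes f: "C1_diff_on S f" and g: "\<And>t. t \<in> T \<Longrightarrow> (g has_real_derivative g' t) (at t)"
    and g': "continuous_on T g'" and ST: "f ` S \<subseteq> T"
  shows "C1_diff_on S (\<lambda>x. g (f x))"
proof (rule C1_diff_on_compose[OF f _ ST])
  show "C1_diff_on T g"
    by (rule C1_diff_onI[OF g[unfolded has_field_derivative_def]]) (auto intro!: continuous_intros g')
qed

lemma C1_diff_on_frame_det:
  assumes w: "C1_diff_on S w" and u: "\<And>j. C1_diff_on S (u j)"
  shows "C1_diff_on S (\<lambda>x. frame_det (w x) (\<lambda>j. u j x))"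
proof -
  have "C1_diff_on S (\<lambda>x. (case b of None \<Rightarrow> w x | Some j \<Rightarrow> u j x) $ c)" for b c
    using w u by (cases b) (auto intro: C1_diff_on_linear[OF bounded_linear_vec_nth])
  then show ?thesis
    unfolding frame_det_rows det_def
    by (intro C1_diff_on_sum C1_diff_on_mult C1_diff_on_prod C1_diff_on_const) auto
qed

lemma C1_diff_on_vec_lambda:
  assumes "\<And>i. C1_diff_on S (f i)"
  shows "C1_diff_on S (\<lambda>x. (\<chi> i. f i x) :: real^'n)"
proof -
  have "(\<chi> i. f i x) = (\<Sum>i\<in>UNIV. f i x *\<^sub>R axis i 1)" for x
    using basis_expansion[of "\<chi> i. f i x"] by (simp add: scalar_mult_eq_scaleR)
  then show ?thesis using assms by (simp add: C1_diff_on_sum C1_diff_on_scaleR)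
qed

lemma continuous_on_det:
  fixes A :: "'a::topological_space \<Rightarrow> real^'n^'n"
  assumes "\<And>i j. continuous_on S (\<lambda>x. A x $ i $ j)"
  shows "continuous_on S (\<lambda>x. det (A x))"
  unfolding det_def
  by (intro continuous_on_sum continuous_on_mult continuous_on_const continuous_on_prod assms)

lemma continuous_on_frame_det:
  assumes w: "continuous_on S w" and u: "\<And>j. continuous_on S (u j)"
  shows "continuous_on S (\<lambda>x. frame_det (w x) (\<lambda>j. u j x))"
proof -
  have "continuous_on S (\<lambda>x. (case b of None \<Rightarrow> w x | Some j \<Rightarrow> u j x) $ c)" for b c
    using w u by (cases b) (auto intro!: continuous_intros)
  then show ?thesis unfolding frame_det_rows by (intro continuous_on_det) simp
qed

section \<open>Polynomials with continuous coefficients\<close>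

text \<open>Polynomials in \<open>t\<close> of bounded degree whose coefficients depend continuously on a point. They can be
integrated coefficient by coefficient, and identities between them can be compared coefficient by
coefficient.\<close>

definition poly_continuous_on :: "'a::topological_space set \<Rightarrow> (real \<Rightarrow> 'a \<Rightarrow> real) \<Rightarrow> bool" where
  "poly_continuous_on S F \<longleftrightarrow> (\<exists>d c. (\<forall>k. continuous_on S (c k)) \<and>
     (\<forall>x\<in>S. \<forall>t. F t x = (\<Sum>k\<le>d. c k x * t ^ k)))"

lemma poly_continuous_on_affine:
  assumes "continuous_on S a" "continuous_on S b"
  shows "poly_continuous_on S (\<lambda>t x. a x + t * b x)"
  unfolding poly_continuous_on_def
  using assms
  by (intro exI[of _ 1] exI[of _ "\<lambda>k. if k = 0 then a else b"]) (auto simp: mult.commute)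

lemma poly_continuous_on_const:
  assumes "continuous_on S a" shows "poly_continuous_on S (\<lambda>t x. a x)"
  using poly_continuous_on_affine[OF assms continuous_on_const[of _ 0]] by simp

lemma poly_continuous_on_padded:
  assumes "poly_continuous_on S F"
  shows "\<exists>c d. (\<forall>k. continuous_on S (c k)) \<and> (\<forall>k>d. \<forall>x. c k x = 0) \<and>
    (\<forall>x\<in>S. \<forall>t. F t x = (\<Sum>k\<le>d. c k x * t ^ k))"
proof -
  obtain d c where c: "\<And>k. continuous_on S (c k)" "\<And>x t. x \<in> S \<Longrightarrow> F t x = (\<Sum>k\<le>d. c k x * t ^ k)"
    using assms unfolding poly_continuous_on_def by blast
  have "continuous_on S (\<lambda>x. if k \<le> d then c k x else 0)" for k
    using c(1) by (cases "k \<le> d") auto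
  then show ?thesis
    by (intro exI[of _ "\<lambda>k x. if k \<le> d then c k x else 0"] exI[of _ d]) (use c in auto)
qed

lemma poly_continuous_on_add:
  assumes "poly_continuous_on S F" "poly_continuous_on S G"
  shows "poly_continuous_on S (\<lambda>t x. F t x + G t x)"
proof -
  obtain c d where c: "\<forall>k. continuous_on S (c k)" "\<forall>k>d. \<forall>x. c k x = 0"
    "\<forall>x\<in>S. \<forall>t. F t x = (\<Sum>k\<le>d. c k x * t ^ k)"
    using poly_continuous_on_padded[OF assms(1)] by (elim exE conjE)
  obtain b e where b: "\<forall>k. continuous_on S (b k)" "\<forall>k>e. \<forall>x. b k x = 0"
    "\<forall>x\<in>S. \<forall>t. G t x = (\<Sum>k\<le>e. b k x * t ^ k)"
    using poly_continuous_on_padded[OF assms(2)] by (elim exE conjE)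
  have "F t x + G t x = (\<Sum>k\<le>max d e. (c k x + b k x) * t ^ k)" if "x \<in> S" for t x
  proof -
    have "(\<Sum>k\<le>d. c k x * t ^ k) = (\<Sum>k\<le>max d e. c k x * t ^ k)"
      by (rule sum.mono_neutral_left) (use c in auto)
    moreover have "(\<Sum>k\<le>e. b k x * t ^ k) = (\<Sum>k\<le>max d e. b k x * t ^ k)"
      by (rule sum.mono_neutral_left) (use b in auto)
    ultimately show ?thesis using c(3) b(3) that by (simp add: sum.distrib distrib_right)
  qed
  then show ?thesis unfolding poly_continuous_on_def
    using c(1) b(1) by (intro exI[of _ "max d e"] exI[of _ "\<lambda>k x. c k x + b k x"]) (auto intro!: continuous_intros)
qed

lemma poly_continuous_on_mult:
  assumes "poly_continuous_on S F" "poly_continuous_on S G"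
  shows "poly_continuous_on S (\<lambda>t x. F t x * G t x)"
proof -
  obtain c d where c: "\<forall>k. continuous_on S (c k)" "\<forall>k>d. \<forall>x. c k x = 0"
    "\<forall>x\<in>S. \<forall>t. F t x = (\<Sum>k\<le>d. c k x * t ^ k)"
    using poly_continuous_on_padded[OF assms(1)] by (elim exE conjE)
  obtain b e where b: "\<forall>k. continuous_on S (b k)" "\<forall>k>e. \<forall>x. b k x = 0"
    "\<forall>x\<in>S. \<forall>t. G t x = (\<Sum>k\<le>e. b k x * t ^ k)"
    using poly_continuous_on_padded[OF assms(2)] by (elim exE conjE)
  have "F t x * G t x = (\<Sum>r\<le>d+e. (\<Sum>k\<le>r. c k x * b (r - k) x) * t ^ r)" if "x \<in> S" for t x
    using polynomial_product[of d "\<lambda>k. c k x" e "\<lambda>k. b k x" t] c b that by simp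
  then show ?thesis unfolding poly_continuous_on_def
    using c(1) b(1) by (intro exI[of _ "d+e"] exI[of _ "\<lambda>r x. \<Sum>k\<le>r. c k x * b (r - k) x"])
      (auto intro!: continuous_intros)
qed

lemma poly_continuous_on_sum:
  assumes "\<And>i. i \<in> I \<Longrightarrow> poly_continuous_on S (F i)"
  shows "poly_continuous_on S (\<lambda>t x. \<Sum>i\<in>I. F i t x)"
  using assms
  by (induction I rule: infinite_finite_induct)
    (auto intro: poly_continuous_on_add poly_continuous_on_const)

lemma poly_continuous_on_prod:
  assumes "\<And>i. i \<in> I \<Longrightarrow> poly_continuous_on S (F i)"
  shows "poly_continuous_on S (\<lambda>t x. \<Prod>i\<in>I. F i t x)"
  using assms
  by (induction I rule: infinite_finite_induct)
    (auto intro: poly_continuous_on_mult poly_continuous_on_const)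

lemma poly_continuous_on_det:
  assumes "\<And>i j. continuous_on S (\<lambda>x. A x $ i $ j)" "\<And>i j. continuous_on S (\<lambda>x. B x $ i $ j)"
  shows "poly_continuous_on S (\<lambda>t x. det (A x + t *\<^sub>R B x))"
  unfolding det_def
  by (intro poly_continuous_on_sum poly_continuous_on_mult poly_continuous_on_prod poly_continuous_on_const
      continuous_on_const) (simp add: poly_continuous_on_affine assms)

lemma polyfun_eq_if_eq_on_infinite:
  fixes a b :: "nat \<Rightarrow> real"
  assumes "infinite T" and "\<And>t. t \<in> T \<Longrightarrow> (\<Sum>k\<le>m. a k * t ^ k) = (\<Sum>k\<le>n. b k * t ^ k)"
  shows "(\<Sum>k\<le>m. a k * t ^ k) = (\<Sum>k\<le>n. b k * t ^ k)"
proof -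
  define p where "p = (\<Sum>k\<le>m. monom (a k) k) - (\<Sum>k\<le>n. monom (b k) k)"
  have p: "poly p t = (\<Sum>k\<le>m. a k * t ^ k) - (\<Sum>k\<le>n. b k * t ^ k)" for t
    by (simp add: p_def poly_sum poly_monom)
  then have "T \<subseteq> {t. poly p t = 0}" using assms(2) by auto
  then have "p = 0" using assms(1) poly_roots_finite[of p] finite_subset by blast
  then show ?thesis using p[of t] by simp
qed

section \<open>The integral of a Jacobian determinant\<close>

lemma continuous_ball_set_integrable:
  fixes g :: "'a::euclidean_space \<Rightarrow> real"
  assumes "continuous_on UNIV g"
  shows "set_integrable lborel (ball a R) g"
proof (rule set_integrable_subset)
  show "set_integrable lborel (cball a R) g"
    unfolding set_integrable_def
    by (intro borel_integrable_compact) (auto intro: continuous_on_subset[OF assms])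
qed auto

lemma norm_le_of_columns:
  fixes L :: "real^'n \<Rightarrow> 'b::real_normed_vector"
  assumes L: "linear L" and B: "\<And>j. norm (L (axis j 1)) \<le> B j"
  shows "norm (L v) \<le> (\<Sum>j\<in>UNIV. B j) * norm v"
proof -
  have "L v = L (\<Sum>j\<in>UNIV. v $ j *\<^sub>R axis j 1)"
    using basis_expansion[of v] by (simp add: scalar_mult_eq_scaleR)
  also have "\<dots> = (\<Sum>j\<in>UNIV. v $ j *\<^sub>R L (axis j 1))"
    by (simp add: linear_sum[OF L] linear_scale[OF L])
  also have "norm \<dots> \<le> (\<Sum>j\<in>UNIV. B j * norm v)"
  proof (rule sum_norm_le)
    fix j
    have "\<bar>v $ j\<bar> * norm (L (axis j 1)) \<le> norm v * B j"
      by (intro mult_mono component_le_norm_cart B) auto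
    then show "norm (v $ j *\<^sub>R L (axis j 1)) \<le> B j * norm v" by (simp add: mult.commute)
  qed
  finally show ?thesis by (simp add: sum_distrib_right)
qed

text \<open>For \<open>r > L\<close> the equation \<open>r x + w x = y\<close> is a fixed point problem for the contraction
\<open>x \<mapsto> (y - w x) / r\<close>. So \<open>x \<mapsto> r x + w x\<close> is a bijection of the whole space; as it is the dilation by \<open>r\<close>
outside the ball, it must map the ball onto the dilated ball.\<close>

lemma perturbed_dilation:
  fixes w :: "'a::euclidean_space \<Rightarrow> 'a"
  assumes lip: "\<And>x y. norm (w x - w y) \<le> L * norm (x - y)" and L: "0 \<le> L" "L < r"
    and zero: "\<And>x. R \<le> norm x \<Longrightarrow> w x = 0"
  shows "inj (\<lambda>x. r *\<^sub>R x + w x)" and "(\<lambda>x. r *\<^sub>R x + w x) ` ball 0 R = ball 0 (r * R)"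
proof -
  let ?u = "\<lambda>x. r *\<^sub>R x + w x"
  have r: "r > 0" using L by simp
  have inj: "x = y" if "?u x = ?u y" for x y
  proof (rule ccontr)
    assume ne: "x \<noteq> y"
    have "r *\<^sub>R (x - y) = w y - w x" using that by (simp add: algebra_simps)
    then have "r * norm (x - y) = norm (w y - w x)"
      using r by (metis abs_of_pos norm_scaleR)
    also have "\<dots> \<le> L * norm (x - y)" using lip[of y x] by (simp add: norm_minus_commute)
    finally show False using ne L by (simp add: mult_le_cancel_right)
  qed
  then show "inj ?u" by (rule injI)
  have surj: "\<exists>x. ?u x = y" for y
  proof -
    have "\<exists>!x\<in>UNIV. (1 / r) *\<^sub>R (y - w x) = x"
    proof (rule Banach_fix[of _ "L / r"])
      fix x z :: 'a
      have "dist ((1 / r) *\<^sub>R (y - w x)) ((1 / r) *\<^sub>R (y - w z)) = norm ((1 / r) *\<^sub>R (w z - w x))"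
        by (simp add: dist_norm algebra_simps)
      also have "\<dots> = norm (w x - w z) / r" using r by (simp add: norm_minus_commute)
      also have "\<dots> \<le> L / r * dist x z"
        using divide_right_mono[OF lip[of x z], of r] r by (simp add: dist_norm)
      finally show "dist ((1 / r) *\<^sub>R (y - w x)) ((1 / r) *\<^sub>R (y - w z)) \<le> L / r * dist x z" .
    qed (use L r in \<open>auto simp: complete_UNIV\<close>)
    then obtain x where "(1 / r) *\<^sub>R (y - w x) = x" by blast
    then have "r *\<^sub>R ((1 / r) *\<^sub>R (y - w x)) = r *\<^sub>R x" by simp
    then have "y - w x = r *\<^sub>R x" using r by simp
    then show ?thesis by (metis diff_add_cancel)
  qed
  show "?u ` ball 0 R = ball 0 (r * R)"
  proof (intro equalityI subsetI)
    fix y assume "y \<in> ?u ` ball 0 R"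
    then obtain x where x: "norm x < R" "y = ?u x" by auto
    show "y \<in> ball 0 (r * R)"
    proof (rule ccontr)
      assume "y \<notin> ball 0 (r * R)"
      then have R: "R \<le> norm ((1 / r) *\<^sub>R y)" using r by (simp add: field_simps)
      then have "?u ((1 / r) *\<^sub>R y) = y" using zero[OF R] r by simp
      then have "x = (1 / r) *\<^sub>R y" using inj[of x "(1 / r) *\<^sub>R y"] x(2) by argo
      then show False using R x(1) by (metis not_le)
    qed
  next
    fix y :: 'a assume y: "y \<in> ball 0 (r * R)"
    obtain x where x: "?u x = y" using surj by blast
    have "norm x < R"
    proof (rule ccontr)
      assume "\<not> norm x < R"
      then have "y = r *\<^sub>R x" and "R \<le> norm x" using x zero by auto
      then have "r * R \<le> norm y" using r by simp
      then show False using y by simp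
    qed
    then show "y \<in> ?u ` ball 0 R" using x by force
  qed
qed

text \<open>\<open>det (I + s W)\<close> is 1 at \<open>s = 0\<close> and cannot vanish while \<open>s L < 1\<close>, since then \<open>I + s W\<close> is injective;
so it stays positive up to \<open>s = 1 / r\<close>. The sign is needed because the change of variables formula
involves the absolute value of the determinant.\<close>

lemma det_pos_of_dominant_scalar:
  fixes W :: "real^'n \<Rightarrow> real^'n"
  assumes W: "linear W" and L: "\<And>v. norm (W v) \<le> L * norm v" "0 \<le> L" "L < r"
  shows "det (r *\<^sub>R mat 1 + matrix W) > 0"
proof -
  have nz: "det (mat 1 + s *\<^sub>R matrix W) \<noteq> 0" if s: "0 \<le> s" "s * L < 1" for s
  proof -
    have "inj (\<lambda>v. (mat 1 + s *\<^sub>R matrix W) *v v)"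
      unfolding linear_injective_0[OF matrix_vector_mul_linear]
    proof (intro allI impI)
      fix v assume "(mat 1 + s *\<^sub>R matrix W) *v v = 0"
      then have "v = - (s *\<^sub>R W v)"
        by (simp add: matrix_vector_mult_add_rdistrib scaleR_matrix_vector_assoc[symmetric]
            fun_cong[OF matrix_vector_mul(2)[OF W]] eq_neg_iff_add_eq_0)
      then have "norm v = s * norm (W v)" using s by (metis abs_of_nonneg norm_minus_cancel norm_scaleR)
      also have "\<dots> \<le> s * (L * norm v)" using L s by (intro mult_left_mono) auto
      finally have "(1 - s * L) * norm v \<le> 0" by (simp add: algebra_simps)
      then show "v = 0" using s by (simp add: mult_le_0_iff)
    qed
    then show ?thesis
      using det_nz_iff_inj[OF matrix_vector_mul_linear[of "mat 1 + s *\<^sub>R matrix W"]]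
      by (simp add: matrix_of_matrix_vector_mul)
  qed
  have r: "r > 0" using L by simp
  have "det (mat 1 + (1 / r) *\<^sub>R matrix W) > 0"
  proof (rule ccontr)
    assume "\<not> ?thesis"
    then have "\<exists>s\<ge>0. s \<le> 1 / r \<and> det (mat 1 + s *\<^sub>R matrix W) = 0"
      using r by (intro IVT2') (auto intro!: continuous_on_det continuous_intros)
    then obtain s where s: "0 \<le> s" "s \<le> 1 / r" "det (mat 1 + s *\<^sub>R matrix W) = 0" by blast
    have "s * L \<le> 1 / r * L" using s L by (intro mult_right_mono) auto
    also have "\<dots> < 1" using L r by (simp add: field_simps)
    finally show False using nz[of s] s by blast
  qed
  moreover have "r *\<^sub>R mat 1 + matrix W = r *\<^sub>R (mat 1 + (1 / r) *\<^sub>R matrix W)"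
    using r by (simp add: scaleR_add_right)
  moreover have "det (r *\<^sub>R A) = r ^ CARD('n) * det A" for A :: "real^'n^'n"
    using det_rows_mul[of "\<lambda>_. r" "\<lambda>i. A $ i"]
    by (simp add: scalar_mult_eq_scaleR scaleR_vec_def)
  ultimately show ?thesis using r by simp
qed

text \<open>The case of Stokes' theorem from which everything else follows: \<open>det Dw\<close> is the
exact form \<open>dw\<^sub>1 \<and> \<dots> \<and> dw\<^sub>n\<close>. Instead of integrating it by parts, which would take second
derivatives of \<open>w\<close>, the proof evaluates \<open>\<integral> det (r I + Dw)\<close> for large \<open>r\<close> as the volume of a ball and
continues the resulting polynomial identity to \<open>r = 0\<close>.\<close>

theorem integral_det_derivative_zero:
  fixes w :: "real^'n \<Rightarrow> real^'n"
  assumes w: "C1_diff_on UNIV w" and zero: "\<And>x. R \<le> norm x \<Longrightarrow> w x = 0"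
  shows "(LINT x:ball 0 R|lborel. det (matrix (frechet_derivative w (at x)))) = 0"
proof -
  define W where "W = (\<lambda>x. frechet_derivative w (at x))"
  have der: "(w has_derivative W x) (at x)" for x
    unfolding W_def using C1_diff_on_has_derivative[OF w] by simp
  have lin: "linear (W x)" for x using der has_derivative_linear by blast
  have contW: "continuous_on UNIV (\<lambda>x. W x v)" for v
    unfolding W_def by (rule C1_diff_on_deriv_continuous[OF w])
  have W0: "W x = (\<lambda>v. 0)" if "R < norm x" for x
  proof -
    have "open {x::real^'n. R < norm x}" by (intro open_Collect_less continuous_intros)
    then have "((\<lambda>x. 0) has_derivative W x) (at x)"
      using that zero by (intro has_derivative_transform_within_open[OF der]) auto
    then show ?thesis using has_derivative_unique has_derivative_const by blast
  qed
  have "\<exists>B. \<forall>x. norm (W x (axis j 1)) \<le> B" for j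
  proof -
    have "bounded ((\<lambda>x. W x (axis j 1)) ` cball 0 R)"
      by (intro compact_imp_bounded compact_continuous_image continuous_on_subset[OF contW]) auto
    then obtain B where "\<forall>x\<in>cball 0 R. norm (W x (axis j 1)) \<le> B"
      unfolding bounded_iff by auto
    then have B: "norm (W x (axis j 1)) \<le> B" if "norm x \<le> R" for x using that by simp
    have "norm (W x (axis j 1)) \<le> max B 0" for x
      by (cases "norm x \<le> R") (use B[of x] W0[of x] in auto)
    then show ?thesis by blast
  qed
  then obtain B where B: "\<And>x j. norm (W x (axis j 1)) \<le> B j" by metis
  define L where "L = (\<Sum>j\<in>UNIV. B j)"
  have WL: "norm (W x v) \<le> L * norm v" for x v
    unfolding L_def by (rule norm_le_of_columns[OF lin B])
  have L0: "0 \<le> L" unfolding L_def by (intro sum_nonneg order_trans[OF norm_ge_zero B])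
  have lip: "norm (w x - w y) \<le> L * norm (x - y)" for x y
    by (rule differentiable_bound[of UNIV w W])
      (use der WL in \<open>auto intro!: onorm_bound[OF L0] has_derivative_at_withinI\<close>)
  \<comment> \<open>the integrand \<open>det (t I + Dw)\<close>, whose integral is a polynomial in \<open>t\<close>\<close>
  define F where "F = (\<lambda>t x. det (matrix (W x) + t *\<^sub>R (mat 1 :: real^'n^'n)))"
  have "poly_continuous_on UNIV F"
    unfolding F_def
    by (rule poly_continuous_on_det) (auto simp: matrix_def intro!: bounded_linear.continuous_on[OF bounded_linear_vec_nth contW])
  then have "\<exists>d c. (\<forall>k. continuous_on UNIV (c k)) \<and> (\<forall>x t. F t x = (\<Sum>k\<le>d. c k x * t ^ k))"
    unfolding poly_continuous_on_def by simp
  then obtain d c where c: "\<And>k. continuous_on UNIV (c k)" "\<And>t x. F t x = (\<Sum>k\<le>d. c k x * t ^ k)"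
    by blast
  define C where "C = (\<lambda>k. LINT x:ball 0 R|lborel. c k x)"
  have intF: "(LINT x:ball 0 R|lborel. F t x) = (\<Sum>k\<le>d. C k * t ^ k)" for t
  proof -
    have "(LINT x:ball 0 R|lborel. F t x) = (\<Sum>k\<le>d. LINT x:ball 0 R|lborel. c k x * t ^ k)"
      unfolding c(2) set_lebesgue_integral_def scaleR_sum_right
      by (rule Bochner_Integration.integral_sum)
        (use continuous_ball_set_integrable[OF c(1)] in
          \<open>auto simp: set_integrable_def mult.assoc[symmetric] intro!: integrable_mult_left\<close>)
    then show ?thesis by (simp add: C_def)
  qed
  define \<mu> where "\<mu> = (LINT x:ball (0::real^'n) R|lborel. (1::real))"
  \<comment> \<open>for large r the map \<open>x \<mapsto> r x + w x\<close> and the dilation by r have the same image of the ball\<close>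
  have big: "(\<Sum>k\<le>d. C k * r ^ k) = r ^ CARD('n) * \<mu>" if r: "r > L" for r
  proof -
    have r0: "r > 0" using L0 r by simp
    let ?u = "\<lambda>x. r *\<^sub>R x + w x"
    let ?B = "ball (0::real^'n) R"
    have u: "inj ?u" "?u ` ?B = ball 0 (r * R)"
      using perturbed_dilation[OF lip L0 r zero] by auto
    have mat: "matrix (\<lambda>v. r *\<^sub>R v + W x v) = matrix (W x) + r *\<^sub>R mat 1" for x
      by (simp add: vec_eq_iff matrix_def mat_def axis_def)
    have pos: "F r x > 0" for x
      unfolding F_def using det_pos_of_dominant_scalar[OF lin WL L0 r, of x] by (simp add: add.commute)
    have one: "set_integrable lborel (ball a \<rho>) (\<lambda>x. 1 :: real)" for a :: "real^'n" and \<rho>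
      by (rule continuous_ball_set_integrable) simp
    have intF': "set_integrable lborel ?B (F r)"
      by (rule continuous_ball_set_integrable) (auto simp: c(2) intro!: continuous_intros c(1))
    have abs: "\<bar>det (matrix (\<lambda>v. r *\<^sub>R v + W x v))\<bar> = F r x" for x
      unfolding mat using pos[of x] by (simp add: F_def)
    have "(LINT x:?B|lborel. \<bar>det (matrix (\<lambda>v. r *\<^sub>R v + W x v))\<bar> * 1) = (LINT y:?u ` ?B|lborel. (1::real))"
    proof (rule set_integral_change_of_variables)
      show "(?u has_derivative (\<lambda>v. r *\<^sub>R v + W x v)) (at x)" for x
        by (intro has_derivative_add has_derivative_scaleR_right has_derivative_ident der)
      show "inj_on ?u ?B" using u(1) by (rule inj_on_subset) auto
      show "set_integrable lborel (?u ` ?B) (\<lambda>x. 1 :: real)" unfolding u(2) by (rule one)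
      show "set_integrable lborel ?B (\<lambda>x. \<bar>det (matrix (\<lambda>v. r *\<^sub>R v + W x v))\<bar> * 1)"
        unfolding abs using intF' by simp
    qed simp
    then have 1: "(LINT x:?B|lborel. F r x) = (LINT y:ball (0::real^'n) (r * R)|lborel. (1::real))"
      unfolding abs u(2) by simp
    have "(LINT x:?B|lborel. \<bar>det (matrix (\<lambda>v::real^'n. r *\<^sub>R v))\<bar> * 1)
        = (LINT y:(\<lambda>x::real^'n. r *\<^sub>R x) ` ?B|lborel. (1::real))"
    proof (rule set_integral_change_of_variables)
      show "((\<lambda>x::real^'n. r *\<^sub>R x) has_derivative (\<lambda>v. r *\<^sub>R v)) (at x)" for x
        by (intro derivative_eq_intros) auto
      show "inj_on (\<lambda>x::real^'n. r *\<^sub>R x) ?B" using r0 by (auto simp: inj_on_def)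
      show "set_integrable lborel ((\<lambda>x::real^'n. r *\<^sub>R x) ` ?B) (\<lambda>x. 1 :: real)"
        using one[of "0::real^'n" "r * R"] r0 ball_scale[of r "0::real^'n" R] by simp
      show "set_integrable lborel ?B (\<lambda>x. \<bar>det (matrix (\<lambda>v::real^'n. r *\<^sub>R v))\<bar> * 1)"
        by (rule continuous_ball_set_integrable) simp
    qed simp
    moreover have "(\<lambda>x::real^'n. r *\<^sub>R x) ` ?B = ball 0 (r * R)"
      using r0 ball_scale[of r "0::real^'n" R] by simp
    ultimately have "(LINT y:ball (0::real^'n) (r * R)|lborel. (1::real)) = r ^ CARD('n) * \<mu>"
      using r0 set_integral_mult_right[of lborel ?B "r ^ CARD('n)" "\<lambda>_. 1"]
      by (simp add: \<mu>_def)
    then show ?thesis using 1 intF[of r] by simp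
  qed
  have "(\<Sum>k\<le>d. C k * 0 ^ k) = (\<Sum>k\<le>CARD('n). (if k = CARD('n) then \<mu> else 0) * 0 ^ k)"
  proof (rule polyfun_eq_if_eq_on_infinite[of "{L<..}"])
    show "infinite {L<..}" by (rule infinite_Ioi)
    fix t assume "t \<in> {L<..}"
    then have "(\<Sum>k\<le>d. C k * t ^ k) = \<mu> * t ^ CARD('n)" using big by (simp add: mult.commute)
    also have "\<dots> = (\<Sum>k\<le>CARD('n). if k = CARD('n) then \<mu> * t ^ k else 0)" by simp
    also have "\<dots> = (\<Sum>k\<le>CARD('n). (if k = CARD('n) then \<mu> else 0) * t ^ k)"
      by (intro sum.cong) auto
    finally show "(\<Sum>k\<le>d. C k * t ^ k) = (\<Sum>k\<le>CARD('n). (if k = CARD('n) then \<mu> else 0) * t ^ k)" .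
  qed
  also have "\<dots> = 0"
    by (rule sum.neutral) (simp add: power_0_left)
  finally have "(LINT x:ball 0 R|lborel. F 0 x) = 0" using intF[of 0] by simp
  then show ?thesis by (simp add: F_def W_def)
qed

section \<open>Integration by parts for frame determinants\<close>

text \<open>A C1 cut-off function: 1 on the closed ball of radius \<open>r\<close>, 0 outside the open ball of radius \<open>R\<close>. The squares
of the positive parts are of class C1, and for \<open>r < R\<close> the two of them never vanish together.\<close>

definition bump :: "'a::euclidean_space \<Rightarrow> real \<Rightarrow> real \<Rightarrow> 'a \<Rightarrow> real" where
  "bump a r R x = (let p = (max 0 (R\<^sup>2 - (norm (x - a))\<^sup>2))\<^sup>2; q = (max 0 ((norm (x - a))\<^sup>2 - r\<^sup>2))\<^sup>2
     in p / (p + q))"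

lemma has_real_derivative_pos_part_square:
  "((\<lambda>t::real. (max 0 t)\<^sup>2) has_real_derivative 2 * max 0 t) (at t)"
proof -
  consider "t < 0" | "t = 0" | "t > 0" by linarith
  then show ?thesis
  proof cases
    case 1
    have "((\<lambda>t::real. 0) has_real_derivative 0) (at t)" by simp
    then have "((\<lambda>t::real. (max 0 t)\<^sup>2) has_real_derivative 0) (at t)"
      by (rule has_field_derivative_transform_within_open[where S = "{..<0}"]) (use 1 in auto)
    then show ?thesis using 1 by simp
  next
    case 3
    have "((\<lambda>t::real. t\<^sup>2) has_real_derivative 2 * t) (at t)"
      by (auto intro!: derivative_eq_intros)
    then have "((\<lambda>t::real. (max 0 t)\<^sup>2) has_real_derivative 2 * t) (at t)"
      by (rule has_field_derivative_transform_within_open[where S = "{0<..}"]) (use 3 in auto)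
    then show ?thesis using 3 by simp
  next
    case 2
    have "((\<lambda>h::real. (max 0 h)\<^sup>2 / h) \<longlongrightarrow> 0) (at 0)"
    proof (rule Lim_null_comparison)
      show "\<forall>\<^sub>F h in at 0. norm ((max 0 h)\<^sup>2 / h) \<le> \<bar>h\<bar>"
        by (intro always_eventually allI) (auto simp: max_def power2_eq_square)
      show "((\<lambda>h::real. \<bar>h\<bar>) \<longlongrightarrow> 0) (at 0)" by (intro tendsto_eq_intros) auto
    qed
    then show ?thesis using 2 by (simp add: DERIV_def)
  qed
qed

lemma C1_diff_on_pos_part_square:
  fixes f :: "'a::real_normed_vector \<Rightarrow> real"
  assumes "C1_diff_on S f" shows "C1_diff_on S (\<lambda>x. (max 0 (f x))\<^sup>2)"
  by (rule C1_diff_on_real_compose[OF assms, of UNIV, OF has_real_derivative_pos_part_square])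
    (auto intro!: continuous_intros)

lemma C1_diff_on_divide:
  fixes f g :: "'a::real_normed_vector \<Rightarrow> real"
  assumes "C1_diff_on S f" "C1_diff_on S g" "\<And>x. x \<in> S \<Longrightarrow> g x > 0"
  shows "C1_diff_on S (\<lambda>x. f x / g x)"
proof -
  have "C1_diff_on S (\<lambda>x. inverse (g x))"
  proof (rule C1_diff_on_real_compose[OF assms(2)])
    show "(inverse has_real_derivative - ((inverse t)\<^sup>2)) (at t)" if "t \<in> {0<..}" for t :: real
      using that DERIV_inverse[of t UNIV] by (simp add: power2_eq_square)
    show "continuous_on {0<..} (\<lambda>t::real. - ((inverse t)\<^sup>2))" by (intro continuous_intros) auto
  qed (use assms in auto)
  then show ?thesis using assms(1) by (simp add: divide_inverse C1_diff_on_mult)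
qed

context
  fixes r R :: real and a :: "'a::euclidean_space"
  assumes r: "0 < r" "r < R"
begin

lemma bump_denominator_pos:
  "(max 0 (R\<^sup>2 - (norm (x - a))\<^sup>2))\<^sup>2 + (max 0 ((norm (x - a))\<^sup>2 - r\<^sup>2))\<^sup>2 > 0"
proof (cases "norm (x - a) < R")
  case True
  then have "(norm (x - a))\<^sup>2 < R\<^sup>2" by (intro power_strict_mono) auto
  then show ?thesis by (intro add_pos_nonneg) auto
next
  case False
  then have "r\<^sup>2 < (norm (x - a))\<^sup>2" using r by (intro power_strict_mono) auto
  then show ?thesis by (intro add_nonneg_pos) auto
qed

lemma bump_C1: "C1_diff_on S (bump a r R)"
proof -
  have id: "C1_diff_on S (\<lambda>x. x - a)"
    by (rule C1_diff_onI[where g' = "\<lambda>x v. v"]) (auto intro!: derivative_eq_intros)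
  have n: "C1_diff_on S (\<lambda>x. (norm (x - a))\<^sup>2)"
    unfolding power2_norm_eq_inner by (rule C1_diff_on_inner[OF id id])
  have n': "C1_diff_on S (\<lambda>x. c + s *\<^sub>R (norm (x - a))\<^sup>2)" for c s :: real
    by (intro C1_diff_on_add C1_diff_on_scaleR C1_diff_on_const n)
  show ?thesis unfolding bump_def[abs_def] Let_def
    using n'[of "R\<^sup>2" "-1"] n'[of "- (r\<^sup>2)" 1] bump_denominator_pos
    by (intro C1_diff_on_divide C1_diff_on_add C1_diff_on_pos_part_square) auto
qed

lemma bump_nonneg: "0 \<le> bump a r R x"
  by (simp add: bump_def Let_def)

lemma bump_eq_1: "norm (x - a) \<le> r \<Longrightarrow> bump a r R x = 1"
  using power_mono[of "norm (x - a)" r 2] power_strict_mono[of r R 2] r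
  by (simp add: bump_def Let_def)

lemma bump_eq_0: "R \<le> norm (x - a) \<Longrightarrow> bump a r R x = 0"
  using r power_mono[of R "norm (x - a)" 2] by (simp add: bump_def Let_def)

end

lemma C1_diff_on_extend_zero:
  assumes U: "open U" and g: "C1_diff_on U g" and K: "closed K"
    and zero: "\<And>x. x \<in> U \<Longrightarrow> x \<notin> K \<Longrightarrow> g x = 0" and KU: "K \<subseteq> U"
  shows "C1_diff_on UNIV (\<lambda>x. if x \<in> U then g x else 0)"
proof (rule C1_diff_on_local)
  fix x :: 'a
  show "\<exists>T. open T \<and> x \<in> T \<and> C1_diff_on T (\<lambda>x. if x \<in> U then g x else 0)"
  proof (cases "x \<in> U")
    case True
    then show ?thesis
      using U C1_diff_on_cong[OF U g, of "\<lambda>x. if x \<in> U then g x else 0"] by auto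
  next
    case False
    have "C1_diff_on (- K) (\<lambda>x. if x \<in> U then g x else 0)"
      by (rule C1_diff_on_cong[OF _ C1_diff_on_const]) (use zero K in auto)
    then show ?thesis using False KU K by (intro exI[of _ "- K"]) auto
  qed
qed

lemma frechet_derivative_cong_open:
  assumes "open T" "x \<in> T" "\<And>y. y \<in> T \<Longrightarrow> f y = g y"
  shows "frechet_derivative f (at x) = frechet_derivative g (at x)"
proof -
  have "(f has_derivative F) (at x) \<longleftrightarrow> (g has_derivative F) (at x)" for F
    using assms has_derivative_transform_within_open[of f F x UNIV T g]
      has_derivative_transform_within_open[of g F x UNIV T f] by auto
  then show ?thesis unfolding frechet_derivative_def by simp
qed

lemma continuous_on_polar_det:
  assumes w: "continuous_on S w" and u: "\<And>j. continuous_on S (\<lambda>x. u x j)"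
    and v: "\<And>j. continuous_on S (\<lambda>x. v x j)"
  shows "continuous_on S (\<lambda>x. polar_det (w x) (u x) (v x))"
proof -
  have "continuous_on S (\<lambda>x. frame_det (w x) (\<lambda>i. if i = j then v x j else u x i))" for j
  proof (rule continuous_on_frame_det[OF w])
    fix i show "continuous_on S (\<lambda>x. if i = j then v x j else u x i)"
      using u v by (cases "i = j") auto
  qed
  then show ?thesis unfolding polar_det_def fun_upd_def by (intro continuous_on_sum)
qed

lemma poly_continuous_on_frame_det:
  fixes w :: "'x::topological_space \<Rightarrow> real^('n::finite option)"
  assumes w: "continuous_on S w" and u: "\<And>j. continuous_on S (\<lambda>x. u x j)"
    and v: "\<And>j. continuous_on S (\<lambda>x. v x j)"
  shows "poly_continuous_on S (\<lambda>t x. frame_det (w x) (\<lambda>j. u x j + t *\<^sub>R v x j))"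
proof -
  define A :: "'x \<Rightarrow> real^('n option)^('n option)"
    where "A = (\<lambda>x. \<chi> b. case b of None \<Rightarrow> w x | Some j \<Rightarrow> u x j)"
  define B :: "'x \<Rightarrow> real^('n option)^('n option)"
    where "B = (\<lambda>x. \<chi> b. case b of None \<Rightarrow> 0 | Some j \<Rightarrow> v x j)"
  have "frame_det (w x) (\<lambda>j. u x j + t *\<^sub>R v x j) = det (A x + t *\<^sub>R B x)" for t x
    unfolding frame_det_rows A_def B_def
    by (intro arg_cong[of _ _ det]) (simp add: vec_eq_iff split: option.split)
  moreover have "continuous_on S (\<lambda>x. A x $ i $ j)" for i j
    unfolding A_def using w u by (cases i) (auto intro!: continuous_intros)
  moreover have "continuous_on S (\<lambda>x. B x $ i $ j)" for i j
    unfolding B_def using v by (cases i) (auto intro!: continuous_intros)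
  ultimately show ?thesis by (simp add: poly_continuous_on_det)
qed

lemma integral_frame_det_derivative_zero:
  fixes w :: "real^'n \<Rightarrow> real^('n::finite option)"
  assumes w: "C1_diff_on UNIV w" and zero: "\<And>x. R \<le> norm x \<Longrightarrow> w x = 0"
  shows "(LINT x:ball 0 R|lborel. frame_det (axis k 1) (\<lambda>j. frechet_derivative w (at x) (axis j 1))) = 0"
proof -
  define \<pi> :: "real^('n option) \<Rightarrow> real^'n" where "\<pi> = (\<lambda>v. \<chi> i. v $ Transposition.transpose None k (Some i))"
  have \<pi>: "bounded_linear \<pi>"
    unfolding \<pi>_def by (auto intro!: linear_conv_bounded_linear[THEN iffD1] linearI simp: vec_eq_iff)
  have C1: "C1_diff_on UNIV (\<lambda>x. \<pi> (w x))" by (rule C1_diff_on_linear[OF \<pi> w])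
  have "frechet_derivative (\<lambda>x. \<pi> (w x)) (at x) = (\<lambda>v. \<pi> (frechet_derivative w (at x) v))" for x
    by (rule frechet_derivative_at[symmetric] , rule bounded_linear.has_derivative[OF \<pi>],
        rule C1_diff_on_has_derivative[OF w]) simp
  then have eq: "frame_det (axis k 1) (\<lambda>j. frechet_derivative w (at x) (axis j 1)) =
      of_int (sign (Transposition.transpose None k)) *
        det (matrix (frechet_derivative (\<lambda>x. \<pi> (w x)) (at x)))" for x
    unfolding frame_det_axis
    by (subst (2) det_transpose[symmetric]) (simp add: matrix_def Finite_Cartesian_Product.transpose_def \<pi>_def)
  have "(LINT x:ball 0 R|lborel. det (matrix (frechet_derivative (\<lambda>x. \<pi> (w x)) (at x)))) = 0"
    by (rule integral_det_derivative_zero[OF C1])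
      (use zero in \<open>simp add: \<pi>_def vec_eq_iff\<close>)
  then show ?thesis unfolding eq by simp
qed

text \<open>If the integrals of a polynomial family vanish identically in \<open>t\<close>, then so do the integrals of all
coefficients, in particular that of the coefficient of \<open>t\<close>, which is the derivative at 0.\<close>

lemma integral_linear_coefficient_zero:
  fixes F :: "real \<Rightarrow> 'a::euclidean_space \<Rightarrow> real"
  assumes F: "poly_continuous_on UNIV F" and int: "\<And>t. (LINT x:ball 0 R|lborel. F t x) = 0"
    and der: "\<And>x. ((\<lambda>t. F t x) has_real_derivative G x) (at 0)"
  shows "(LINT x:ball 0 R|lborel. G x) = 0"
proof -
  have "\<exists>d c. (\<forall>k. continuous_on UNIV (c k)) \<and> (\<forall>x t. F t x = (\<Sum>k\<le>d. c k x * t ^ k))"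
    using F unfolding poly_continuous_on_def by simp
  then obtain d c where c: "\<And>k. continuous_on UNIV (c k)" "\<And>t x. F t x = (\<Sum>k\<le>d. c k x * t ^ k)"
    by blast
  define C where "C = (\<lambda>k. LINT x:ball 0 R|lborel. c k x)"
  have integ: "(LINT x:ball 0 R|lborel. (\<Sum>k\<le>d. c k x * s k)) = (\<Sum>k\<le>d. C k * s k)" for s :: "nat \<Rightarrow> real"
  proof -
    have "(LINT x:ball 0 R|lborel. (\<Sum>k\<le>d. c k x * s k)) = (\<Sum>k\<le>d. LINT x:ball 0 R|lborel. c k x * s k)"
      unfolding set_lebesgue_integral_def scaleR_sum_right
      by (rule Bochner_Integration.integral_sum)
        (use continuous_ball_set_integrable[OF c(1)] in
          \<open>auto simp: set_integrable_def mult.assoc[symmetric] intro!: integrable_mult_left\<close>)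
    then show ?thesis by (simp add: C_def)
  qed
  have dp: "((\<lambda>t. \<Sum>k\<le>d. b k * t ^ k) has_real_derivative (\<Sum>k\<le>d. b k * (of_nat k * 0 ^ (k - 1)))) (at 0)"
    for b :: "nat \<Rightarrow> real"
    by (auto intro!: derivative_eq_intros sum.cong)
  have "G x = (\<Sum>k\<le>d. c k x * (of_nat k * 0 ^ (k - 1)))" for x
    using DERIV_unique[OF der[of x, unfolded c(2)] dp] .
  then have "(LINT x:ball 0 R|lborel. G x) = (\<Sum>k\<le>d. C k * (of_nat k * 0 ^ (k - 1)))"
    using integ[of "\<lambda>k. of_nat k * 0 ^ (k - 1)"] by simp
  moreover have "(\<lambda>t. \<Sum>k\<le>d. C k * t ^ k) = (\<lambda>t. 0)"
    using int integ unfolding c(2) by (simp add: fun_eq_iff)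
  then have "(\<Sum>k\<le>d. C k * (of_nat k * 0 ^ (k - 1))) = 0"
    using dp[of C] DERIV_const[of 0 "at 0"] DERIV_unique by metis
  ultimately show ?thesis by simp
qed

lemma integral_polar_det_derivative_zero:
  fixes h b :: "real^'n \<Rightarrow> real^('n::finite option)"
  assumes h: "C1_diff_on UNIV h" "\<And>x. R \<le> norm x \<Longrightarrow> h x = 0"
    and b: "C1_diff_on UNIV b" "\<And>x. R \<le> norm x \<Longrightarrow> b x = 0"
  shows "(LINT x:ball 0 R|lborel. polar_det (axis k 1) (\<lambda>j. frechet_derivative h (at x) (axis j 1))
     (\<lambda>j. frechet_derivative b (at x) (axis j 1))) = 0"
proof (rule integral_linear_coefficient_zero)
  let ?F = "\<lambda>t x. frame_det (axis k 1) (\<lambda>j. frechet_derivative h (at x) (axis j 1)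
      + t *\<^sub>R frechet_derivative b (at x) (axis j 1))"
  show "poly_continuous_on UNIV ?F"
    by (intro poly_continuous_on_frame_det continuous_on_const C1_diff_on_deriv_continuous h b)
  fix t
  have d: "((\<lambda>x. h x + t *\<^sub>R b x) has_derivative (\<lambda>v. frechet_derivative h (at x) v
      + t *\<^sub>R frechet_derivative b (at x) v)) (at x)" for x
    by (intro has_derivative_add has_derivative_scaleR_right C1_diff_on_has_derivative[OF h(1)]
        C1_diff_on_has_derivative[OF b(1)]) auto
  have "frechet_derivative (\<lambda>x. h x + t *\<^sub>R b x) (at x) = (\<lambda>v. frechet_derivative h (at x) v
      + t *\<^sub>R frechet_derivative b (at x) v)" for x
    by (rule frechet_derivative_at[OF d, symmetric])
  then show "(LINT x:ball 0 R|lborel. ?F t x) = 0"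
    using integral_frame_det_derivative_zero[of "\<lambda>x. h x + t *\<^sub>R b x" R k] h b
    by (simp add: C1_diff_on_add C1_diff_on_scaleR)
next
  fix x
  let ?h = "\<lambda>j. frechet_derivative h (at x) (axis j 1)" and ?b = "\<lambda>j. frechet_derivative b (at x) (axis j 1)"
  have "((\<lambda>t. ?h j + t *\<^sub>R ?b j) has_vector_derivative ?b j) (at 0)" for j
    by (auto intro!: derivative_eq_intros)
  from has_derivative_frame_det[where u = "\<lambda>t j. ?h j + t *\<^sub>R ?b j", OF this]
  show "((\<lambda>t. frame_det (axis k 1) (\<lambda>j. ?h j + t *\<^sub>R ?b j)) has_real_derivative
      polar_det (axis k 1) ?h ?b) (at 0)" by simp
qed

text \<open>The algebra of the product rule: the left-hand side is the sum over the coordinates \<open>k\<close> of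
the polar determinant of the derivative of \<open>a\<^sub>k b\<close>. Its two kinds of terms are collected over \<open>k\<close>, and
exchanging the first column with the replaced one in terms of the first kind accounts for the sign.\<close>

lemma sum_polar_det_axis:
  "(\<Sum>k\<in>UNIV. polar_det (axis k 1) u (\<lambda>j. (a' j $ k) *\<^sub>R b + (a $ k) *\<^sub>R b' j))
     = polar_det a u b' - polar_det b u a'"
proof -
  have ex: "(\<Sum>k\<in>UNIV. (a $ k) * frame_det (axis k 1) u) = frame_det a u" for a u
  proof -
    have "frame_det a u = frame_det (\<Sum>k\<in>UNIV. (a $ k) *\<^sub>R axis k 1) u"
      using basis_expansion[of a] by (simp add: scalar_mult_eq_scaleR)
    then show ?thesis
      by (simp add: linear_sum[OF linear_frame_det] linear_scale[OF linear_frame_det])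
  qed
  have "(\<Sum>k\<in>UNIV. polar_det (axis k 1) u (\<lambda>j. (a' j $ k) *\<^sub>R b + (a $ k) *\<^sub>R b' j))
    = (\<Sum>j\<in>UNIV. \<Sum>k\<in>UNIV. (a' j $ k) * frame_det (axis k 1) (u(j := b))
        + (a $ k) * frame_det (axis k 1) (u(j := b' j)))"
    unfolding polar_det_def
    by (subst sum.swap) (simp add: linear_add[OF linear_frame_det_slot] linear_scale[OF linear_frame_det_slot])
  also have "\<dots> = (\<Sum>j\<in>UNIV. frame_det (a' j) (u(j := b)) + frame_det a (u(j := b' j)))"
    by (simp add: sum.distrib ex)
  also have "\<dots> = (\<Sum>j\<in>UNIV. frame_det a (u(j := b' j)) - frame_det b (u(j := a' j)))"
    by (intro sum.cong refl) (simp add: frame_det_swap[of "a' _"])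
  finally show ?thesis by (simp add: polar_det_def sum_subtractf)
qed

lemma polar_det_zero [simp]: "polar_det w u (\<lambda>j. 0) = 0"
  by (simp add: polar_det_def linear_0[OF linear_frame_det_slot])

lemma polar_det_zero_left [simp]: "polar_det 0 u v = 0"
  by (simp add: polar_det_def linear_0[OF linear_frame_det])

text \<open>Formally the integrand is, up to sign, the divergence with respect to \<open>j\<close> of the frame determinant
of \<open>a\<close> and the derivatives of \<open>h\<close> with the \<open>j\<close>-th of them replaced by \<open>b\<close>. After decomposing \<open>a\<close> into
coordinates, it is minus the sum over \<open>k\<close> of the polar determinants of the basis vectors with the
derivatives of \<open>h\<close> and of \<open>a\<^sub>k b\<close>; each of these has integral zero, once \<open>h\<close> is cut off outside the
support of \<open>a\<close>.\<close>

theorem integral_polar_det_by_parts: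
  fixes a b h :: "real^'n \<Rightarrow> real^('n::finite option)"
  assumes U: "open U" and a: "C1_diff_on U a" and b: "C1_diff_on U b" and h: "C1_diff_on U h"
    and \<epsilon>: "\<epsilon> > 0" "cball x0 (2 * \<epsilon>) \<subseteq> U" and zero: "\<And>x. x \<in> U \<Longrightarrow> \<epsilon> \<le> norm (x - x0) \<Longrightarrow> a x = 0"
  defines "D \<equiv> \<lambda>(g :: real^'n \<Rightarrow> real^('n option)) x j. frechet_derivative g (at x) (axis j 1)"
  shows "(LINT x:U|lborel. polar_det (b x) (D h x) (D a x) - polar_det (a x) (D h x) (D b x)) = 0"
proof -
  define cutoff where "cutoff = bump x0 (3/2 * \<epsilon>) (2 * \<epsilon>)"
  define H where "H = (\<lambda>x. if x \<in> U then cutoff x *\<^sub>R h x else 0)"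
  define \<beta> where "\<beta> = (\<lambda>k x. if x \<in> U then (a x $ k) *\<^sub>R b x else 0)"
  define R where "R = norm x0 + 2 * \<epsilon>"
  have e: "0 < 3/2 * \<epsilon>" "3/2 * \<epsilon> < 2 * \<epsilon>" using \<epsilon> by auto
  have cutC: "C1_diff_on U cutoff" unfolding cutoff_def by (rule bump_C1[OF e])
  have cut0: "cutoff x = 0" if "2 * \<epsilon> \<le> norm (x - x0)" for x
    unfolding cutoff_def by (rule bump_eq_0[OF e that])
  have eU: "cball x0 \<epsilon> \<subseteq> U" using \<epsilon> by auto
  have far: "2 * \<epsilon> \<le> norm (x - x0)" if "R \<le> norm x" for x
    using that norm_triangle_sub[of x x0] by (simp add: R_def)
  have H: "C1_diff_on UNIV H" unfolding H_def
    by (rule C1_diff_on_extend_zero[OF U _ closed_cball[of x0 "2 * \<epsilon>"]])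
      (use \<epsilon> cut0 in \<open>auto simp: dist_norm norm_minus_commute intro!: C1_diff_on_scaleR cutC h\<close>)
  have H0: "H x = 0" if "R \<le> norm x" for x
    using cut0[OF far[OF that]] by (simp add: H_def)
  have \<beta>: "C1_diff_on UNIV (\<beta> k)" for k unfolding \<beta>_def
    by (rule C1_diff_on_extend_zero[OF U _ closed_cball[of x0 \<epsilon>]])
      (use eU zero in \<open>auto simp: dist_norm norm_minus_commute
        intro!: C1_diff_on_scaleR b C1_diff_on_linear[OF bounded_linear_vec_nth a]\<close>)
  have \<beta>0: "\<beta> k x = 0" if "R \<le> norm x" for x k
    using zero far[OF that] \<epsilon> by (auto simp: \<beta>_def)
  let ?I = "\<lambda>k x. polar_det (axis k 1) (D H x) (D (\<beta> k) x)"
  have int0: "(LINT x:ball 0 R|lborel. ?I k x) = 0" for k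
    unfolding D_def by (rule integral_polar_det_derivative_zero[OF H H0 \<beta> \<beta>0])
  have intI: "set_integrable lborel (ball 0 R) (?I k)" for k
    unfolding D_def
    by (intro continuous_ball_set_integrable continuous_on_polar_det continuous_on_const
        C1_diff_on_deriv_continuous H \<beta>)
  have der: "(g has_derivative frechet_derivative g (at x)) (at x)" if "C1_diff_on U g" "x \<in> U"
    for g :: "real^'n \<Rightarrow> real^('n option)" and x
    using C1_diff_on_has_derivative that by blast
  have pt: "indicator U x *\<^sub>R (polar_det (b x) (D h x) (D a x) - polar_det (a x) (D h x) (D b x))
     = - (\<Sum>k\<in>UNIV. indicator (ball 0 R) x *\<^sub>R ?I k x)" for x
  proof (cases "x \<in> cball x0 \<epsilon>")
    case True
    then have xU: "x \<in> U" using eU by blast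
    have "norm x \<le> norm x0 + norm (x - x0)" by (rule norm_triangle_sub)
    then have xR: "x \<in> ball 0 R" using True \<epsilon> by (simp add: R_def dist_norm norm_minus_commute)
    have "D H x = D h x"
    proof -
      have "frechet_derivative H (at x) = frechet_derivative h (at x)"
      proof (rule frechet_derivative_cong_open[of "ball x0 (3/2 * \<epsilon>)"])
        show "x \<in> ball x0 (3/2 * \<epsilon>)" using True \<epsilon> by simp
        fix y assume y: "y \<in> ball x0 (3/2 * \<epsilon>)"
        then have "y \<in> U" using \<epsilon> by auto
        moreover have "cutoff y = 1"
          using y bump_eq_1[OF e, of y x0] by (simp add: cutoff_def dist_norm norm_minus_commute)
        ultimately show "H y = h y" by (simp add: H_def)
      qed simp
      then show ?thesis by (simp add: D_def)
    qed
    moreover have "D (\<beta> k) x = (\<lambda>j. (D a x j $ k) *\<^sub>R b x + (a x $ k) *\<^sub>R D b x j)" for k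
    proof -
      have d: "((\<lambda>x. (a x $ k) *\<^sub>R b x) has_derivative
        (\<lambda>v. (a x $ k) *\<^sub>R frechet_derivative b (at x) v + (frechet_derivative a (at x) v $ k) *\<^sub>R b x)) (at x)"
        by (intro has_derivative_scaleR bounded_linear.has_derivative[OF bounded_linear_vec_nth] der a b xU)
      have "frechet_derivative (\<lambda>x. (a x $ k) *\<^sub>R b x) (at x) =
         (\<lambda>v. (a x $ k) *\<^sub>R frechet_derivative b (at x) v + (frechet_derivative a (at x) v $ k) *\<^sub>R b x)"
        by (rule frechet_derivative_at[OF d, symmetric])
      moreover have "frechet_derivative (\<beta> k) (at x) = frechet_derivative (\<lambda>x. (a x $ k) *\<^sub>R b x) (at x)"
        by (rule frechet_derivative_cong_open[OF U xU]) (simp add: \<beta>_def)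
      ultimately show ?thesis by (simp add: D_def add.commute)
    qed
    ultimately show ?thesis
      using xU xR sum_polar_det_axis[of "D h x" "D a x" "b x" "a x" "D b x"] by simp
  next
    case False
    have op: "open (U - cball x0 \<epsilon>)" "open (- cball x0 \<epsilon>)" using U by auto
    have "frechet_derivative (\<beta> k) (at x) = frechet_derivative (\<lambda>x. 0) (at x)" for k
      by (rule frechet_derivative_cong_open[OF op(2)])
        (use False zero in \<open>auto simp: \<beta>_def dist_norm norm_minus_commute\<close>)
    then have 1: "D (\<beta> k) x = (\<lambda>j. 0)" for k by (simp add: D_def)
    have 2: "D a x = (\<lambda>j. 0)" "a x = 0" if "x \<in> U"
    proof -
      have "frechet_derivative a (at x) = frechet_derivative (\<lambda>x. 0) (at x)"
        by (rule frechet_derivative_cong_open[OF op(1)])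
          (use False that zero in \<open>auto simp: dist_norm norm_minus_commute\<close>)
      then show "D a x = (\<lambda>j. 0)" by (simp add: D_def)
      show "a x = 0" using False that zero by (auto simp: dist_norm norm_minus_commute)
    qed
    show ?thesis using 1 2 by (cases "x \<in> U") auto
  qed
  show ?thesis
    unfolding set_lebesgue_integral_def pt integral_minus
    by (subst Bochner_Integration.integral_sum)
      (use int0 intI in \<open>auto simp: set_lebesgue_integral_def set_integrable_def\<close>)
qed

section \<open>Principal directions\<close>

text \<open>A maximum point of \<open>x \<bullet> S x\<close> on the unit sphere of the subspace is an eigenvector, the eigenvalue
being the maximum.\<close>

lemma self_adjoint_has_eigenvector:
  fixes S :: "'a::euclidean_space \<Rightarrow> 'a"
  assumes S: "linear S" and T: "subspace T" "S ` T \<subseteq> T" "T \<noteq> {0}"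
    and sa: "\<And>x y. x \<in> T \<Longrightarrow> y \<in> T \<Longrightarrow> S x \<bullet> y = x \<bullet> S y"
  shows "\<exists>x\<in>T. norm x = 1 \<and> (\<exists>k. S x = k *\<^sub>R x)"
proof -
  let ?K = "T \<inter> sphere 0 1"
  have "0 \<in> T" using T(1) by (rule subspace_0)
  then obtain z where z: "z \<in> T" "z \<noteq> 0" using T(3) by blast
  then have "(1 / norm z) *\<^sub>R z \<in> ?K" using subspace_scale[OF T(1)] by simp
  then have ne: "?K \<noteq> {}" by blast
  have "compact ?K" using closed_subspace[OF T(1)] by (simp add: closed_Int_compact)
  moreover have "continuous_on ?K (\<lambda>x. x \<bullet> S x)"
    by (intro continuous_intros linear_continuous_on linear_conv_bounded_linear[THEN iffD1] S)
  ultimately obtain x where x: "x \<in> ?K" "\<And>y. y \<in> ?K \<Longrightarrow> y \<bullet> S y \<le> x \<bullet> S x"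
    using continuous_attains_sup[of ?K "\<lambda>x. x \<bullet> S x"] ne by blast
  define k where "k = x \<bullet> S x"
  have xT: "x \<in> T" and nx: "norm x = 1" using x(1) by auto
  have q: "k * (y \<bullet> y) - y \<bullet> S y \<ge> 0" if "y \<in> T" for y
  proof (cases "y = 0")
    case False
    have "(1 / norm y) *\<^sub>R y \<in> ?K" using that False subspace_scale[OF T(1)] by simp
    from x(2)[OF this] have "(y \<bullet> S y) / (norm y * norm y) \<le> k"
      by (simp add: k_def linear_scale[OF S])
    then show ?thesis using False by (simp add: field_simps dot_square_norm power2_eq_square)
  qed simp
  define z where "z = k *\<^sub>R x - S x"
  have zT: "z \<in> T" unfolding z_def using xT T by (intro subspace_diff subspace_scale) auto
  \<comment> \<open>the quadratic form \<open>k (y \<bullet> y) - y \<bullet> S y\<close> is nonnegative and vanishes at x, so its differential at x is zero\<close>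
  have "0 \<le> 2 * s * (z \<bullet> z) + s\<^sup>2 * (k * (z \<bullet> z) - z \<bullet> S z)" for s
  proof -
    have "x + s *\<^sub>R z \<in> T" using xT zT T(1) by (intro subspace_add subspace_scale)
    from q[OF this] have "0 \<le> k * ((x + s *\<^sub>R z) \<bullet> (x + s *\<^sub>R z)) - (x + s *\<^sub>R z) \<bullet> S (x + s *\<^sub>R z)" .
    also have "\<dots> = (k * (x \<bullet> x) - x \<bullet> S x) + s * (2 * k * (z \<bullet> x) - z \<bullet> S x - x \<bullet> S z)
        + s\<^sup>2 * (k * (z \<bullet> z) - z \<bullet> S z)"
      by (simp add: linear_add[OF S] linear_scale[OF S] inner_add_left inner_add_right
          algebra_simps power2_eq_square inner_commute)
    also have "k * (x \<bullet> x) - x \<bullet> S x = 0" using nx by (simp add: k_def norm_eq_1)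
    also have "2 * k * (z \<bullet> x) - z \<bullet> S x - x \<bullet> S z = 2 * (z \<bullet> z)"
    proof -
      have "x \<bullet> S z = z \<bullet> S x" using sa[OF xT zT] by (simp add: inner_commute)
      moreover have "z \<bullet> z = k * (z \<bullet> x) - z \<bullet> S x"
        by (subst (2) z_def) (simp add: inner_diff_right)
      ultimately show ?thesis by simp
    qed
    finally show ?thesis by (simp add: mult.commute mult.left_commute)
  qed
  then have *: "0 \<le> 2 * s * a + s\<^sup>2 * b" if "a = z \<bullet> z" "b = k * (z \<bullet> z) - z \<bullet> S z" for s a b
    using that by simp
  have "z \<bullet> z \<le> 0"
  proof (rule ccontr)
    define a b where "a = z \<bullet> z" and "b = k * (z \<bullet> z) - z \<bullet> S z"
    assume "\<not> z \<bullet> z \<le> 0"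
    then have a: "a > 0" unfolding a_def by linarith
    \<comment> \<open>negative and so small that the linear term of the quadratic polynomial in s dominates\<close>
    define s where "s = - a / (1 + \<bar>b\<bar>)"
    have s: "s < 0" using a by (simp add: s_def divide_neg_pos)
    have "0 \<le> s * (2 * a + s * b)" using *[OF a_def b_def, of s] by (simp add: power2_eq_square algebra_simps)
    then have "2 * a + s * b \<le> 0" using s by (simp add: zero_le_mult_iff)
    moreover have "\<bar>s * b\<bar> \<le> a"
      using a by (simp add: s_def abs_mult field_simps)
    ultimately show False using a by linarith
  qed
  then have "z = 0" by (metis inner_ge_zero inner_eq_zero_iff antisym)
  then show ?thesis using xT nx by (auto simp: z_def intro!: bexI[of _ x] exI[of _ k])
qed

text \<open>Split off one eigenvector and pass to its orthogonal complement in the subspace, which is again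
invariant.\<close>

theorem self_adjoint_eigenbasis:
  fixes S :: "'a::euclidean_space \<Rightarrow> 'a"
  assumes S: "linear S" and T: "subspace T" "S ` T \<subseteq> T"
    and sa: "\<And>x y. x \<in> T \<Longrightarrow> y \<in> T \<Longrightarrow> S x \<bullet> y = x \<bullet> S y"
  shows "\<exists>B. B \<subseteq> T \<and> pairwise orthogonal B \<and> 0 \<notin> B \<and> span B = T \<and> (\<forall>b\<in>B. \<exists>k. S b = k *\<^sub>R b)"
  using T sa
proof (induction "dim T" arbitrary: T rule: less_induct)
  case less
  show ?case
  proof (cases "T = {0}")
    case True
    then show ?thesis by (intro exI[of _ "{}"]) auto
  next
    case False
    obtain x k where x: "x \<in> T" "norm x = 1" "S x = k *\<^sub>R x"
      using self_adjoint_has_eigenvector[OF S less.prems(1,2) False less.prems(3)] by blast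
    define T' where "T' = T \<inter> {y. x \<bullet> y = 0}"
    have sub: "subspace T'" unfolding T'_def
      by (intro subspace_inter less.prems subspace_hyperplane)
    have inv: "S ` T' \<subseteq> T'"
    proof (rule image_subsetI)
      fix y assume y: "y \<in> T'"
      then have "x \<bullet> S y = S x \<bullet> y" using less.prems(3)[OF x(1), of y] by (simp add: T'_def)
      then show "S y \<in> T'" using y x(3) less.prems(2) by (auto simp: T'_def)
    qed
    have "x \<notin> T'" using x(2) by (simp add: T'_def norm_eq_1)
    then have "T' \<subset> T" using x(1) unfolding T'_def by blast
    then have dim: "dim T' < dim T"
      using sub less.prems(1) by (metis dim_psubset span_eq_iff)
    obtain B where B: "B \<subseteq> T'" "pairwise orthogonal B" "0 \<notin> B" "span B = T'"
        "\<forall>b\<in>B. \<exists>k. S b = k *\<^sub>R b"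
      using less.hyps[OF dim sub inv] less.prems(3) by (auto simp: T'_def)
    have "span (insert x B) = T"
    proof
      show "span (insert x B) \<subseteq> T"
        using x(1) B(1) by (intro span_minimal less.prems) (auto simp: T'_def)
      show "T \<subseteq> span (insert x B)"
      proof
        fix y assume y: "y \<in> T"
        have "y - (x \<bullet> y) *\<^sub>R x \<in> T'"
          using y x less.prems(1) by (auto simp: T'_def inner_diff_right norm_eq_1 intro!: subspace_diff subspace_scale)
        then show "y \<in> span (insert x B)" using B(4) by (auto simp: span_insert)
      qed
    qed
    moreover have "pairwise orthogonal (insert x B)"
      using B(1,2) by (auto simp: pairwise_insert T'_def orthogonal_def inner_commute)
    moreover have "insert x B \<subseteq> T" "0 \<notin> insert x B" using x B by (auto simp: T'_def)
    ultimately show ?thesis using B(5) x(3) by (intro exI[of _ "insert x B"]) auto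
  qed
qed

text \<open>For \<open>K = df\<close> and \<open>M = d\<nu>\<close> the vectors \<open>e j\<close> are the principal directions. The map \<open>M \<circ> K\<^sup>-\<^sup>1\<close> of
the tangent space \<open>range K\<close> is self-adjoint for the ambient inner product, so the spectral theorem applies to it;
\<open>\<pi>\<close> extends the inverse of \<open>K\<close> to the whole space.\<close>

theorem simultaneous_diagonalisation:
  fixes K M :: "real^'n \<Rightarrow> 'a::euclidean_space"
  assumes K: "linear K" "inj K" and M: "linear M" "range M \<subseteq> range K"
    and sym: "\<And>v w. M v \<bullet> K w = M w \<bullet> K v"
  shows "\<exists>e \<kappa>. inj e \<and> independent (range e) \<and> (\<forall>j::'n. M (e j) = \<kappa> j *\<^sub>R K (e j))"
proof -
  obtain \<pi> where \<pi>: "linear \<pi>" "\<pi> \<circ> K = id"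
    using linear_injective_left_inverse[OF K] by blast
  then have \<pi>K: "\<pi> (K v) = v" for v by (metis comp_apply id_apply)
  have "linear (M \<circ> \<pi>)" using \<pi>(1) M(1) by (rule linear_compose)
  moreover have sub: "subspace (range K)" by (rule linear_subspace_image[OF K(1) subspace_UNIV])
  moreover have "(M \<circ> \<pi>) ` range K \<subseteq> range K" using M(2) by auto
  moreover have "(M \<circ> \<pi>) x \<bullet> y = x \<bullet> (M \<circ> \<pi>) y" if "x \<in> range K" "y \<in> range K" for x y
    using that sym by (auto simp: \<pi>K inner_commute)
  ultimately obtain B where B: "B \<subseteq> range K" "pairwise orthogonal B" "0 \<notin> B" "span B = range K"
      "\<forall>b\<in>B. \<exists>k. (M \<circ> \<pi>) b = k *\<^sub>R b"
    using self_adjoint_eigenbasis[of "M \<circ> \<pi>" "range K"] by blast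
  have ind: "independent B" using B(2,3) by (rule pairwise_orthogonal_independent)
  have "card B = dim (range K)" using dim_span_eq_card_independent[OF ind] B(4) by simp
  also have "\<dots> = CARD('n)"
    using dim_image_eq[OF K(1), of UNIV] K(2) by simp
  finally have "card B = CARD('n)" .
  then obtain \<beta> :: "'n \<Rightarrow> 'a" where \<beta>: "bij_betw \<beta> UNIV B"
    using finite_same_card_bij[of UNIV B] independent_imp_finite[OF ind] by (metis finite)
  have K\<pi>: "K (\<pi> (\<beta> j)) = \<beta> j" for j
    using B(1) \<beta> \<pi>K by (metis bij_betwE image_iff subsetD UNIV_I)
  define e where "e = (\<lambda>j. \<pi> (\<beta> j))"
  have eq_im: "\<beta> = K \<circ> e" by (simp add: fun_eq_iff e_def K\<pi>)
  have "inj (K \<circ> e)" using \<beta> by (simp add: bij_betw_def flip: eq_im)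
  then have "inj e" by (rule inj_on_imageI2)
  moreover have "independent (range e)"
  proof -
    have "inj_on \<pi> (span B)" unfolding B(4) by (auto simp: inj_on_def \<pi>K)
    then have "independent (\<pi> ` B)" by (rule linear_independent_injective_image[OF \<pi>(1) ind])
    moreover have "\<pi> ` B = range e" using \<beta> by (auto simp: e_def bij_betw_def)
    ultimately show ?thesis by simp
  qed
  moreover have "\<exists>k. M (e j) = k *\<^sub>R K (e j)" for j
    using B(5) \<beta> by (auto simp: e_def K\<pi> bij_betw_def)
  ultimately show ?thesis by metis
qed

lemma frame_det_scale:
  "frame_det w (\<lambda>j. c j *\<^sub>R u j) = (\<Prod>j\<in>UNIV. c j) * frame_det w u"
proof -
  let ?c = "\<lambda>b. case b of None \<Rightarrow> 1 | Some j \<Rightarrow> c j"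
  have "frame_det w (\<lambda>j. c j *\<^sub>R u j) = det (\<chi> b. ?c b *s (case b of None \<Rightarrow> w | Some j \<Rightarrow> u j))"
    unfolding frame_det_rows
    by (intro arg_cong[of _ _ det]) (simp add: vec_eq_iff split: option.split)
  also have "\<dots> = prod ?c UNIV * frame_det w u"
    unfolding frame_det_rows by (rule det_rows_mul)
  also have "prod ?c UNIV = (\<Prod>j\<in>UNIV. c j)"
    by (simp add: UNIV_option_conv prod.reindex)
  finally show ?thesis .
qed

text \<open>Both sides are multiplied by the same nonzero determinant when the standard basis is replaced by
\<open>e\<close>, and for this basis \<open>r K + t M\<close> merely scales the \<open>j\<close>-th column by \<open>r + t \<kappa>\<^sub>j\<close>.\<close>

lemma frame_det_pencil:
  fixes K M :: "real^'n \<Rightarrow> real^('n::finite option)"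
  assumes K: "linear K" and M: "linear M" and e: "inj e" "independent (range e)"
    and eig: "\<And>j::'n. M (e j) = \<kappa> j *\<^sub>R K (e j)"
  shows "frame_det w (\<lambda>j. r *\<^sub>R K (axis j 1) + t *\<^sub>R M (axis j 1))
    = (\<Prod>j\<in>UNIV. r + t * \<kappa> j) * frame_det w (\<lambda>j. K (axis j 1))"
proof -
  define E where "E = (\<lambda>v::real^'n. \<Sum>j\<in>UNIV. (v $ j) *\<^sub>R e j)"
  have E: "linear E" unfolding E_def
    by (rule linearI) (simp_all add: scaleR_add_left sum.distrib scaleR_sum_right)
  have Ea: "E (axis j 1) = e j" for j
    by (simp add: E_def axis_def if_distrib[of "\<lambda>a. a *\<^sub>R _"] cong: if_cong)
  have "inj E"
    unfolding linear_injective_0[OF E]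
  proof (intro allI impI)
    fix v assume "E v = 0"
    then have "(\<Sum>x\<in>range e. (v $ inv e x) *\<^sub>R x) = 0"
      using e(1) by (simp add: E_def sum.reindex)
    then have "v $ inv e (e j) = 0" for j
      using independentD[OF e(2) finite_imageI[OF finite] subset_refl, of "\<lambda>x. v $ inv e x" "e j"]
      by simp
    then show "v = 0" using e(1) by (simp add: vec_eq_iff)
  qed
  then have dE: "det (matrix E) \<noteq> 0" using det_nz_iff_inj[OF E] by blast
  let ?G = "\<lambda>v. r *\<^sub>R K v + t *\<^sub>R M v"
  have G: "linear ?G" by (intro linear_compose_add linear_compose_scale_right K M)
  have "det (matrix E) * frame_det w (\<lambda>j. ?G (axis j 1)) = frame_det w (\<lambda>j. ?G (E (axis j 1)))"
    by (rule frame_det_compose[OF G, symmetric])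
  also have "\<dots> = frame_det w (\<lambda>j. (r + t * \<kappa> j) *\<^sub>R K (E (axis j 1)))"
    by (simp add: Ea eig algebra_simps)
  also have "\<dots> = (\<Prod>j\<in>UNIV. r + t * \<kappa> j) * (det (matrix E) * frame_det w (\<lambda>j. K (axis j 1)))"
    unfolding frame_det_scale frame_det_compose[OF K] ..
  finally show ?thesis using dE by simp
qed

section \<open>Symmetry of the second derivative\<close>

lemma C2_onD:
  assumes U: "open U" and g: "C2_on U g"
  shows "C1_diff_on U g" and "C1_diff_on U (\<lambda>x. frechet_derivative g (at x) v)"
proof -
  obtain g' where g': "\<And>x. x \<in> U \<Longrightarrow> (g has_derivative blinfun_apply (g' x)) (at x)" "C1_on U g'"
    using g unfolding C2_on_def by blast
  have C1: "C1_diff_on U g'" by (rule C1_on_imp_C1_diff_on[OF g'(2)])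
  have app: "C1_diff_on U (\<lambda>x. blinfun_apply (g' x) v)" for v
    by (rule C1_diff_on_linear[OF _ C1]) (rule blinfun.bounded_linear_left)
  show "C1_diff_on U g"
    by (rule C1_diff_onI[OF g'(1)]) (auto intro: C1_diff_on_continuous app)
  show "C1_diff_on U (\<lambda>x. frechet_derivative g (at x) v)"
    by (rule C1_diff_on_cong[OF U app[of v]]) (metis g'(1) frechet_derivative_at)
qed

text \<open>The mean value theorem, applied first to the difference in the direction \<open>w\<close> as a function along
\<open>v\<close> and then to the directional derivative along \<open>w\<close>.\<close>

lemma second_difference_mean_value:
  fixes \<phi> :: "'a::real_normed_vector \<Rightarrow> real"
  assumes \<phi>: "C1_diff_on U \<phi>" and \<phi>': "C1_diff_on U (\<lambda>y. frechet_derivative \<phi> (at y) v)"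
    and s: "s > 0" and sub: "\<And>\<sigma> \<tau>. 0 \<le> \<sigma> \<Longrightarrow> \<sigma> \<le> s \<Longrightarrow> 0 \<le> \<tau> \<Longrightarrow> \<tau> \<le> s \<Longrightarrow> x + \<sigma> *\<^sub>R v + \<tau> *\<^sub>R w \<in> U"
  shows "\<exists>\<sigma> \<tau>. 0 \<le> \<sigma> \<and> \<sigma> \<le> s \<and> 0 \<le> \<tau> \<and> \<tau> \<le> s \<and>
     \<phi> (x + s *\<^sub>R v + s *\<^sub>R w) - \<phi> (x + s *\<^sub>R v) - \<phi> (x + s *\<^sub>R w) + \<phi> x =
      s\<^sup>2 * frechet_derivative (\<lambda>y. frechet_derivative \<phi> (at y) v) (at (x + \<sigma> *\<^sub>R v + \<tau> *\<^sub>R w)) w"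
proof -
  let ?D = "\<lambda>y. frechet_derivative \<phi> (at y) v"
  have lin: "linear (frechet_derivative g (at y))" if "C1_diff_on U g" "y \<in> U" for g :: "'a \<Rightarrow> real" and y
    using C1_diff_on_has_derivative[OF that] has_derivative_linear by blast
  have line: "((\<lambda>\<sigma>. g (a + \<sigma> *\<^sub>R u)) has_real_derivative frechet_derivative g (at (a + \<sigma> *\<^sub>R u)) u) (at \<sigma>)"
    if g: "C1_diff_on U g" "a + \<sigma> *\<^sub>R u \<in> U" for g :: "'a \<Rightarrow> real" and a u \<sigma>
  proof -
    have "((\<lambda>\<sigma>. a + \<sigma> *\<^sub>R u) has_derivative (\<lambda>h. h *\<^sub>R u)) (at \<sigma>)"
      by (auto intro!: derivative_eq_intros)
    from has_derivative_compose[OF this C1_diff_on_has_derivative[OF g]]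
    show ?thesis
      unfolding has_field_derivative_def by (simp add: linear_scale[OF lin[OF g]] mult_commute_abs)
  qed
  let ?k = "\<lambda>\<sigma>. \<phi> ((x + s *\<^sub>R w) + \<sigma> *\<^sub>R v) - \<phi> (x + \<sigma> *\<^sub>R v)"
  have in1: "(x + s *\<^sub>R w) + \<sigma> *\<^sub>R v \<in> U" "x + \<sigma> *\<^sub>R v \<in> U" if "0 \<le> \<sigma>" "\<sigma> \<le> s" for \<sigma>
    using sub[of \<sigma> s] sub[of \<sigma> 0] that s by (simp_all add: add.assoc add.commute[of "s *\<^sub>R w"])
  have "(?k has_real_derivative ?D ((x + s *\<^sub>R w) + \<sigma> *\<^sub>R v) - ?D (x + \<sigma> *\<^sub>R v)) (at \<sigma>)" if "0 \<le> \<sigma>" "\<sigma> \<le> s" for \<sigma>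
    by (intro DERIV_diff line \<phi> in1 that)
  from MVT2[OF s this] obtain \<sigma> where \<sigma>: "0 < \<sigma>" "\<sigma> < s"
    "?k s - ?k 0 = (s - 0) * (?D ((x + s *\<^sub>R w) + \<sigma> *\<^sub>R v) - ?D (x + \<sigma> *\<^sub>R v))" by blast
  have "((\<lambda>\<tau>. ?D ((x + \<sigma> *\<^sub>R v) + \<tau> *\<^sub>R w)) has_real_derivative
      frechet_derivative ?D (at ((x + \<sigma> *\<^sub>R v) + \<tau> *\<^sub>R w)) w) (at \<tau>)" if "0 \<le> \<tau>" "\<tau> \<le> s" for \<tau>
    using \<sigma> that by (intro line[OF \<phi>'] sub) auto
  from MVT2[OF s this] obtain \<tau> where \<tau>: "0 < \<tau>" "\<tau> < s"
    "?D ((x + \<sigma> *\<^sub>R v) + s *\<^sub>R w) - ?D ((x + \<sigma> *\<^sub>R v) + 0 *\<^sub>R w)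
      = (s - 0) * frechet_derivative ?D (at ((x + \<sigma> *\<^sub>R v) + \<tau> *\<^sub>R w)) w" by blast
  have "?k s - ?k 0 = s * (?D ((x + \<sigma> *\<^sub>R v) + s *\<^sub>R w) - ?D ((x + \<sigma> *\<^sub>R v) + 0 *\<^sub>R w))"
    unfolding \<sigma>(3) by (simp add: add_ac)
  also have "\<dots> = s\<^sup>2 * frechet_derivative ?D (at (x + \<sigma> *\<^sub>R v + \<tau> *\<^sub>R w)) w"
    unfolding \<tau>(3) by (simp add: power2_eq_square)
  finally show ?thesis
    using \<sigma>(1,2) \<tau>(1,2) by (intro exI[of _ \<sigma>] exI[of _ \<tau>]) (auto simp: add_ac)
qed

text \<open>The second difference is symmetric in \<open>v\<close> and \<open>w\<close>, so by the preceding lemma both mixed derivatives,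
taken at suitable points close to \<open>x\<close>, are equal; continuity carries this over to \<open>x\<close>.\<close>

theorem second_derivative_symmetric:
  fixes \<phi> :: "'a::real_normed_vector \<Rightarrow> real"
  assumes U: "open U" "x \<in> U" and \<phi>: "C1_diff_on U \<phi>"
    and \<phi>': "\<And>v. C1_diff_on U (\<lambda>y. frechet_derivative \<phi> (at y) v)"
  shows "frechet_derivative (\<lambda>y. frechet_derivative \<phi> (at y) v) (at x) w
       = frechet_derivative (\<lambda>y. frechet_derivative \<phi> (at y) w) (at x) v"
proof -
  let ?H = "\<lambda>v w y. frechet_derivative (\<lambda>y. frechet_derivative \<phi> (at y) v) (at y) w"
  obtain r where r: "r > 0" "ball x r \<subseteq> U" using U open_contains_ball by blast
  \<comment> \<open>step sizes tending to 0 for which the whole parallelogram lies in the ball of radius r\<close>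
  define s where "s = (\<lambda>n::nat. r / (1 + norm v + norm w) / real (Suc n))"
  have d: "0 < 1 + norm v + norm w" by (intro add_pos_nonneg) auto
  have s0: "s n > 0" for n using r d by (simp add: s_def)
  have slim: "s \<longlonglongrightarrow> 0" unfolding s_def by (rule lim_const_over_n[THEN LIMSEQ_Suc])
  have small: "norm (\<sigma> *\<^sub>R v + \<tau> *\<^sub>R w) \<le> s n * (norm v + norm w)"
    if "0 \<le> \<sigma>" "\<sigma> \<le> s n" "0 \<le> \<tau>" "\<tau> \<le> s n" for \<sigma> \<tau> n
  proof -
    have "norm (\<sigma> *\<^sub>R v + \<tau> *\<^sub>R w) \<le> \<sigma> * norm v + \<tau> * norm w"
      using norm_triangle_ineq[of "\<sigma> *\<^sub>R v" "\<tau> *\<^sub>R w"] that by simp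
    also have "\<dots> \<le> s n * norm v + s n * norm w" using that by (intro add_mono mult_right_mono) auto
    finally show ?thesis by (simp add: distrib_left)
  qed
  have sr: "s n * (norm v + norm w) < r" for n
  proof -
    have "s n \<le> s 0" unfolding s_def using r d by (intro divide_left_mono) auto
    then have "s n * (norm v + norm w) \<le> s 0 * (norm v + norm w)" by (intro mult_right_mono) auto
    also have "\<dots> < r" using r d by (simp add: s_def field_simps)
    finally show ?thesis .
  qed
  have sub: "x + \<sigma> *\<^sub>R v + \<tau> *\<^sub>R w \<in> U" if "0 \<le> \<sigma>" "\<sigma> \<le> s n" "0 \<le> \<tau>" "\<tau> \<le> s n" for \<sigma> \<tau> n
  proof -
    have "dist x (x + \<sigma> *\<^sub>R v + \<tau> *\<^sub>R w) = norm (\<sigma> *\<^sub>R v + \<tau> *\<^sub>R w)"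
      by (metis add.assoc add_diff_cancel_left' dist_commute dist_norm)
    also have "\<dots> < r" using small[OF that] sr[of n] by linarith
    finally show ?thesis using r by auto
  qed
  have "\<exists>p q. norm (p - x) \<le> s n * (norm v + norm w) \<and> norm (q - x) \<le> s n * (norm v + norm w)
     \<and> ?H v w p = ?H w v q" for n
  proof -
    obtain \<sigma> \<tau> where 1: "0 \<le> \<sigma>" "\<sigma> \<le> s n" "0 \<le> \<tau>" "\<tau> \<le> s n"
      "\<phi> (x + s n *\<^sub>R v + s n *\<^sub>R w) - \<phi> (x + s n *\<^sub>R v) - \<phi> (x + s n *\<^sub>R w) + \<phi> x
        = (s n)\<^sup>2 * ?H v w (x + \<sigma> *\<^sub>R v + \<tau> *\<^sub>R w)"
      by (atomize_elim, rule second_difference_mean_value[OF \<phi> \<phi>' s0 sub])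
    have sub': "x + \<sigma> *\<^sub>R w + \<tau> *\<^sub>R v \<in> U" if "0 \<le> \<sigma>" "\<sigma> \<le> s n" "0 \<le> \<tau>" "\<tau> \<le> s n" for \<sigma> \<tau>
      using sub[OF that(3,4,1,2)] by (simp add: add_ac)
    obtain \<sigma>' \<tau>' where 2: "0 \<le> \<sigma>'" "\<sigma>' \<le> s n" "0 \<le> \<tau>'" "\<tau>' \<le> s n"
      "\<phi> (x + s n *\<^sub>R w + s n *\<^sub>R v) - \<phi> (x + s n *\<^sub>R w) - \<phi> (x + s n *\<^sub>R v) + \<phi> x
        = (s n)\<^sup>2 * ?H w v (x + \<sigma>' *\<^sub>R w + \<tau>' *\<^sub>R v)"
      by (atomize_elim, rule second_difference_mean_value[OF \<phi> \<phi>' s0 sub'])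
    have "(s n)\<^sup>2 * ?H v w (x + \<sigma> *\<^sub>R v + \<tau> *\<^sub>R w) = (s n)\<^sup>2 * ?H w v (x + \<sigma>' *\<^sub>R w + \<tau>' *\<^sub>R v)"
      using 1(5) 2(5) unfolding add.assoc add.commute[of "s n *\<^sub>R w"] by linarith
    then have "?H v w (x + \<sigma> *\<^sub>R v + \<tau> *\<^sub>R w) = ?H w v (x + \<sigma>' *\<^sub>R w + \<tau>' *\<^sub>R v)"
      using s0[of n] by simp
    moreover have "norm ((x + \<sigma> *\<^sub>R v + \<tau> *\<^sub>R w) - x) \<le> s n * (norm v + norm w)"
      using small[OF 1(1-4)] by (simp add: add.assoc)
    moreover have "norm ((x + \<sigma>' *\<^sub>R w + \<tau>' *\<^sub>R v) - x) \<le> s n * (norm v + norm w)"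
      using small[OF 2(3,4,1,2)] by (simp add: add_ac)
    ultimately show ?thesis by blast
  qed
  then obtain p q where pq: "\<And>n. norm (p n - x) \<le> s n * (norm v + norm w)"
      "\<And>n. norm (q n - x) \<le> s n * (norm v + norm w)" "\<And>n. ?H v w (p n) = ?H w v (q n)" by metis
  have lim0: "(\<lambda>n. s n * (norm v + norm w)) \<longlonglongrightarrow> 0" using tendsto_mult_left_zero[OF slim] by blast
  have "p \<longlonglongrightarrow> x"
    by (rule LIM_zero_cancel, rule Lim_null_comparison[OF _ lim0]) (simp add: pq(1))
  moreover have "q \<longlonglongrightarrow> x"
    by (rule LIM_zero_cancel, rule Lim_null_comparison[OF _ lim0]) (simp add: pq(2))
  moreover have "isCont (?H v w) x" "isCont (?H w v) x"
    using C1_diff_on_deriv_continuous[OF \<phi>'] U continuous_on_eq_continuous_at by blast+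
  ultimately have "(\<lambda>n. ?H v w (p n)) \<longlonglongrightarrow> ?H v w x" "(\<lambda>n. ?H w v (q n)) \<longlonglongrightarrow> ?H w v x"
    by (auto intro: isCont_tendsto_compose)
  then show ?thesis using LIMSEQ_unique pq(3) by simp
qed

text \<open>Differentiate the transformation law of \<open>frame_det\<close> along the line \<open>K + s L\<close> at \<open>s = 0\<close>.\<close>

lemma polar_det_compose:
  fixes K L :: "real^'n \<Rightarrow> real^('n::finite option)" and T :: "real^'n \<Rightarrow> real^'n"
  assumes K: "linear K" and L: "linear L"
  shows "polar_det w (\<lambda>j. K (T (axis j 1))) (\<lambda>j. L (T (axis j 1)))
    = det (matrix T) * polar_det w (\<lambda>j. K (axis j 1)) (\<lambda>j. L (axis j 1))"
proof -
  have d: "((\<lambda>s. frame_det w (\<lambda>j. u j + s *\<^sub>R v j)) has_real_derivative polar_det w u v) (at 0)"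
    for u v :: "'n \<Rightarrow> real^('n option)"
  proof -
    have "((\<lambda>s. u j + s *\<^sub>R v j) has_vector_derivative v j) (at 0)" for j
      by (auto intro!: derivative_eq_intros)
    from has_derivative_frame_det[where u = "\<lambda>s j. u j + s *\<^sub>R v j", OF this]
    show ?thesis by simp
  qed
  have G: "linear (\<lambda>x. K x + s *\<^sub>R L x)" for s
    by (intro linear_compose_add linear_compose_scale_right K L)
  let ?F = "\<lambda>s. frame_det w (\<lambda>j. K (T (axis j 1)) + s *\<^sub>R L (T (axis j 1)))"
  have "?F = (\<lambda>s. det (matrix T) * frame_det w (\<lambda>j. K (axis j 1) + s *\<^sub>R L (axis j 1)))"
    by (rule ext) (rule frame_det_compose[OF G])
  then have "(?F has_real_derivative
      det (matrix T) * polar_det w (\<lambda>j. K (axis j 1)) (\<lambda>j. L (axis j 1))) (at 0)"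
    by (simp only: DERIV_cmult[OF d])
  then show ?thesis by (rule DERIV_unique[OF d])
qed

lemma set_integrable_compact_support:
  fixes g :: "'a::euclidean_space \<Rightarrow> real"
  assumes U: "continuous_on U g" and C: "compact C" "C \<subseteq> U" and zero: "\<And>x. x \<in> U \<Longrightarrow> x \<notin> C \<Longrightarrow> g x = 0"
  shows "set_integrable lborel U g"
proof -
  have "(\<lambda>x. indicator U x *\<^sub>R g x) = (\<lambda>x. indicator C x *\<^sub>R g x)"
  proof
    fix x show "indicator U x *\<^sub>R g x = indicator C x *\<^sub>R g x"
      using C(2) zero[of x] by (cases "x \<in> U") (auto simp: indicator_def)
  qed
  moreover have "integrable lborel (\<lambda>x. indicator C x *\<^sub>R g x)"
    by (intro borel_integrable_compact C continuous_on_subset[OF U])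
  ultimately show ?thesis unfolding set_integrable_def by simp
qed

section \<open>Charts and densities\<close>

lemma
  assumes c: "is_chart N c"
  shows chart_openin: "openin N (dom_chart c)"
    and chart_subset: "dom_chart c \<subseteq> topspace N"
    and chart_open_image: "open (image_chart c)"
    and param_coord: "p \<in> dom_chart c \<Longrightarrow> param c (coord c p) = p"
    and param_in: "x \<in> image_chart c \<Longrightarrow> param c x \<in> dom_chart c"
    and coord_param: "x \<in> image_chart c \<Longrightarrow> coord c (param c x) = x"
    and chart_continuous: "continuous_map (subtopology N (dom_chart c)) euclidean (coord c)"
    and param_continuous: "continuous_map (top_of_set (image_chart c)) N (param c)"
proof -
  show o: "openin N (dom_chart c)" "open (image_chart c)"
    using c unfolding is_chart_def by auto
  show sub: "dom_chart c \<subseteq> topspace N" using o by (simp add: openin_subset)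
  have h: "homeomorphic_map (subtopology N (dom_chart c)) (top_of_set (image_chart c)) (coord c)"
    using c unfolding is_chart_def by auto
  have top: "topspace (subtopology N (dom_chart c)) = dom_chart c" using sub by auto
  have inj: "inj_on (coord c) (dom_chart c)"
    using h unfolding homeomorphic_map_def top by blast
  show pc: "param c (coord c p) = p" if "p \<in> dom_chart c" for p
    unfolding param_def using inj that by (rule inv_into_f_f)
  show "param c x \<in> dom_chart c" if "x \<in> image_chart c" for x
    unfolding param_def using that by (rule inv_into_into)
  show "coord c (param c x) = x" if "x \<in> image_chart c" for x
    unfolding param_def using that by (rule f_inv_into_f)
  show "continuous_map (subtopology N (dom_chart c)) euclidean (coord c)"
    using homeomorphic_imp_continuous_map[OF h] by (simp add: continuous_map_in_subtopology)
  obtain g where g: "homeomorphic_maps (subtopology N (dom_chart c)) (top_of_set (image_chart c)) (coord c) g"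
    using h unfolding homeomorphic_map_maps by blast
  then have gc: "continuous_map (top_of_set (image_chart c)) (subtopology N (dom_chart c)) g"
    and "\<And>p. p \<in> dom_chart c \<Longrightarrow> g (coord c p) = p"
    unfolding homeomorphic_maps_def top by auto
  then have "continuous_map (top_of_set (image_chart c)) (subtopology N (dom_chart c)) (param c)"
    by (intro continuous_map_eq[OF gc]) (auto simp: pc)
  then show "continuous_map (top_of_set (image_chart c)) N (param c)"
    by (simp add: continuous_map_in_subtopology)
qed

lemma open_coord_image:
  assumes c: "is_chart N c" and W: "openin N W"
  shows "open (coord c ` (dom_chart c \<inter> W))"
proof -
  have "openin (top_of_set (image_chart c)) {x \<in> image_chart c. param c x \<in> W}"
    using param_continuous[OF c] W by (auto simp: continuous_map_def)
  then have "open {x \<in> image_chart c. param c x \<in> W}"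
    using chart_open_image[OF c] by (simp add: openin_open_eq)
  moreover have "{x \<in> image_chart c. param c x \<in> W} = coord c ` (dom_chart c \<inter> W)"
    using param_coord[OF c] by force
  ultimately show ?thesis by simp
qed

lemma openin_coord_vimage:
  assumes c: "is_chart N c" and V: "open V"
  shows "openin N {p \<in> dom_chart c. coord c p \<in> V}"
proof -
  have "openin (subtopology N (dom_chart c)) {p \<in> topspace (subtopology N (dom_chart c)). coord c p \<in> V}"
    using chart_continuous[OF c] V by (auto simp: continuous_map_def)
  moreover have "{p \<in> topspace (subtopology N (dom_chart c)). coord c p \<in> V} = {p \<in> dom_chart c. coord c p \<in> V}"
    using chart_subset[OF c] by auto
  ultimately show ?thesis using openin_open_subtopology[OF chart_openin[OF c]] by metis
qed

lemma compact_coord_image: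
  assumes c: "is_chart N c" and K: "compactin N K" "K \<subseteq> dom_chart c"
  shows "compact (coord c ` K)"
proof -
  have "compactin (subtopology N (dom_chart c)) K" using K by (simp add: compactin_subtopology)
  then have "compactin euclidean (coord c ` K)"
    using image_compactin chart_continuous[OF c] by blast
  then show ?thesis by simp
qed

lemma compactin_param_image:
  assumes c: "is_chart N c" and C: "compact C" "C \<subseteq> image_chart c"
  shows "compactin N (param c ` C)"
proof -
  have "compactin (top_of_set (image_chart c)) C" using C by (simp add: compactin_subtopology)
  then show ?thesis using image_compactin param_continuous[OF c] by blast
qed

definition C1_fun :: "('a, 'n::finite) chart set \<Rightarrow> ('a \<Rightarrow> 'b::real_normed_vector) \<Rightarrow> bool" where
  "C1_fun \<A> g \<longleftrightarrow> (\<forall>c\<in>\<A>. C1_diff_on (image_chart c) (g \<circ> param c))"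

text \<open>The coefficients of a continuous \<open>n\<close>-form with respect to the charts of an oriented atlas. As the
Jacobian determinants are positive, such coefficients can be integrated chart by chart.\<close>

definition density :: "('a, 'n::finite) chart set \<Rightarrow> (('a, 'n) chart \<Rightarrow> 'a \<Rightarrow> real) \<Rightarrow> bool" where
  "density \<A> \<Phi> \<longleftrightarrow> (\<forall>c\<in>\<A>. continuous_on (image_chart c) (\<Phi> c \<circ> param c)) \<and>
     (\<forall>c\<in>\<A>. \<forall>d\<in>\<A>. \<forall>p\<in>dom_chart c \<inter> dom_chart d.
        \<Phi> c p = det (matrix (frechet_derivative (coord d \<circ> param c) (at (coord c p)))) * \<Phi> d p)"

abbreviation chart_integral :: "('a, 'n::finite) chart \<Rightarrow> ('a \<Rightarrow> real) \<Rightarrow> real" where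
  "chart_integral c h \<equiv> set_lebesgue_integral lborel (image_chart c) (h \<circ> param c)"

locale closed_manifold =
  fixes N :: "'a topology" and \<A> :: "('a, 'n::finite) chart set"
  assumes manifold: "closed_oriented_manifold N \<A>"
begin

lemma chart: "c \<in> \<A> \<Longrightarrow> is_chart N c"
  using manifold unfolding closed_oriented_manifold_def oriented_C2_atlas_def by blast

lemma compact_N: "compact_space N" and Hausdorff_N: "Hausdorff_space N"
  using manifold unfolding closed_oriented_manifold_def by auto

lemma topspace_N: "topspace N = (\<Union>c\<in>\<A>. dom_chart c)"
  using manifold unfolding closed_oriented_manifold_def oriented_C2_atlas_def by blast

lemma chart_at: "p \<in> topspace N \<Longrightarrow> \<exists>c\<in>\<A>. p \<in> dom_chart c"
  using topspace_N by auto

lemma coord_in [simp]: "p \<in> dom_chart c \<Longrightarrow> coord c p \<in> image_chart c"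
  by (rule imageI)

context
  fixes c d :: "('a, 'n) chart"
  assumes c: "c \<in> \<A>" and d: "d \<in> \<A>"
begin

definition "overlap = coord c ` (dom_chart c \<inter> dom_chart d)"

lemma open_overlap: "open overlap"
  unfolding overlap_def by (rule open_coord_image[OF chart[OF c] chart_openin[OF chart[OF d]]])

lemma overlap_subset: "overlap \<subseteq> image_chart c"
  unfolding overlap_def by blast

lemma overlap_iff: "x \<in> image_chart c \<Longrightarrow> x \<in> overlap \<longleftrightarrow> param c x \<in> dom_chart d"
proof
  assume "x \<in> overlap"
  then obtain p where "p \<in> dom_chart c" "p \<in> dom_chart d" "x = coord c p" by (auto simp: overlap_def)
  then show "param c x \<in> dom_chart d" using param_coord[OF chart[OF c]] by simp
next
  assume x: "x \<in> image_chart c" "param c x \<in> dom_chart d"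
  then have "coord c (param c x) \<in> overlap"
    unfolding overlap_def using param_in[OF chart[OF c]] by blast
  then show "x \<in> overlap" using coord_param[OF chart[OF c] x(1)] by simp
qed

lemma transition_C1: "C1_diff_on overlap (coord d \<circ> param c)"
  using manifold c d unfolding closed_oriented_manifold_def oriented_C2_atlas_def overlap_def
  by (intro C2_onD(1)[OF open_overlap[unfolded overlap_def]]) blast

lemma transition_det_pos:
  "x \<in> overlap \<Longrightarrow> det (matrix (frechet_derivative (coord d \<circ> param c) (at x))) > 0"
  using manifold c d unfolding closed_oriented_manifold_def oriented_C2_atlas_def overlap_def by blast

lemma param_transition: "x \<in> overlap \<Longrightarrow> param d ((coord d \<circ> param c) x) = param c x"
  unfolding overlap_def using param_coord[OF chart[OF c]] param_coord[OF chart[OF d]] by auto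

lemma chain_rule:
  assumes p: "p \<in> dom_chart c" "p \<in> dom_chart d"
    and g: "(g \<circ> param d) differentiable (at (coord d p))"
  shows "(g \<circ> param c) differentiable (at (coord c p))"
    and "differential c g p = (\<lambda>v. differential d g p (frechet_derivative (coord d \<circ> param c) (at (coord c p)) v))"
proof -
  let ?x = "coord c p" and ?\<tau> = "coord d \<circ> param c"
  have x: "?x \<in> overlap" using p by (auto simp: overlap_def)
  have \<tau>x: "?\<tau> ?x = coord d p" using param_coord[OF chart[OF c] p(1)] by simp
  have "(?\<tau> has_derivative frechet_derivative ?\<tau> (at ?x)) (at ?x)"
    by (rule C1_diff_on_has_derivative[OF transition_C1 x])
  moreover have "((g \<circ> param d) has_derivative differential d g p) (at (?\<tau> ?x))"
    unfolding \<tau>x differential_def using g frechet_derivative_works by blast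
  ultimately have "((\<lambda>x. (g \<circ> param d) (?\<tau> x)) has_derivative
      (\<lambda>v. differential d g p (frechet_derivative ?\<tau> (at ?x) v))) (at ?x)"
    by (rule has_derivative_compose)
  then have D: "((g \<circ> param c) has_derivative (\<lambda>v. differential d g p (frechet_derivative ?\<tau> (at ?x) v))) (at ?x)"
    by (rule has_derivative_transform_within_open[OF _ open_overlap x]) (metis comp_apply param_transition)
  show "(g \<circ> param c) differentiable (at ?x)" using D by (rule differentiableI)
  show "differential c g p = (\<lambda>v. differential d g p (frechet_derivative ?\<tau> (at ?x) v))"
    unfolding differential_def[of c] by (rule frechet_derivative_at[OF D, symmetric])
qed

end

lemma C1_fun_differentiable:
  "C1_fun \<A> g \<Longrightarrow> c \<in> \<A> \<Longrightarrow> p \<in> dom_chart c \<Longrightarrow> (g \<circ> param c) differentiable (at (coord c p))"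
  unfolding C1_fun_def by (meson C1_diff_on_differentiable coord_in)

lemma C1_fun_linear:
  assumes "C1_fun \<A> g" "c \<in> \<A>" "p \<in> dom_chart c" shows "linear (differential c g p)"
  using C1_fun_differentiable[OF assms] unfolding differential_def
  by (metis frechet_derivative_works has_derivative_linear)

lemma C1_fun_continuous_differential:
  assumes "C1_fun \<A> g" "c \<in> \<A>"
  shows "continuous_on (image_chart c) (\<lambda>x. differential c g (param c x) v)"
proof -
  have "continuous_on (image_chart c) (\<lambda>x. frechet_derivative (g \<circ> param c) (at x) v)"
    using assms unfolding C1_fun_def by (blast intro: C1_diff_on_deriv_continuous)
  then show ?thesis
    unfolding differential_def using coord_param[OF chart[OF assms(2)]]
    by (simp cong: continuous_on_cong)
qed

lemma C1_fun_continuous_on: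
  "C1_fun \<A> g \<Longrightarrow> c \<in> \<A> \<Longrightarrow> continuous_on (image_chart c) (\<lambda>x. g (param c x))"
  unfolding C1_fun_def using C1_diff_on_continuous by (fastforce simp: o_def)

lemma C1_fun_continuous_map:
  fixes g :: "'a \<Rightarrow> 'b::real_normed_vector"
  assumes g: "C1_fun \<A> g" shows "continuous_map N euclidean g"
  unfolding continuous_map_def
proof (intro conjI allI impI)
  fix V :: "'b set" assume "openin euclidean V"
  then have V: "open V" by simp
  show "openin N {p \<in> topspace N. g p \<in> V}"
  proof (subst openin_subopen, intro ballI)
    fix p assume "p \<in> {p \<in> topspace N. g p \<in> V}"
    then obtain c where c: "c \<in> \<A>" "p \<in> dom_chart c" "g p \<in> V" using chart_at by blast
    let ?V = "{x \<in> image_chart c. g (param c x) \<in> V}"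
    have "open ?V"
      using continuous_open_preimage[OF C1_fun_continuous_on[OF g c(1)] chart_open_image[OF chart[OF c(1)]] V]
      by (simp add: vimage_def Int_def)
    then have "openin N {q \<in> dom_chart c. coord c q \<in> ?V}"
      by (rule openin_coord_vimage[OF chart[OF c(1)]])
    moreover have "{q \<in> dom_chart c. coord c q \<in> ?V} \<subseteq> {p \<in> topspace N. g p \<in> V}"
    proof
      fix q assume "q \<in> {q \<in> dom_chart c. coord c q \<in> ?V}"
      then have "q \<in> dom_chart c" "g (param c (coord c q)) \<in> V" by blast+
      then show "q \<in> {p \<in> topspace N. g p \<in> V}"
        using param_coord[OF chart[OF c(1)]] chart_subset[OF chart[OF c(1)]] by auto
    qed
    moreover have "p \<in> {q \<in> dom_chart c. coord c q \<in> ?V}"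
      using c param_coord[OF chart[OF c(1)]] by auto
    ultimately show "\<exists>T. openin N T \<and> p \<in> T \<and> T \<subseteq> {p \<in> topspace N. g p \<in> V}" by blast
  qed
qed simp

lemma continuous_on_param:
  assumes "c \<in> \<A>" "continuous_map N euclideanreal g"
  shows "continuous_on (image_chart c) (g \<circ> param c)"
  using continuous_map_compose[OF param_continuous[OF chart[OF assms(1)]] assms(2)] by simp

lemma density_times:
  assumes "continuous_map N euclideanreal g" "density \<A> \<Phi>"
  shows "density \<A> (\<lambda>c p. g p * \<Phi> c p)"
proof -
  have "continuous_on (image_chart c) (\<lambda>x. (g \<circ> param c) x * (\<Phi> c \<circ> param c) x)" if "c \<in> \<A>" for c
  proof (rule continuous_on_mult[OF continuous_on_param[OF that assms(1)]])
    show "continuous_on (image_chart c) (\<Phi> c \<circ> param c)"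
      using assms(2) that by (simp only: density_def)
  qed
  then have cont: "continuous_on (image_chart c) ((\<lambda>p. g p * \<Phi> c p) \<circ> param c)" if "c \<in> \<A>" for c
    using that by (simp only: comp_def)
  have law: "\<Phi> c p = det (matrix (frechet_derivative (coord d \<circ> param c) (at (coord c p)))) * \<Phi> d p"
    if "c \<in> \<A>" "d \<in> \<A>" "p \<in> dom_chart c \<inter> dom_chart d" for c d p
    using assms(2) that unfolding density_def by blast
  show ?thesis
    unfolding density_def
  proof (intro conjI ballI cont)
    fix c d p assume "c \<in> \<A>" "d \<in> \<A>" "p \<in> dom_chart c \<inter> dom_chart d"
    from law[OF this]
    show "g p * \<Phi> c p = det (matrix (frechet_derivative (coord d \<circ> param c) (at (coord c p)))) * (g p * \<Phi> d p)"
      by (simp only: mult.left_commute)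
  qed
qed

lemma density_integrable:
  assumes \<Phi>: "density \<A> \<Phi>" and c: "c \<in> \<A>" and K: "compactin N K" "K \<subseteq> dom_chart c"
    and zero: "\<And>p. p \<in> dom_chart c \<Longrightarrow> p \<notin> K \<Longrightarrow> \<Phi> c p = 0"
  shows "set_integrable lborel (image_chart c) (\<Phi> c \<circ> param c)"
proof (rule set_integrable_compact_support[OF _ compact_coord_image[OF chart[OF c] K]])
  show "continuous_on (image_chart c) (\<Phi> c \<circ> param c)" using \<Phi> c by (simp add: density_def)
  show "coord c ` K \<subseteq> image_chart c" using K(2) by blast
  fix x assume x: "x \<in> image_chart c" "x \<notin> coord c ` K"
  then have "param c x \<notin> K" using coord_param[OF chart[OF c] x(1)] by (metis imageI)
  then show "(\<Phi> c \<circ> param c) x = 0" using zero param_in[OF chart[OF c] x(1)] by simp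
qed

text \<open>Both integrals extend only over the overlap of the two charts, where the change of variables formula
for the transition map turns one into the other.\<close>

lemma chart_integral_transfer:
  assumes \<Phi>: "density \<A> \<Phi>" and c: "c \<in> \<A>" and d: "d \<in> \<A>"
    and K: "compactin N K" "K \<subseteq> dom_chart c" "K \<subseteq> dom_chart d"
    and zero: "\<And>p. p \<in> dom_chart c \<Longrightarrow> p \<notin> K \<Longrightarrow> \<Phi> c p = 0" "\<And>p. p \<in> dom_chart d \<Longrightarrow> p \<notin> K \<Longrightarrow> \<Phi> d p = 0"
  shows "chart_integral c (\<Phi> c) = chart_integral d (\<Phi> d)"
proof -
  let ?\<tau> = "coord d \<circ> param c" and ?W = "overlap c d" and ?V = "overlap d c"
  let ?\<Phi>c = "\<Phi> c \<circ> param c" and ?\<Phi>d = "\<Phi> d \<circ> param d"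
  let ?J = "\<lambda>x. \<bar>det (matrix (frechet_derivative ?\<tau> (at x)))\<bar>"
  have ind_c: "indicator (image_chart c) x *\<^sub>R ?\<Phi>c x = indicator ?W x *\<^sub>R ?\<Phi>c x" for x
    using overlap_subset[OF c d] overlap_iff[OF c d, of x] zero(1)[OF param_in[OF chart[OF c], of x]] K(3)
    by (auto simp: indicator_def)
  have ind_d: "indicator (image_chart d) x *\<^sub>R ?\<Phi>d x = indicator ?V x *\<^sub>R ?\<Phi>d x" for x
    using overlap_subset[OF d c] overlap_iff[OF d c, of x] zero(2)[OF param_in[OF chart[OF d], of x]] K(2)
    by (auto simp: indicator_def)
  have int_c: "set_integrable lborel ?W ?\<Phi>c"
    using density_integrable[OF \<Phi> c K(1,2) zero(1)] unfolding set_integrable_def ind_c .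
  have int_d: "set_integrable lborel ?V ?\<Phi>d"
    using density_integrable[OF \<Phi> d K(1,3) zero(2)] unfolding set_integrable_def ind_d .
  have im: "?\<tau> ` ?W = ?V"
    unfolding overlap_def[OF c d] overlap_def[OF d c] using param_coord[OF chart[OF c]]
    by (force simp: image_image)
  have inj: "inj_on ?\<tau> ?W"
  proof (rule inj_onI)
    fix x y assume xy: "x \<in> ?W" "y \<in> ?W" "?\<tau> x = ?\<tau> y"
    then have "param c x = param c y" using param_transition[OF c d] by metis
    then show "x = y" using xy overlap_subset[OF c d] coord_param[OF chart[OF c]] by (metis subsetD)
  qed
  have eq: "?J x * ?\<Phi>d (?\<tau> x) = ?\<Phi>c x" if x: "x \<in> ?W" for x
  proof -
    have p: "param c x \<in> dom_chart c \<inter> dom_chart d" "coord c (param c x) = x"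
      using x overlap_subset[OF c d] overlap_iff[OF c d] param_in[OF chart[OF c]] coord_param[OF chart[OF c]] by blast+
    have "\<Phi> c (param c x) = det (matrix (frechet_derivative ?\<tau> (at (coord c (param c x))))) * \<Phi> d (param c x)"
      using \<Phi> c d p(1) unfolding density_def by blast
    then show ?thesis
      using transition_det_pos[OF c d x] param_transition[OF c d x] p(2) by simp
  qed
  have "chart_integral c (\<Phi> c) = (LINT x:?W|lborel. ?\<Phi>c x)"
    unfolding set_lebesgue_integral_def ind_c ..
  also have "\<dots> = (LINT x:?W|lborel. ?J x * ?\<Phi>d (?\<tau> x))"
    by (rule set_lebesgue_integral_cong) (use open_overlap[OF c d] eq in auto)
  also have "\<dots> = (LINT y:?\<tau> ` ?W|lborel. ?\<Phi>d y)"
  proof (rule set_integral_change_of_variables[OF open_overlap[OF c d] _ inj])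
    show "(?\<tau> has_derivative frechet_derivative ?\<tau> (at x)) (at x)" if "x \<in> ?W" for x
      by (rule C1_diff_on_has_derivative[OF transition_C1[OF c d] that])
    show "set_integrable lborel (?\<tau> ` ?W) ?\<Phi>d" unfolding im by (rule int_d)
    have "(\<lambda>x. indicator ?W x *\<^sub>R (?J x * ?\<Phi>d (?\<tau> x))) = (\<lambda>x. indicator ?W x *\<^sub>R ?\<Phi>c x)"
      using eq by (auto simp: fun_eq_iff indicator_def)
    then show "set_integrable lborel ?W (\<lambda>x. ?J x * ?\<Phi>d (?\<tau> x))"
      using int_c unfolding set_integrable_def by simp
  qed
  also have "\<dots> = chart_integral d (\<Phi> d)"
    unfolding im set_lebesgue_integral_def ind_d ..
  finally show ?thesis .
qed

context
  fixes B \<rho> assumes part: "partition_of_unity N \<A> B \<rho>"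
begin

lemma partition_chart: "c \<in> B \<Longrightarrow> c \<in> \<A>"
  and partition_continuous: "c \<in> B \<Longrightarrow> continuous_map N euclideanreal (\<rho> c)"
  and partition_sum: "p \<in> topspace N \<Longrightarrow> (\<Sum>c\<in>B. \<rho> c p) = 1"
  using part unfolding partition_of_unity_def by auto

lemma partition_support:
  assumes "c \<in> B"
  shows "compactin N (N closure_of {p \<in> topspace N. \<rho> c p \<noteq> 0})"
    and "N closure_of {p \<in> topspace N. \<rho> c p \<noteq> 0} \<subseteq> dom_chart c"
    and "p \<in> topspace N \<Longrightarrow> p \<notin> N closure_of {p \<in> topspace N. \<rho> c p \<noteq> 0} \<Longrightarrow> \<rho> c p = 0"
proof -
  show "compactin N (N closure_of {p \<in> topspace N. \<rho> c p \<noteq> 0})"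
    by (rule closedin_compact_space[OF compact_N closedin_closure_of])
  show "N closure_of {p \<in> topspace N. \<rho> c p \<noteq> 0} \<subseteq> dom_chart c"
    using part assms unfolding partition_of_unity_def by blast
  show "p \<in> topspace N \<Longrightarrow> p \<notin> N closure_of {p \<in> topspace N. \<rho> c p \<noteq> 0} \<Longrightarrow> \<rho> c p = 0"
    using closure_of_subset[of "{p \<in> topspace N. \<rho> c p \<noteq> 0}" N] by blast
qed

lemma partition_density_integrable:
  assumes \<Phi>: "density \<A> \<Phi>" and c: "c \<in> B"
  shows "set_integrable lborel (image_chart c) ((\<lambda>p. \<rho> c p * \<Phi> c p) \<circ> param c)"
  using density_integrable[OF density_times[OF partition_continuous[OF c] \<Phi>] partition_chart[OF c]
      partition_support(1,2)[OF c]] partition_support(3)[OF c] chart_subset[OF chart[OF partition_chart[OF c]]]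
  by auto

text \<open>Multiplying the density by a member of the partition keeps the support in the chart of \<open>d\<close> and puts it into
that of \<open>c\<close> as well; after transferring every term to the chart \<open>d\<close> the partition adds up to 1.\<close>

lemma partition_integral_localized:
  assumes \<Phi>: "density \<A> \<Phi>" and d: "d \<in> \<A>" and K: "compactin N K" "K \<subseteq> dom_chart d"
    and zero: "\<And>c p. c \<in> \<A> \<Longrightarrow> p \<in> dom_chart c \<Longrightarrow> p \<notin> K \<Longrightarrow> \<Phi> c p = 0"
  shows "(\<Sum>c\<in>B. chart_integral c (\<lambda>p. \<rho> c p * \<Phi> c p)) = chart_integral d (\<Phi> d)"
proof -
  let ?S = "\<lambda>c. N closure_of {p \<in> topspace N. \<rho> c p \<noteq> 0}"
  have 1: "chart_integral c (\<lambda>p. \<rho> c p * \<Phi> c p) = chart_integral d (\<lambda>p. \<rho> c p * \<Phi> d p)"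
    "set_integrable lborel (image_chart d) ((\<lambda>p. \<rho> c p * \<Phi> d p) \<circ> param d)" if c: "c \<in> B" for c
  proof -
    note cA = partition_chart[OF c]
    have dens: "density \<A> (\<lambda>e p. \<rho> c p * \<Phi> e p)"
      by (rule density_times[OF partition_continuous[OF c] \<Phi>])
    have K': "compactin N (?S c \<inter> K)"
      by (rule closed_Int_compactin[OF closedin_closure_of K(1)])
    have z: "\<rho> c p * \<Phi> e p = 0" if "e \<in> \<A>" "p \<in> dom_chart e" "p \<notin> ?S c \<inter> K" for e p
      using that zero[of e p] partition_support(3)[OF c, of p] chart_subset[OF chart[OF that(1)]] by auto
    show "chart_integral c (\<lambda>p. \<rho> c p * \<Phi> c p) = chart_integral d (\<lambda>p. \<rho> c p * \<Phi> d p)"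
      by (rule chart_integral_transfer[OF dens cA d K'])
        (use K(2) partition_support(2)[OF c] z cA d in auto)
    show "set_integrable lborel (image_chart d) ((\<lambda>p. \<rho> c p * \<Phi> d p) \<circ> param d)"
      by (rule density_integrable[OF dens d K']) (use K(2) z d in auto)
  qed
  have "(\<Sum>c\<in>B. chart_integral c (\<lambda>p. \<rho> c p * \<Phi> c p)) = (\<Sum>c\<in>B. chart_integral d (\<lambda>p. \<rho> c p * \<Phi> d p))"
    by (intro sum.cong refl 1)
  also have "\<dots> = (LINT x|lborel. (\<Sum>c\<in>B. indicator (image_chart d) x *\<^sub>R ((\<lambda>p. \<rho> c p * \<Phi> d p) \<circ> param d) x))"
    unfolding set_lebesgue_integral_def
    by (rule Bochner_Integration.integral_sum[symmetric]) (use 1(2) in \<open>simp add: set_integrable_def\<close>)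
  also have "\<dots> = (LINT x|lborel. indicator (image_chart d) x *\<^sub>R (\<Phi> d \<circ> param d) x)"
  proof (rule Bochner_Integration.integral_cong[OF refl])
    fix x
    have "(\<Sum>c\<in>B. \<rho> c (param d x) * \<Phi> d (param d x)) = \<Phi> d (param d x)" if "x \<in> image_chart d"
    proof -
      have "param d x \<in> topspace N"
        using param_in[OF chart[OF d] that] chart_subset[OF chart[OF d]] by blast
      then show ?thesis using partition_sum by (simp flip: sum_distrib_right)
    qed
    then show "(\<Sum>c\<in>B. indicator (image_chart d) x *\<^sub>R ((\<lambda>p. \<rho> c p * \<Phi> d p) \<circ> param d) x)
      = indicator (image_chart d) x *\<^sub>R (\<Phi> d \<circ> param d) x"
      by (simp add: indicator_def)
  qed
  finally show ?thesis unfolding set_lebesgue_integral_def .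
qed

end

end

section \<open>Partitions of unity\<close>

context closed_manifold
begin

lemma C1_fun_scaleR:
  "C1_fun \<A> \<gamma> \<Longrightarrow> C1_fun \<A> g \<Longrightarrow> C1_fun \<A> (\<lambda>p. \<gamma> p *\<^sub>R g p)"
  unfolding C1_fun_def comp_def by (auto intro: C1_diff_on_scaleR)

lemma C1_fun_sum: "(\<And>i. i \<in> I \<Longrightarrow> C1_fun \<A> (g i)) \<Longrightarrow> C1_fun \<A> (\<lambda>p. \<Sum>i\<in>I. g i p)"
  unfolding C1_fun_def comp_def by (intro ballI C1_diff_on_sum) blast

text \<open>The support of the bump is compact, hence closed by the Hausdorff property, so near a point outside
the chart \<open>c\<close> the function vanishes.\<close>

lemma C1_fun_bump:
  assumes c: "c \<in> \<A>" and e: "\<epsilon> > 0" "cball x0 \<epsilon> \<subseteq> image_chart c"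
  shows "C1_fun \<A> (\<lambda>q. if q \<in> dom_chart c then bump x0 (\<epsilon>/2) \<epsilon> (coord c q) else 0)"
  unfolding C1_fun_def
proof
  fix d assume d: "d \<in> \<A>"
  have e': "0 < \<epsilon>/2" "\<epsilon>/2 < \<epsilon>" using e by auto
  let ?\<beta> = "\<lambda>q. if q \<in> dom_chart c then bump x0 (\<epsilon>/2) \<epsilon> (coord c q) else 0"
  let ?K = "param c ` cball x0 \<epsilon>"
  have K: "compactin N ?K" by (rule compactin_param_image[OF chart[OF c] compact_cball e(2)])
  have Kd: "?K \<subseteq> dom_chart c" using e(2) param_in[OF chart[OF c]] by blast
  have "openin N (topspace N - ?K)"
    using compactin_imp_closedin[OF Hausdorff_N K] by blast
  then have opT: "open (coord d ` (dom_chart d \<inter> (topspace N - ?K)))"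
    by (rule open_coord_image[OF chart[OF d]])
  show "C1_diff_on (image_chart d) (?\<beta> \<circ> param d)"
  proof (rule C1_diff_on_local)
    fix x assume x: "x \<in> image_chart d"
    show "\<exists>T. open T \<and> x \<in> T \<and> C1_diff_on T (?\<beta> \<circ> param d)"
    proof (cases "param d x \<in> dom_chart c")
      case True
      then have xo: "x \<in> overlap d c" using overlap_iff[OF d c x] by simp
      have "C1_diff_on (overlap d c) (\<lambda>y. bump x0 (\<epsilon>/2) \<epsilon> ((coord c \<circ> param d) y))"
        by (rule C1_diff_on_compose[OF transition_C1[OF d c] bump_C1[OF e'] subset_UNIV])
      then have "C1_diff_on (overlap d c) (?\<beta> \<circ> param d)"
        by (rule C1_diff_on_cong[OF open_overlap[OF d c]])
          (use overlap_iff[OF d c] overlap_subset[OF d c] in auto)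
      then show ?thesis using open_overlap[OF d c] xo by blast
    next
      case False
      let ?T = "coord d ` (dom_chart d \<inter> (topspace N - ?K))"
      have "param d x \<in> dom_chart d \<inter> (topspace N - ?K)"
        using False Kd param_in[OF chart[OF d] x] chart_subset[OF chart[OF d]] by blast
      then have "coord d (param d x) \<in> ?T" by (rule imageI)
      then have xT: "x \<in> ?T" using coord_param[OF chart[OF d] x] by simp
      have "C1_diff_on ?T (?\<beta> \<circ> param d)"
      proof (rule C1_diff_on_cong[OF opT C1_diff_on_const[of _ 0]])
        fix y assume "y \<in> ?T"
        then obtain q where q: "q \<in> dom_chart d" "q \<notin> ?K" "y = coord d q" by blast
        have "bump x0 (\<epsilon>/2) \<epsilon> (coord c q) = 0" if qc: "q \<in> dom_chart c"
        proof (rule bump_eq_0[OF e'], rule ccontr)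
          assume "\<not> \<epsilon> \<le> norm (coord c q - x0)"
          then have "coord c q \<in> cball x0 \<epsilon>" by (simp add: dist_norm norm_minus_commute)
          then have "param c (coord c q) \<in> ?K" by (rule imageI)
          then show False using q(2) param_coord[OF chart[OF c] qc] by simp
        qed
        then show "0 = (?\<beta> \<circ> param d) y" using q param_coord[OF chart[OF d] q(1)] by simp
      qed
      then show ?thesis using opT xT by blast
    qed
  qed
qed

text \<open>The bumps are indexed by the points of a finite set rather than by charts: each is then supported
in a ball whose concentric ball of twice the radius lies in the image of its chart, which is the
room that the cut-off in \<open>integral_polar_det_by_parts\<close> takes. Finitely many half-size balls
cover the manifold, so the sum of the bumps is positive and one can divide by it.\<close>

lemma exists_C1_partition:
  obtains F :: "'a set" and chrt x \<epsilon> \<eta> where "finite F"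
    and "\<And>i. i \<in> F \<Longrightarrow> chrt i \<in> \<A> \<and> \<epsilon> i > 0 \<and> cball (x i) (2 * \<epsilon> i) \<subseteq> image_chart (chrt i)"
    and "\<And>i. i \<in> F \<Longrightarrow> C1_fun \<A> (\<eta> i)" and "\<And>i p. i \<in> F \<Longrightarrow> 0 \<le> \<eta> i p"
    and "\<And>i p. i \<in> F \<Longrightarrow> p \<notin> dom_chart (chrt i) \<or> \<epsilon> i \<le> norm (coord (chrt i) p - x i) \<Longrightarrow> \<eta> i p = (0::real)"
    and "\<And>p. p \<in> topspace N \<Longrightarrow> (\<Sum>i\<in>F. \<eta> i p) = 1"
proof -
  have "\<exists>c \<epsilon>. c \<in> \<A> \<and> p \<in> dom_chart c \<and> \<epsilon> > 0 \<and> cball (coord c p) (2 * \<epsilon>) \<subseteq> image_chart c"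
    if p: "p \<in> topspace N" for p
  proof -
    obtain c where c: "c \<in> \<A>" "p \<in> dom_chart c" using chart_at[OF p] by blast
    obtain r where r: "r > 0" "cball (coord c p) r \<subseteq> image_chart c"
      using open_contains_cball chart_open_image[OF chart[OF c(1)]] coord_in[OF c(2)] by metis
    then show ?thesis using c by (intro exI[of _ c] exI[of _ "r / 2"]) auto
  qed
  then obtain chrt \<epsilon> where ch: "\<And>p. p \<in> topspace N \<Longrightarrow> chrt p \<in> \<A> \<and> p \<in> dom_chart (chrt p) \<and> \<epsilon> p > 0 \<and>
      cball (coord (chrt p) p) (2 * \<epsilon> p) \<subseteq> image_chart (chrt p)" by metis
  define x where "x = (\<lambda>p. coord (chrt p) p)"
  define O' where "O' = (\<lambda>p. {q \<in> dom_chart (chrt p). coord (chrt p) q \<in> ball (x p) (\<epsilon> p / 2)})"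
  have "openin N (O' p)" if "p \<in> topspace N" for p
    unfolding O'_def using ch[OF that] by (intro openin_coord_vimage[OF chart]) auto
  moreover have "p \<in> O' p" if "p \<in> topspace N" for p
    using ch[OF that] by (simp add: O'_def x_def)
  then have "topspace N \<subseteq> \<Union>(O' ` topspace N)" by blast
  ultimately have "\<exists>\<F>. finite \<F> \<and> \<F> \<subseteq> O' ` topspace N \<and> topspace N \<subseteq> \<Union>\<F>"
    using compact_N unfolding compact_space_def by (intro compactinD) auto
  then obtain \<F> where "finite \<F>" "\<F> \<subseteq> O' ` topspace N" "topspace N \<subseteq> \<Union>\<F>" by blast
  then obtain F where F: "finite F" "F \<subseteq> topspace N" "topspace N \<subseteq> \<Union>(O' ` F)"
    by (metis finite_subset_image)
  define \<beta> where "\<beta> = (\<lambda>p q. if q \<in> dom_chart (chrt p) then bump (x p) (\<epsilon> p / 2) (\<epsilon> p) (coord (chrt p) q) else 0)"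
  define S where "S = (\<lambda>q. \<Sum>p\<in>F. \<beta> p q)"
  have half: "0 < \<epsilon> p / 2" "\<epsilon> p / 2 < \<epsilon> p" if "p \<in> F" for p
    using ch[of p] that F(2) by auto
  have \<beta>C: "C1_fun \<A> (\<beta> p)" if p: "p \<in> F" for p
  proof -
    have "cball (x p) (\<epsilon> p) \<subseteq> cball (x p) (2 * \<epsilon> p)" using half[OF p] by (intro subset_cball) linarith
    then have "cball (x p) (\<epsilon> p) \<subseteq> image_chart (chrt p)"
      using ch[of p] p F(2) unfolding x_def by blast
    then show ?thesis unfolding \<beta>_def using ch[of p] p F(2) by (intro C1_fun_bump) auto
  qed
  have \<beta>0: "0 \<le> \<beta> p q" if "p \<in> F" for p q
    by (simp add: \<beta>_def bump_nonneg[OF half[OF that]])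
  have S0: "0 \<le> S q" for q unfolding S_def by (intro sum_nonneg \<beta>0)
  have Spos: "S q > 0" if q: "q \<in> topspace N" for q
  proof -
    obtain p where p: "p \<in> F" "q \<in> O' p" using F(3) q by blast
    then have "norm (coord (chrt p) q - x p) \<le> \<epsilon> p / 2" "q \<in> dom_chart (chrt p)"
      by (auto simp: O'_def dist_norm norm_minus_commute)
    then have "\<beta> p q = 1" using bump_eq_1[OF half[OF p(1)]] by (simp add: \<beta>_def)
    moreover have "\<beta> p q \<le> S q" unfolding S_def by (rule member_le_sum[OF p(1) _ F(1)]) (use \<beta>0 in auto)
    ultimately show ?thesis by simp
  qed
  have SC: "C1_fun \<A> S" unfolding S_def by (intro C1_fun_sum \<beta>C)
  show ?thesis
  proof (rule that[of F chrt \<epsilon> x "\<lambda>p q. \<beta> p q / S q"])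
    show "finite F" by (rule F(1))
    show "chrt i \<in> \<A> \<and> \<epsilon> i > 0 \<and> cball (x i) (2 * \<epsilon> i) \<subseteq> image_chart (chrt i)" if "i \<in> F" for i
      using ch[of i] that F(2) by (auto simp: x_def)
    show "C1_fun \<A> (\<lambda>q. \<beta> i q / S q)" if i: "i \<in> F" for i
      unfolding C1_fun_def
    proof
      fix c assume c: "c \<in> \<A>"
      have "S (param c y) > 0" if "y \<in> image_chart c" for y
        using Spos param_in[OF chart[OF c] that] chart_subset[OF chart[OF c]] by blast
      then show "C1_diff_on (image_chart c) ((\<lambda>q. \<beta> i q / S q) \<circ> param c)"
        using \<beta>C[OF i] SC c unfolding C1_fun_def comp_def by (intro C1_diff_on_divide) auto
    qed
    show "0 \<le> \<beta> i p / S p" if "i \<in> F" for i p using \<beta>0[OF that] S0 by simp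
    show "\<beta> i p / S p = 0" if "i \<in> F" "p \<notin> dom_chart (chrt i) \<or> \<epsilon> i \<le> norm (coord (chrt i) p - x i)" for i p
      using that bump_eq_0[OF half[OF that(1)]] by (auto simp: \<beta>_def)
    show "(\<Sum>i\<in>F. \<beta> i p / S p) = 1" if "p \<in> topspace N" for p
      using Spos[OF that] by (simp add: S_def sum_divide_distrib[symmetric])
  qed
qed

text \<open>Add up the bumps that belong to the same chart.\<close>

lemma exists_partition_of_unity: "\<exists>B \<rho>. partition_of_unity N \<A> B \<rho>"
proof -
  obtain F :: "'a set" and chrt x \<epsilon> \<eta> where F: "finite F"
    and ch: "\<And>i. i \<in> F \<Longrightarrow> chrt i \<in> \<A> \<and> \<epsilon> i > 0 \<and> cball (x i) (2 * \<epsilon> i) \<subseteq> image_chart (chrt i)"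
    and C1: "\<And>i. i \<in> F \<Longrightarrow> C1_fun \<A> (\<eta> i)" and nn: "\<And>i p. i \<in> F \<Longrightarrow> 0 \<le> \<eta> i p"
    and z: "\<And>i p. i \<in> F \<Longrightarrow> p \<notin> dom_chart (chrt i) \<or> \<epsilon> i \<le> norm (coord (chrt i) p - x i) \<Longrightarrow> \<eta> i p = (0::real)"
    and sum1: "\<And>p. p \<in> topspace N \<Longrightarrow> (\<Sum>i\<in>F. \<eta> i p) = 1"
    by (rule exists_C1_partition) blast
  define \<rho> where "\<rho> = (\<lambda>c p. \<Sum>i\<in>{i\<in>F. chrt i = c}. \<eta> i p)"
  have "partition_of_unity N \<A> (chrt ` F) \<rho>"
    unfolding partition_of_unity_def
  proof (intro conjI ballI)
    show "finite (chrt ` F)" using F by simp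
    show "chrt ` F \<subseteq> \<A>" using ch by blast
  next
    fix c assume c: "c \<in> chrt ` F"
    have "C1_fun \<A> (\<rho> c)" unfolding \<rho>_def by (intro C1_fun_sum C1) simp
    then show "continuous_map N euclideanreal (\<rho> c)" by (rule C1_fun_continuous_map)
    show "0 \<le> \<rho> c p" for p unfolding \<rho>_def by (intro sum_nonneg nn) simp
    let ?K = "\<lambda>i. param (chrt i) ` cball (x i) (\<epsilon> i)"
    let ?T = "\<Union>i\<in>{i\<in>F. chrt i = c}. ?K i"
    have sub: "cball (x i) (\<epsilon> i) \<subseteq> image_chart (chrt i)" if "i \<in> F" for i
    proof -
      have "cball (x i) (\<epsilon> i) \<subseteq> cball (x i) (2 * \<epsilon> i)" using ch[OF that] by (intro subset_cball) linarith
      then show ?thesis using ch[OF that] by blast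
    qed
    have Kd: "?K i \<subseteq> dom_chart (chrt i)" if "i \<in> F" for i
      using sub[OF that] param_in[OF chart[of "chrt i"]] ch[OF that] by blast
    have "closedin N (?K i)" if "i \<in> F" for i
      using sub[OF that] ch[OF that]
      by (intro compactin_imp_closedin[OF Hausdorff_N] compactin_param_image chart) auto
    then have "closedin N ?T" using F by (intro closedin_Union) auto
    moreover have "{p \<in> topspace N. \<rho> c p \<noteq> 0} \<subseteq> ?T"
    proof
      fix p assume "p \<in> {p \<in> topspace N. \<rho> c p \<noteq> 0}"
      then obtain i where i: "i \<in> F" "chrt i = c" "\<eta> i p \<noteq> 0"
        unfolding \<rho>_def by (metis (mono_tags, lifting) mem_Collect_eq sum.neutral)
      then have p: "p \<in> dom_chart (chrt i)" "norm (coord (chrt i) p - x i) < \<epsilon> i"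
        using z[OF i(1), of p] by (auto simp: not_le[symmetric])
      then have "coord (chrt i) p \<in> cball (x i) (\<epsilon> i)" by (simp add: dist_norm norm_minus_commute)
      then have "param (chrt i) (coord (chrt i) p) \<in> ?K i" by (rule imageI)
      then have "p \<in> ?K i" using param_coord[OF chart p(1)] ch[OF i(1)] by simp
      then show "p \<in> ?T" using i by blast
    qed
    ultimately have "N closure_of {p \<in> topspace N. \<rho> c p \<noteq> 0} \<subseteq> ?T" by (rule closure_of_minimal[rotated])
    also have "?T \<subseteq> dom_chart c" using Kd by blast
    finally show "N closure_of {p \<in> topspace N. \<rho> c p \<noteq> 0} \<subseteq> dom_chart c" .
  next
    fix p assume p: "p \<in> topspace N"
    have "(\<Sum>c\<in>chrt ` F. \<rho> c p) = (\<Sum>i\<in>F. \<eta> i p)"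
      unfolding \<rho>_def using F by (rule sum.image_gen[symmetric])
    then show "(\<Sum>c\<in>chrt ` F. \<rho> c p) = 1" using sum1[OF p] by simp
  qed
  then show ?thesis by blast
qed

end

section \<open>Geometry of the hypersurface\<close>

text \<open>The left-hand side is the cross product of the tangent vectors \<open>u j\<close>. Its difference from the
right-hand side is orthogonal to \<open>n\<close> and to all \<open>u j\<close>, and these span the space. Hence the normal is
obtained from the derivatives of the immersion by an explicit formula.\<close>

lemma unit_normal_cross_product:
  assumes n: "norm n = 1" "\<And>j. n \<bullet> u j = 0" and nz: "frame_det n u \<noteq> 0"
  shows "(\<chi> k. frame_det (axis k 1) u) = frame_det n u *\<^sub>R n"
proof -
  let ?X = "\<chi> k. frame_det (axis k 1) u"
  have X: "?X \<bullet> v = frame_det v u" for v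
  proof -
    have "frame_det v u = frame_det (\<Sum>k\<in>UNIV. (v $ k) *\<^sub>R axis k 1) u"
      using basis_expansion[of v] by (simp add: scalar_mult_eq_scaleR)
    also have "\<dots> = (\<Sum>k\<in>UNIV. (v $ k) * frame_det (axis k 1) u)"
      by (simp add: linear_sum[OF linear_frame_det] linear_scale[OF linear_frame_det])
    finally show ?thesis by (simp add: inner_vec_def mult.commute)
  qed
  define y where "y = ?X - frame_det n u *\<^sub>R n"
  have nn: "n \<bullet> n = 1" using n(1) by (simp add: norm_eq_1)
  have "y \<bullet> n = 0" unfolding y_def inner_diff_left X by (simp add: nn)
  moreover have "y \<bullet> u j = 0" for j
    unfolding y_def inner_diff_left X by (simp add: frame_det_repeated n(2))
  ultimately have "y = 0" using frame_det_zero[of y n u] nz by blast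
  then show ?thesis by (simp add: y_def)
qed

locale oriented_hypersurface = closed_manifold N \<A>
  for N :: "'a topology" and \<A> :: "('a, 'n::finite) chart set" +
  fixes f \<nu> :: "'a \<Rightarrow> real ^ ('n option)"
  assumes immersion: "C2_immersion \<A> f" and normal: "oriented_unit_normal \<A> f \<nu>"
begin

lemma f_C2: "c \<in> \<A> \<Longrightarrow> C2_on (image_chart c) (f \<circ> param c)"
  using immersion unfolding C2_immersion_def by blast

lemma f_C1: "C1_fun \<A> f"
  unfolding C1_fun_def using C2_onD(1)[OF chart_open_image[OF chart] f_C2] by blast

lemma f_inj: "c \<in> \<A> \<Longrightarrow> p \<in> dom_chart c \<Longrightarrow> inj (differential c f p)"
  using immersion unfolding C2_immersion_def by blast

lemma \<nu>_norm: "c \<in> \<A> \<Longrightarrow> p \<in> dom_chart c \<Longrightarrow> norm (\<nu> p) = 1"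
  and \<nu>_orth: "c \<in> \<A> \<Longrightarrow> p \<in> dom_chart c \<Longrightarrow> \<nu> p \<bullet> differential c f p v = 0"
  and \<nu>_pos: "c \<in> \<A> \<Longrightarrow> p \<in> dom_chart c \<Longrightarrow> frame_det (\<nu> p) (\<lambda>j. differential c f p (axis j 1)) > 0"
  using normal unfolding oriented_unit_normal_def by blast+

lemma \<nu>_C1: "C1_fun \<A> \<nu>"
  unfolding C1_fun_def
proof
  fix c assume c: "c \<in> \<A>"
  let ?U = "image_chart c"
  have U: "open ?U" by (rule chart_open_image[OF chart[OF c]])
  define X where "X = (\<lambda>x. \<chi> k. frame_det (axis k 1) (\<lambda>j. frechet_derivative (f \<circ> param c) (at x) (axis j 1)))"
  have XC: "C1_diff_on ?U X"
    unfolding X_def by (intro C1_diff_on_vec_lambda C1_diff_on_frame_det C1_diff_on_const C2_onD(2)[OF U f_C2[OF c]])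
  have X: "\<exists>a>0. X x = a *\<^sub>R \<nu> (param c x) \<and> norm (\<nu> (param c x)) = 1" if x: "x \<in> ?U" for x
  proof -
    have p: "param c x \<in> dom_chart c" by (rule param_in[OF chart[OF c] x])
    have d: "differential c f (param c x) = frechet_derivative (f \<circ> param c) (at x)"
      by (simp add: differential_def coord_param[OF chart[OF c] x])
    show ?thesis
      using unit_normal_cross_product[OF \<nu>_norm[OF c p], of "\<lambda>j. differential c f (param c x) (axis j 1)"]
        \<nu>_orth[OF c p] \<nu>_pos[OF c p] \<nu>_norm[OF c p] unfolding X_def d by force
  qed
  have XX: "X x \<bullet> X x > 0" if "x \<in> ?U" for x
    using X[OF that] by (auto simp: norm_eq_1)
  have sq: "C1_diff_on ?U (\<lambda>x. sqrt (X x \<bullet> X x))"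
  proof (rule C1_diff_on_real_compose[OF C1_diff_on_inner[OF XC XC], of "{0<..}"])
    show "(sqrt has_real_derivative inverse (sqrt t) / 2) (at t)" if "t \<in> {0<..}" for t
      using that by (intro DERIV_real_sqrt) simp
    show "continuous_on {0<..} (\<lambda>t. inverse (sqrt t) / 2)" by (intro continuous_intros) auto
  qed (use XX in auto)
  have "C1_diff_on ?U (\<lambda>x. (1 / sqrt (X x \<bullet> X x)) *\<^sub>R X x)"
    by (intro C1_diff_on_scaleR XC C1_diff_on_divide sq C1_diff_on_const) (use XX in auto)
  then show "C1_diff_on ?U (\<nu> \<circ> param c)"
  proof (rule C1_diff_on_cong[OF U])
    fix x assume "x \<in> ?U"
    then obtain a where a: "a > 0" "X x = a *\<^sub>R \<nu> (param c x)" "norm (\<nu> (param c x)) = 1" using X by blast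
    then have "sqrt (X x \<bullet> X x) = a" by (simp add: norm_eq_1 real_sqrt_mult)
    then show "(1 / sqrt (X x \<bullet> X x)) *\<^sub>R X x = (\<nu> \<circ> param c) x" using a by simp
  qed
qed

context
  fixes c :: "('a, 'n) chart" and p :: 'a
  assumes c: "c \<in> \<A>" and p: "p \<in> dom_chart c"
begin

lemma has_derivative_in_chart:
  assumes "C1_fun \<A> g" "x \<in> image_chart c"
  shows "((g \<circ> param c) has_derivative frechet_derivative (g \<circ> param c) (at x)) (at x)"
  using assms c unfolding C1_fun_def by (blast intro: C1_diff_on_has_derivative)

text \<open>Stated for two maps so as to cover \<open>\<langle>\<nu>, \<nu>\<rangle> = 1\<close>, by which \<open>d\<nu>\<close> is tangential, and \<open>\<langle>\<nu>, df v\<rangle> = 0\<close>, by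
which the second fundamental form is given by second derivatives of \<open>f\<close>.\<close>

lemma constant_inner_derivative:
  assumes g: "C1_diff_on (image_chart c) g" and h: "C1_diff_on (image_chart c) h"
    and const: "\<And>x. x \<in> image_chart c \<Longrightarrow> g x \<bullet> h x = k"
  shows "g (coord c p) \<bullet> frechet_derivative h (at (coord c p)) v
    = - (frechet_derivative g (at (coord c p)) v \<bullet> h (coord c p))"
proof -
  let ?x = "coord c p"
  have x: "?x \<in> image_chart c" using p by simp
  have "((\<lambda>x. g x \<bullet> h x) has_derivative (\<lambda>v. g ?x \<bullet> frechet_derivative h (at ?x) v
     + frechet_derivative g (at ?x) v \<bullet> h ?x)) (at ?x)"
    by (intro has_derivative_inner C1_diff_on_has_derivative[OF g x] C1_diff_on_has_derivative[OF h x])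
  then have "((\<lambda>x. k) has_derivative (\<lambda>v. g ?x \<bullet> frechet_derivative h (at ?x) v
     + frechet_derivative g (at ?x) v \<bullet> h ?x)) (at ?x)"
    by (rule has_derivative_transform_within_open[OF _ chart_open_image[OF chart[OF c]] x const])
  then have "(\<lambda>v. g ?x \<bullet> frechet_derivative h (at ?x) v + frechet_derivative g (at ?x) v \<bullet> h ?x) = (\<lambda>v. 0)"
    using has_derivative_unique has_derivative_const by blast
  then have "g ?x \<bullet> frechet_derivative h (at ?x) v + frechet_derivative g (at ?x) v \<bullet> h ?x = 0"
    by meson
  then show ?thesis by simp
qed

lemma d\<nu>_orth: "\<nu> p \<bullet> differential c \<nu> p v = 0"
proof -
  have C: "C1_diff_on (image_chart c) (\<nu> \<circ> param c)" using \<nu>_C1 c by (simp add: C1_fun_def)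
  have 1: "(\<nu> \<circ> param c) x \<bullet> (\<nu> \<circ> param c) x = 1" if "x \<in> image_chart c" for x
    using \<nu>_norm[OF c param_in[OF chart[OF c] that]] by (simp add: norm_eq_1)
  show ?thesis
    using constant_inner_derivative[OF C C 1, of v] param_coord[OF chart[OF c] p]
    unfolding differential_def comp_def by (simp add: inner_commute)
qed

lemma second_fundamental_form_symmetric:
  "differential c \<nu> p v \<bullet> differential c f p w = differential c \<nu> p w \<bullet> differential c f p v"
proof -
  let ?F = "f \<circ> param c" and ?n = "\<nu> p" and ?x = "coord c p" and ?U = "image_chart c"
  have U: "open ?U" "?x \<in> ?U" using chart_open_image[OF chart[OF c]] p by auto
  have NC: "C1_diff_on ?U (\<nu> \<circ> param c)" using \<nu>_C1 c by (simp add: C1_fun_def)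
  have FC: "C1_diff_on ?U ?F" and F'C: "\<And>v. C1_diff_on ?U (\<lambda>x. frechet_derivative ?F (at x) v)"
    by (rule C2_onD[OF U(1) f_C2[OF c]])+
  have px: "param c ?x = p" by (rule param_coord[OF chart[OF c] p])
  have 0: "(\<nu> \<circ> param c) x \<bullet> frechet_derivative ?F (at x) v = 0" if "x \<in> ?U" for x v
    using \<nu>_orth[OF c param_in[OF chart[OF c] that], of v] coord_param[OF chart[OF c] that]
    by (simp add: differential_def)
  have 1: "?n \<bullet> frechet_derivative (\<lambda>x. frechet_derivative ?F (at x) v) (at ?x) w
    = - (differential c \<nu> p w \<bullet> differential c f p v)" for v w
    using constant_inner_derivative[OF NC F'C 0, of v w] px unfolding differential_def comp_def by simp
  \<comment> \<open>Schwarz for the height function in the direction of the normal at p\<close>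
  define \<phi> where "\<phi> = (\<lambda>x. ?n \<bullet> ?F x)"
  have bl: "bounded_linear (\<lambda>y. ?n \<bullet> y)" by (rule bounded_linear_inner_right)
  have \<phi>': "frechet_derivative \<phi> (at x) = (\<lambda>v. ?n \<bullet> frechet_derivative ?F (at x) v)" if "x \<in> ?U" for x
    unfolding \<phi>_def
    by (rule frechet_derivative_at[symmetric]) (rule bounded_linear.has_derivative[OF bl C1_diff_on_has_derivative[OF FC that]])
  have \<phi>C: "C1_diff_on ?U \<phi>" unfolding \<phi>_def by (rule C1_diff_on_linear[OF bl FC])
  have \<phi>'C: "C1_diff_on ?U (\<lambda>x. frechet_derivative \<phi> (at x) v)" for v
    by (rule C1_diff_on_cong[OF U(1) C1_diff_on_linear[OF bl F'C[of v]]]) (simp add: \<phi>')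
  have 2: "frechet_derivative (\<lambda>x. frechet_derivative \<phi> (at x) v) (at ?x) w
    = ?n \<bullet> frechet_derivative (\<lambda>x. frechet_derivative ?F (at x) v) (at ?x) w" for v w
  proof -
    have "frechet_derivative (\<lambda>x. frechet_derivative \<phi> (at x) v) (at ?x)
       = frechet_derivative (\<lambda>x. ?n \<bullet> frechet_derivative ?F (at x) v) (at ?x)"
      by (rule frechet_derivative_cong_open[OF U]) (simp add: \<phi>')
    also have "\<dots> = (\<lambda>w. ?n \<bullet> frechet_derivative (\<lambda>x. frechet_derivative ?F (at x) v) (at ?x) w)"
      by (rule frechet_derivative_at[symmetric]) (rule bounded_linear.has_derivative[OF bl C1_diff_on_has_derivative[OF F'C U(2)]])
    finally show ?thesis by simp
  qed
  show ?thesis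
    using second_derivative_symmetric[OF U \<phi>C \<phi>'C, of v w] unfolding 2 1 by simp
qed

lemma tangent_space: "range (differential c f p) = {y. \<nu> p \<bullet> y = 0}"
proof -
  have lin: "linear (differential c f p)" by (rule C1_fun_linear[OF f_C1 c p])
  have n0: "\<nu> p \<noteq> 0" using \<nu>_norm[OF c p] by auto
  show ?thesis
  proof (rule subspace_dim_equal)
    show "subspace (range (differential c f p))" by (rule linear_subspace_image[OF lin subspace_UNIV])
    show "subspace {y. \<nu> p \<bullet> y = 0}" by (rule subspace_hyperplane)
    show "range (differential c f p) \<subseteq> {y. \<nu> p \<bullet> y = 0}" using \<nu>_orth[OF c p] by auto
    have "dim (range (differential c f p)) = CARD('n)"
      using dim_image_eq[OF lin, of UNIV] f_inj[OF c p] by simp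
    moreover have "dim {y. \<nu> p \<bullet> y = 0} = CARD('n)"
      using dim_hyperplane[OF n0] by simp
    ultimately show "dim {y. \<nu> p \<bullet> y = 0} \<le> dim (range (differential c f p))" by simp
  qed
qed

lemma d\<nu>_range: "range (differential c \<nu> p) \<subseteq> range (differential c f p)"
  unfolding tangent_space using d\<nu>_orth by auto

lemma differential_second_fundamental_form:
  "differential c f p (second_fundamental_form c f \<nu> p Y) = differential c \<nu> p Y"
proof -
  obtain Z where Z: "differential c f p Z = differential c \<nu> p Y" using d\<nu>_range by (metis rangeE rangeI subsetD)
  then have "second_fundamental_form c f \<nu> p Y = Z"
    unfolding second_fundamental_form_def by (intro the_equality) (use injD[OF f_inj[OF c p]] in auto)
  then show ?thesis using Z by simp
qed

lemma exists_eigenvalue_list: "\<exists>\<kappa>. eigenvalue_list (second_fundamental_form c f \<nu> p) \<kappa>"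
proof -
  have lf: "linear (differential c f p)" and l\<nu>: "linear (differential c \<nu> p)"
    by (rule C1_fun_linear[OF _ c p], rule f_C1 \<nu>_C1)+
  obtain e \<kappa> where e: "inj (e :: 'n \<Rightarrow> real^'n)" "independent (range e)"
      "\<forall>j. differential c \<nu> p (e j) = \<kappa> j *\<^sub>R differential c f p (e j)"
    by (atomize_elim, rule simultaneous_diagonalisation[OF lf f_inj[OF c p] l\<nu> d\<nu>_range
          second_fundamental_form_symmetric])
  have "second_fundamental_form c f \<nu> p (e j) = \<kappa> j *\<^sub>R e j" for j
    using injD[OF f_inj[OF c p]] differential_second_fundamental_form e(3) by (simp add: linear_scale[OF lf])
  then show ?thesis unfolding eigenvalue_list_def using e by blast
qed

lemma volume_coeff_eq: "volume_coeff c f p = frame_det (\<nu> p) (\<lambda>j. differential c f p (axis j 1))"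
  using frame_det_unit_normal_sq[OF \<nu>_norm[OF c p], of "\<lambda>j. differential c f p (axis j 1)"]
    \<nu>_orth[OF c p] \<nu>_pos[OF c p]
  unfolding volume_coeff_def induced_metric_def by (metis real_sqrt_unique less_imp_le)

lemma frame_det_pencil_eigenvalues:
  assumes "eigenvalue_list (second_fundamental_form c f \<nu> p) \<kappa>"
  shows "frame_det (\<nu> p) (\<lambda>j. r *\<^sub>R differential c f p (axis j 1) + t *\<^sub>R differential c \<nu> p (axis j 1))
    = (\<Prod>j\<in>UNIV. r + t * \<kappa> j) * volume_coeff c f p"
proof -
  have lf: "linear (differential c f p)" and l\<nu>: "linear (differential c \<nu> p)"
    by (rule C1_fun_linear[OF _ c p], rule f_C1 \<nu>_C1)+
  obtain e :: "'n \<Rightarrow> real^'n" where e: "inj e" "independent (range e)" "\<And>j. second_fundamental_form c f \<nu> p (e j) = \<kappa> j *\<^sub>R e j"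
    using assms unfolding eigenvalue_list_def by blast
  have "differential c \<nu> p (e j) = \<kappa> j *\<^sub>R differential c f p (e j)" for j
    using differential_second_fundamental_form[of "e j"] e(3) by (simp add: linear_scale[OF lf])
  from frame_det_pencil[OF lf l\<nu> e(1,2) this] show ?thesis unfolding volume_coeff_eq .
qed

end

lemma frame_det_pencil_transform:
  assumes c: "c \<in> \<A>" and d: "d \<in> \<A>" and p: "p \<in> dom_chart c" "p \<in> dom_chart d"
    and g: "C1_fun \<A> g" and h: "C1_fun \<A> h"
  shows "frame_det w (\<lambda>j. r *\<^sub>R differential c g p (axis j 1) + t *\<^sub>R differential c h p (axis j 1))
   = det (matrix (frechet_derivative (coord d \<circ> param c) (at (coord c p)))) *
     frame_det w (\<lambda>j. r *\<^sub>R differential d g p (axis j 1) + t *\<^sub>R differential d h p (axis j 1))"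
proof -
  have "linear (\<lambda>v. r *\<^sub>R differential d g p v + t *\<^sub>R differential d h p v)"
    by (intro linear_compose_add linear_compose_scale_right C1_fun_linear g h d p)
  from frame_det_compose[OF this, of w] show ?thesis
    unfolding chain_rule(2)[OF c d p C1_fun_differentiable[OF g d p(2)]]
      chain_rule(2)[OF c d p C1_fun_differentiable[OF h d p(2)]] .
qed

text \<open>The principal curvatures may have been read off in a chart \<open>c\<close> other than \<open>d\<close>; both sides
transform by the same Jacobian determinant.\<close>

theorem frame_det_pencil_principal_curvatures:
  assumes d: "d \<in> \<A>" and p: "p \<in> dom_chart d"
  shows "frame_det (\<nu> p) (\<lambda>j. r *\<^sub>R differential d f p (axis j 1) + t *\<^sub>R differential d \<nu> p (axis j 1))
    = (\<Prod>j\<in>UNIV. r + t * principal_curvatures \<A> f \<nu> p j) * volume_coeff d f p"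
proof -
  let ?\<kappa> = "principal_curvatures \<A> f \<nu> p"
  have "\<exists>\<kappa>. \<exists>c\<in>\<A>. p \<in> dom_chart c \<and> eigenvalue_list (second_fundamental_form c f \<nu> p) \<kappa>"
    using exists_eigenvalue_list[OF d p] d p by blast
  then have "\<exists>c\<in>\<A>. p \<in> dom_chart c \<and> eigenvalue_list (second_fundamental_form c f \<nu> p) ?\<kappa>"
    unfolding principal_curvatures_def by (rule someI_ex)
  then obtain c where c: "c \<in> \<A>" "p \<in> dom_chart c" "eigenvalue_list (second_fundamental_form c f \<nu> p) ?\<kappa>" by blast
  let ?J = "det (matrix (frechet_derivative (coord c \<circ> param d) (at (coord d p))))"
  have vol: "volume_coeff d f p = ?J * volume_coeff c f p"
    using frame_det_pencil_transform[OF d c(1) p c(2) f_C1 \<nu>_C1, of "\<nu> p" 1 0]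
    by (simp add: volume_coeff_eq[OF d p] volume_coeff_eq[OF c(1,2)])
  show ?thesis
    unfolding frame_det_pencil_transform[OF d c(1) p c(2) f_C1 \<nu>_C1]
      frame_det_pencil_eigenvalues[OF c] vol by simp
qed

end

section \<open>Elementary symmetric functions of the curvatures\<close>

definition elementary_symmetric :: "('n::finite \<Rightarrow> real) \<Rightarrow> nat \<Rightarrow> real" where
  "elementary_symmetric \<kappa> k = (\<Sum>J | J \<subseteq> UNIV \<and> card J = k. \<Prod>j\<in>J. \<kappa> j)"

lemma elementary_symmetric_beyond: "CARD('n) < k \<Longrightarrow> elementary_symmetric (\<kappa> :: 'n::finite \<Rightarrow> real) k = 0"
proof -
  assume k: "CARD('n) < k"
  have "{J :: 'n set. J \<subseteq> UNIV \<and> card J = k} = {}"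
  proof -
    have "card J \<noteq> k" for J :: "'n set" using card_mono[of UNIV J] k by auto
    then show ?thesis by simp
  qed
  then show ?thesis by (simp only: elementary_symmetric_def sum.empty)
qed

lemma prod_pencil_expansion:
  fixes \<kappa> :: "'n::finite \<Rightarrow> real"
  shows "(\<Prod>j\<in>UNIV. r + t * \<kappa> j) = (\<Sum>k\<le>CARD('n). elementary_symmetric \<kappa> k * t ^ k * r ^ (CARD('n) - k))"
proof -
  let ?g = "\<lambda>J. (\<Prod>j\<in>J. t * \<kappa> j) * (\<Prod>j\<in>UNIV - J. r)"
  have "(\<Prod>j\<in>UNIV. r + t * \<kappa> j) = sum ?g (Pow UNIV)"
    using prod_add[of "UNIV :: 'n set" "\<lambda>j. t * \<kappa> j" "\<lambda>j. r"] by (simp add: add.commute)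
  also have "\<dots> = (\<Sum>k\<le>CARD('n). sum ?g {J \<in> Pow UNIV. card J = k})"
    by (rule sum.group[symmetric]) (auto intro: card_mono)
  also have "\<dots> = (\<Sum>k\<le>CARD('n). elementary_symmetric \<kappa> k * t ^ k * r ^ (CARD('n) - k))"
  proof (rule sum.cong[OF refl])
    fix k
    have "?g J = (\<Prod>j\<in>J. \<kappa> j) * (t ^ k * r ^ (CARD('n) - k))" if "card J = k" for J
      using that by (simp add: prod.distrib card_Diff_subset)
    then show "sum ?g {J \<in> Pow UNIV. card J = k} = elementary_symmetric \<kappa> k * t ^ k * r ^ (CARD('n) - k)"
      by (simp add: elementary_symmetric_def sum_distrib_right mult.assoc)
  qed
  finally show ?thesis .
qed

lemma binomial_step: "real (n - i) * real (n choose i) = real (Suc i) * real (n choose Suc i)"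
  using binomial_absorb_comp[of n i] binomial_absorption[of i n]
  by (metis of_nat_mult)

text \<open>With \<open>E\<^sub>k\<close> the elementary symmetric functions and \<open>n\<close> the dimension, the derivative in \<open>r\<close> is the sum of
\<open>(n - k) E\<^sub>k t\<^sup>k\<close> and the derivative in \<open>t\<close> that of \<open>(k + 1) E\<^sub>k\<^sub>+\<^sub>1 t\<^sup>k\<close>. The two weights agree after normalising the
\<open>E\<^sub>k\<close> by binomial coefficients, because \<open>(n - k) (n choose k) = (k + 1) (n choose (k + 1))\<close>.\<close>

lemma pencil_derivative_difference:
  fixes \<kappa> :: "'n::finite \<Rightarrow> real"
  assumes r: "((\<lambda>r. \<Prod>j\<in>UNIV. r + t * \<kappa> j) has_real_derivative A) (at 1)"
    and t: "((\<lambda>t. \<Prod>j\<in>UNIV. 1 + t * \<kappa> j) has_real_derivative B) (at t)"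
  shows "A - s * B = (\<Sum>i\<le>CARD('n) - 1. (real (CARD('n) - i) * real (CARD('n) choose i)) *
     (elementary_symmetric \<kappa> i / real (CARD('n) choose i)
       - s * (elementary_symmetric \<kappa> (Suc i) / real (CARD('n) choose Suc i))) * t ^ i)"
proof -
  let ?n = "CARD('n)" and ?E = "elementary_symmetric \<kappa>"
  have n: "?n = Suc (?n - 1)" by simp
  have "((\<lambda>r. \<Prod>j\<in>UNIV. r + t * \<kappa> j) has_real_derivative
      (\<Sum>k\<le>?n. ?E k * t ^ k * real (?n - k))) (at 1)"
    unfolding prod_pencil_expansion by (auto intro!: derivative_eq_intros sum.cong)
  then have "A = (\<Sum>k\<le>?n. ?E k * t ^ k * real (?n - k))" using DERIV_unique[OF r] by blast
  also have "\<dots> = (\<Sum>k\<le>?n - 1. ?E k * t ^ k * real (?n - k))"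
    by (subst n, subst sum.atMost_Suc) simp
  finally have A: "A = (\<Sum>k\<le>?n - 1. ?E k * t ^ k * real (?n - k))" .
  have "((\<lambda>t. \<Prod>j\<in>UNIV. 1 + t * \<kappa> j) has_real_derivative
      (\<Sum>k\<le>?n. ?E k * (real k * t ^ (k - 1)))) (at t)"
    unfolding prod_pencil_expansion by (auto intro!: derivative_eq_intros sum.cong)
  then have "B = (\<Sum>k\<le>?n. ?E k * (real k * t ^ (k - 1)))" using DERIV_unique[OF t] by blast
  also have "\<dots> = (\<Sum>k\<le>?n - 1. ?E (Suc k) * (real (Suc k) * t ^ k))"
    by (subst n, subst sum.atMost_Suc_shift) simp
  finally have B: "B = (\<Sum>k\<le>?n - 1. ?E (Suc k) * (real (Suc k) * t ^ k))" .
  have "real (?n - k) * real (?n choose k) * (?E k / real (?n choose k)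
       - s * (?E (Suc k) / real (?n choose Suc k))) * t ^ k
     = ?E k * t ^ k * real (?n - k) - s * (?E (Suc k) * (real (Suc k) * t ^ k))"
    if "k \<le> ?n - 1" for k
  proof -
    have "Suc k \<le> ?n" using that n by linarith
    then have nz: "real (?n choose k) \<noteq> 0" "real (?n choose Suc k) \<noteq> 0" by auto
    have "real (?n - k) * real (?n choose k) * (?E (Suc k) / real (?n choose Suc k)) = real (Suc k) * ?E (Suc k)"
      unfolding binomial_step using nz by simp
    moreover have "real (?n - k) * real (?n choose k) * (?E k / real (?n choose k)) = real (?n - k) * ?E k"
      using nz by simp
    moreover have "w * (q1 - s * q2) * T = a * T * z - s * (b * (y * T))"
      if "w * q2 = y * b" "w * q1 = z * a" for w q1 q2 T a b y z :: real
      using that by algebra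
    ultimately show ?thesis by blast
  qed
  then show ?thesis unfolding A B
    by (simp add: sum_subtractf sum_distrib_left)
qed

lemma polar_det_sum_right:
  "polar_det w u (\<lambda>j. \<Sum>i\<in>I. v i j) = (\<Sum>i\<in>I. polar_det w u (v i))"
  unfolding polar_det_def by (subst sum.swap) (simp add: linear_sum[OF linear_frame_det_slot])

lemma linear_polar_det: "linear (\<lambda>w. polar_det w u v)"
  unfolding polar_det_def by (intro linear_compose_sum ballI linear_frame_det)

text \<open>If all other columns are tangential, the first one matters only through its normal component.
Applied to the position vector, this produces the support function \<open>\<langle>f, \<nu>\<rangle>\<close>.\<close>

lemma polar_det_normal_component:
  assumes n: "norm n = 1" and u: "\<And>j. n \<bullet> u j = 0" and v: "\<And>j. n \<bullet> v j = 0"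
  shows "polar_det w u v = (w \<bullet> n) * polar_det n u v"
proof -
  define y where "y = w - (w \<bullet> n) *\<^sub>R n"
  have "n \<bullet> y = 0" using n by (simp add: y_def inner_diff_right inner_commute norm_eq_1)
  then have "frame_det y (u(j := v j)) = 0" for j
    using n u v by (intro frame_det_zero[of n]) auto
  then have "polar_det y u v = 0" by (simp add: polar_det_def)
  then show ?thesis
    by (simp add: y_def linear_diff[OF linear_polar_det] linear_scale[OF linear_polar_det])
qed

section \<open>The Minkowski form\<close>

context oriented_hypersurface
begin

abbreviation \<kappa> :: "'a \<Rightarrow> 'n \<Rightarrow> real" where "\<kappa> \<equiv> principal_curvatures \<A> f \<nu>"

definition parallel :: "real \<Rightarrow> 'a \<Rightarrow> real ^ ('n option)" where
  "parallel t p = f p + t *\<^sub>R \<nu> p"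

abbreviation dc :: "('a, 'n) chart \<Rightarrow> ('a \<Rightarrow> real ^ ('n option)) \<Rightarrow> 'a \<Rightarrow> 'n \<Rightarrow> real ^ ('n option)" where
  "dc c g p \<equiv> \<lambda>j. differential c g p (axis j 1)"

text \<open>Up to a constant, the coefficient in the chart \<open>c\<close> of the formal exterior derivative of
\<open>det (a, \<nu>, dh, \<dots>, dh)\<close>, where \<open>h\<close> is the parallel hypersurface at distance \<open>t\<close>.\<close>

definition minkowski_form :: "real \<Rightarrow> ('a \<Rightarrow> real ^ ('n option)) \<Rightarrow> ('a, 'n) chart \<Rightarrow> 'a \<Rightarrow> real" where
  "minkowski_form t a c p = polar_det (\<nu> p) (dc c (parallel t) p) (dc c a p)
     - polar_det (a p) (dc c (parallel t) p) (dc c \<nu> p)"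

lemma parallel_C1: "C1_fun \<A> (parallel t)"
  using f_C1 \<nu>_C1 unfolding C1_fun_def comp_def parallel_def
  by (auto intro!: C1_diff_on_add C1_diff_on_scaleR)

lemma differential_parallel:
  assumes "c \<in> \<A>" "p \<in> dom_chart c"
  shows "differential c (parallel t) p v = differential c f p v + t *\<^sub>R differential c \<nu> p v"
proof -
  have x: "coord c p \<in> image_chart c" using assms(2) by simp
  have eq: "(\<lambda>x. (f \<circ> param c) x + t *\<^sub>R (\<nu> \<circ> param c) x) = parallel t \<circ> param c"
    by (simp add: fun_eq_iff parallel_def)
  have D: "((\<lambda>x. (f \<circ> param c) x + t *\<^sub>R (\<nu> \<circ> param c) x) has_derivative
     (\<lambda>v. differential c f p v + t *\<^sub>R differential c \<nu> p v)) (at (coord c p))"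
    unfolding differential_def
    by (intro has_derivative_add has_derivative_scaleR_right has_derivative_in_chart[OF assms _ x] f_C1 \<nu>_C1)
  show ?thesis
    unfolding differential_def[of c "parallel t"] frechet_derivative_at[OF D[unfolded eq], symmetric] ..
qed

lemma minkowski_form_density:
  assumes a: "C1_fun \<A> a"
  shows "density \<A> (minkowski_form t a)"
  unfolding density_def
proof (intro conjI ballI)
  fix c assume c: "c \<in> \<A>"
  show "continuous_on (image_chart c) (minkowski_form t a c \<circ> param c)"
    unfolding minkowski_form_def comp_def
    by (intro continuous_on_diff continuous_on_polar_det C1_fun_continuous_differential
        C1_fun_continuous_on parallel_C1 \<nu>_C1 a c)
next
  fix c d p assume c: "c \<in> \<A>" and d: "d \<in> \<A>" and "p \<in> dom_chart c \<inter> dom_chart d"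
  then have p: "p \<in> dom_chart c" "p \<in> dom_chart d" by auto
  have chain: "differential c g p = (\<lambda>v. differential d g p (frechet_derivative (coord d \<circ> param c) (at (coord c p)) v))"
    and lin: "linear (differential d g p)" if "C1_fun \<A> g" for g :: "'a \<Rightarrow> real ^ ('n option)"
    using chain_rule(2)[OF c d p C1_fun_differentiable[OF that d p(2)]] C1_fun_linear[OF that d p(2)] by auto
  show "minkowski_form t a c p =
      det (matrix (frechet_derivative (coord d \<circ> param c) (at (coord c p)))) * minkowski_form t a d p"
    unfolding minkowski_form_def chain[OF parallel_C1] chain[OF a] chain[OF \<nu>_C1]
      polar_det_compose[OF lin[OF parallel_C1] lin[OF a]] polar_det_compose[OF lin[OF parallel_C1] lin[OF \<nu>_C1]]
    by (simp add: right_diff_distrib)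
qed

lemma differential_cong:
  assumes c: "c \<in> \<A>" "p \<in> dom_chart c" and W: "openin N W" "p \<in> W" and eq: "\<And>q. q \<in> W \<Longrightarrow> g q = h q"
  shows "differential c g p = differential c h p"
  unfolding differential_def
proof (rule frechet_derivative_cong_open)
  show "open (coord c ` (dom_chart c \<inter> W))" by (rule open_coord_image[OF chart[OF c(1)] W(1)])
  show "coord c p \<in> coord c ` (dom_chart c \<inter> W)" using c W by blast
  fix y assume "y \<in> coord c ` (dom_chart c \<inter> W)"
  then show "(g \<circ> param c) y = (h \<circ> param c) y" using eq param_coord[OF chart[OF c(1)]] by auto
qed

lemma minkowski_form_integral_local:
  assumes a: "C1_fun \<A> a" and d: "d \<in> \<A>" and \<epsilon>: "\<epsilon> > 0" "cball x0 (2 * \<epsilon>) \<subseteq> image_chart d"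
    and zero: "\<And>p. p \<in> dom_chart d \<Longrightarrow> \<epsilon> \<le> norm (coord d p - x0) \<Longrightarrow> a p = 0"
  shows "chart_integral d (minkowski_form t a d) = 0"
proof -
  let ?U = "image_chart d"
  let ?D = "\<lambda>g x j. frechet_derivative (g \<circ> param d) (at x) (axis j 1)"
  have C: "C1_diff_on ?U (g \<circ> param d)" if "C1_fun \<A> g" for g :: "'a \<Rightarrow> real ^ ('n option)"
    using that d by (simp only: C1_fun_def)
  have "(a \<circ> param d) x = 0" if "x \<in> ?U" "\<epsilon> \<le> norm (x - x0)" for x
    using zero[OF param_in[OF chart[OF d] that(1)]] coord_param[OF chart[OF d] that(1)] that(2) by simp
  from integral_polar_det_by_parts[OF chart_open_image[OF chart[OF d]] C[OF a] C[OF \<nu>_C1] C[OF parallel_C1[of t]] \<epsilon> this]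
  have "(LINT x:?U|lborel. polar_det ((\<nu> \<circ> param d) x) (?D (parallel t) x) (?D a x)
      - polar_det ((a \<circ> param d) x) (?D (parallel t) x) (?D \<nu> x)) = 0" .
  moreover have "chart_integral d (minkowski_form t a d) = (LINT x:?U|lborel.
      polar_det ((\<nu> \<circ> param d) x) (?D (parallel t) x) (?D a x)
      - polar_det ((a \<circ> param d) x) (?D (parallel t) x) (?D \<nu> x))"
    by (rule set_lebesgue_integral_cong)
      (use chart_open_image[OF chart[OF d]] coord_param[OF chart[OF d]] in
        \<open>auto simp: minkowski_form_def differential_def\<close>)
  ultimately show ?thesis by simp
qed

lemma minkowski_form_zero:
  assumes "c \<in> \<A>" "p \<in> dom_chart c" "openin N W" "p \<in> W" "\<And>q. q \<in> W \<Longrightarrow> a q = 0"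
  shows "minkowski_form t a c p = 0"
proof -
  have "differential c a p = differential c (\<lambda>q. 0) p"
    by (rule differential_cong[OF assms(1-4)]) (rule assms(5))
  moreover have "(\<lambda>q. 0 :: real ^ ('n option)) \<circ> param c = (\<lambda>x. 0)" by (simp add: fun_eq_iff)
  ultimately have "dc c a p = (\<lambda>j. 0)" by (simp add: differential_def)
  then show ?thesis using assms(4,5) by (simp add: minkowski_form_def)
qed

lemma minkowski_form_sum:
  assumes c: "c \<in> \<A>" "p \<in> dom_chart c" and g: "\<And>i. i \<in> I \<Longrightarrow> C1_fun \<A> (g i)"
    and a: "\<And>q. q \<in> topspace N \<Longrightarrow> a q = (\<Sum>i\<in>I. g i q)"
  shows "minkowski_form t a c p = (\<Sum>i\<in>I. minkowski_form t (g i) c p)"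
proof -
  have pN: "p \<in> topspace N" using c chart_subset[OF chart] by blast
  have x: "coord c p \<in> image_chart c" using c(2) by simp
  have eq: "(\<lambda>x. \<Sum>i\<in>I. (g i \<circ> param c) x) = (\<lambda>q. \<Sum>i\<in>I. g i q) \<circ> param c"
    by (simp add: fun_eq_iff)
  have D: "((\<lambda>x. \<Sum>i\<in>I. (g i \<circ> param c) x) has_derivative (\<lambda>v. \<Sum>i\<in>I. differential c (g i) p v)) (at (coord c p))"
    unfolding differential_def
    by (intro has_derivative_sum has_derivative_in_chart[OF c _ x] g)
  have "differential c (\<lambda>q. \<Sum>i\<in>I. g i q) p = (\<lambda>v. \<Sum>i\<in>I. differential c (g i) p v)"
    unfolding differential_def[of c "\<lambda>q. \<Sum>i\<in>I. g i q"] by (rule frechet_derivative_at[OF D[unfolded eq], symmetric])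
  moreover have "differential c a p = differential c (\<lambda>q. \<Sum>i\<in>I. g i q) p"
    by (rule differential_cong[OF c openin_topspace pN a])
  ultimately have "dc c a p = (\<lambda>j. \<Sum>i\<in>I. dc c (g i) p j)" by simp
  then show ?thesis
    unfolding minkowski_form_def a[OF pN]
    by (simp add: polar_det_sum_right linear_sum[OF linear_polar_det] sum_subtractf)
qed

text \<open>Write \<open>f\<close> as the sum of the \<open>\<eta>\<^sub>i f\<close>. The form is linear in its map argument, and the form of each
summand is supported in one chart, where its integral is zero by integration by parts.\<close>

theorem minkowski_form_integral:
  assumes part: "partition_of_unity N \<A> B \<rho>"
  shows "(\<Sum>c\<in>B. chart_integral c (\<lambda>p. \<rho> c p * minkowski_form t f c p)) = 0"
proof -
  obtain F :: "'a set" and chrt x \<epsilon> \<eta> where F: "finite F"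
    and ch: "\<And>i. i \<in> F \<Longrightarrow> chrt i \<in> \<A> \<and> \<epsilon> i > 0 \<and> cball (x i) (2 * \<epsilon> i) \<subseteq> image_chart (chrt i)"
    and C1: "\<And>i. i \<in> F \<Longrightarrow> C1_fun \<A> (\<eta> i)" and nn: "\<And>i p. i \<in> F \<Longrightarrow> 0 \<le> \<eta> i p"
    and z: "\<And>i p. i \<in> F \<Longrightarrow> p \<notin> dom_chart (chrt i) \<or> \<epsilon> i \<le> norm (coord (chrt i) p - x i) \<Longrightarrow> \<eta> i p = (0::real)"
    and sum1: "\<And>p. p \<in> topspace N \<Longrightarrow> (\<Sum>i\<in>F. \<eta> i p) = 1"
    by (rule exists_C1_partition) blast
  let ?g = "\<lambda>i p. \<eta> i p *\<^sub>R f p"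
  let ?\<Phi> = "\<lambda>i. minkowski_form t (?g i)"
  have gC: "C1_fun \<A> (?g i)" if "i \<in> F" for i by (rule C1_fun_scaleR[OF C1[OF that] f_C1])
  have dens: "density \<A> (?\<Phi> i)" if "i \<in> F" for i by (rule minkowski_form_density[OF gC[OF that]])
  have fsum: "f q = (\<Sum>i\<in>F. ?g i q)" if "q \<in> topspace N" for q
    using sum1[OF that] by (simp flip: scaleR_sum_left)
  have local: "(\<Sum>c\<in>B. chart_integral c (\<lambda>p. \<rho> c p * ?\<Phi> i c p)) = 0" if i: "i \<in> F" for i
  proof -
    let ?d = "chrt i" let ?K = "param ?d ` cball (x i) (\<epsilon> i)"
    have d: "?d \<in> \<A>" and e: "\<epsilon> i > 0" "cball (x i) (2 * \<epsilon> i) \<subseteq> image_chart ?d" using ch[OF i] by auto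
    have "cball (x i) (\<epsilon> i) \<subseteq> cball (x i) (2 * \<epsilon> i)" using e(1) by (intro subset_cball) linarith
    then have sub: "cball (x i) (\<epsilon> i) \<subseteq> image_chart ?d" using e(2) by blast
    have K: "compactin N ?K" by (rule compactin_param_image[OF chart[OF d] compact_cball sub])
    have Kd: "?K \<subseteq> dom_chart ?d" using sub param_in[OF chart[OF d]] by blast
    have W: "openin N (topspace N - ?K)" using compactin_imp_closedin[OF Hausdorff_N K] by blast
    have gz: "?g i q = 0" if q: "q \<in> topspace N - ?K" for q
    proof -
      have "q \<notin> dom_chart ?d \<or> \<epsilon> i \<le> norm (coord ?d q - x i)"
      proof (rule ccontr)
        assume "\<not> ?thesis"
        then have "q \<in> dom_chart ?d" "coord ?d q \<in> cball (x i) (\<epsilon> i)"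
          by (auto simp: dist_norm norm_minus_commute)
        then have "q \<in> ?K" using param_coord[OF chart[OF d]] by (metis imageI)
        then show False using q by blast
      qed
      then show ?thesis using z[OF i] by simp
    qed
    have "(\<Sum>c\<in>B. chart_integral c (\<lambda>p. \<rho> c p * ?\<Phi> i c p)) = chart_integral ?d (?\<Phi> i ?d)"
    proof (rule partition_integral_localized[OF part dens[OF i] d K Kd])
      fix c p assume "c \<in> \<A>" "p \<in> dom_chart c" "p \<notin> ?K"
      then show "?\<Phi> i c p = 0"
        using chart_subset[OF chart[of c]] by (intro minkowski_form_zero[OF _ _ W _ gz]) auto
    qed
    also have "\<dots> = 0"
      by (rule minkowski_form_integral_local[OF gC[OF i] d e]) (use z[OF i] in simp)
    finally show ?thesis .
  qed
  have "chart_integral c (\<lambda>p. \<rho> c p * minkowski_form t f c p)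
     = (\<Sum>i\<in>F. chart_integral c (\<lambda>p. \<rho> c p * ?\<Phi> i c p))" if c: "c \<in> B" for c
  proof -
    note cA = partition_chart[OF part c]
    have "indicator (image_chart c) y *\<^sub>R ((\<lambda>p. \<rho> c p * minkowski_form t f c p) \<circ> param c) y
      = (\<Sum>i\<in>F. indicator (image_chart c) y *\<^sub>R ((\<lambda>p. \<rho> c p * ?\<Phi> i c p) \<circ> param c) y)" for y
    proof (cases "y \<in> image_chart c")
      case True
      then show ?thesis
        using minkowski_form_sum[OF cA param_in[OF chart[OF cA] True] gC fsum, of t]
        by (simp add: sum_distrib_left)
    qed simp
    then show ?thesis
      unfolding set_lebesgue_integral_def
      using partition_density_integrable[OF part dens c] by (simp add: set_integrable_def)
  qed
  then have "(\<Sum>c\<in>B. chart_integral c (\<lambda>p. \<rho> c p * minkowski_form t f c p))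
     = (\<Sum>i\<in>F. \<Sum>c\<in>B. chart_integral c (\<lambda>p. \<rho> c p * ?\<Phi> i c p))"
    by (subst sum.swap) simp
  then show ?thesis using local by simp
qed

definition curvature_density :: "nat \<Rightarrow> ('a, 'n) chart \<Rightarrow> 'a \<Rightarrow> real" where
  "curvature_density i c p =
     (mean_curvature \<A> f \<nu> i p - (f p \<bullet> \<nu> p) * mean_curvature \<A> f \<nu> (Suc i) p) * volume_coeff c f p"

lemma mean_curvature_eq:
  "mean_curvature \<A> f \<nu> i p = elementary_symmetric (\<kappa> p) i / real (CARD('n) choose i)"
  by (simp add: mean_curvature_def elementary_symmetric_def)

text \<open>The two terms of the form are the derivatives at \<open>r = 1\<close> of \<open>\<Prod>\<^sub>j (r + t \<kappa>\<^sub>j) vol\<close> in \<open>r\<close> and in \<open>t\<close>.\<close>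

lemma minkowski_form_curvatures:
  assumes c: "c \<in> \<A>" and p: "p \<in> dom_chart c"
  shows "minkowski_form t f c p =
    (\<Sum>i\<le>CARD('n) - 1. (real (CARD('n) - i) * real (CARD('n) choose i)) * curvature_density i c p * t ^ i)"
proof -
  let ?P = "\<lambda>r t. \<Prod>j\<in>UNIV. r + t * \<kappa> p j" and ?vol = "volume_coeff c f p"
  let ?u = "\<lambda>r t j. r *\<^sub>R dc c f p j + t *\<^sub>R dc c \<nu> p j"
  have par: "dc c (parallel t) p = ?u 1 t"
    using differential_parallel[OF c p] by simp
  have vol: "?vol > 0" using \<nu>_pos[OF c p] by (simp add: volume_coeff_eq[OF c p])
  have det: "frame_det (\<nu> p) (?u r t) = ?P r t * ?vol" for r t
    by (rule frame_det_pencil_principal_curvatures[OF c p])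
  have "((\<lambda>r. ?u r t j) has_vector_derivative dc c f p j) (at 1)" for j
    by (auto intro!: derivative_eq_intros)
  from has_derivative_frame_det[where u = "\<lambda>r. ?u r t", OF this, of "\<nu> p"]
  have "((\<lambda>r. ?P r t * ?vol) has_real_derivative polar_det (\<nu> p) (?u 1 t) (dc c f p)) (at 1)"
    unfolding det .
  from DERIV_cdivide[OF this, of ?vol]
  have r: "((\<lambda>r. ?P r t) has_real_derivative polar_det (\<nu> p) (?u 1 t) (dc c f p) / ?vol) (at 1)"
    using vol by simp
  have "((\<lambda>t. ?u 1 t j) has_vector_derivative dc c \<nu> p j) (at t)" for j
    by (auto intro!: derivative_eq_intros)
  from has_derivative_frame_det[where u = "\<lambda>t. ?u 1 t", OF this, of "\<nu> p"]
  have "((\<lambda>t. ?P 1 t * ?vol) has_real_derivative polar_det (\<nu> p) (?u 1 t) (dc c \<nu> p)) (at t)"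
    unfolding det .
  from DERIV_cdivide[OF this, of ?vol]
  have t: "((\<lambda>t. ?P 1 t) has_real_derivative polar_det (\<nu> p) (?u 1 t) (dc c \<nu> p) / ?vol) (at t)"
    using vol by simp
  have "polar_det (f p) (?u 1 t) (dc c \<nu> p) = (f p \<bullet> \<nu> p) * polar_det (\<nu> p) (?u 1 t) (dc c \<nu> p)"
    by (rule polar_det_normal_component)
      (simp_all add: \<nu>_norm[OF c p] inner_add_right \<nu>_orth[OF c p] d\<nu>_orth[OF c p])
  then have "minkowski_form t f c p = (polar_det (\<nu> p) (?u 1 t) (dc c f p) / ?vol
      - (f p \<bullet> \<nu> p) * (polar_det (\<nu> p) (?u 1 t) (dc c \<nu> p) / ?vol)) * ?vol"
    using vol unfolding minkowski_form_def par by (simp add: field_simps)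
  also have "\<dots> = (\<Sum>i\<le>CARD('n) - 1. (real (CARD('n) - i) * real (CARD('n) choose i)) * curvature_density i c p * t ^ i)"
    unfolding pencil_derivative_difference[OF r t] sum_distrib_right curvature_density_def mean_curvature_eq
    by (intro sum.cong refl) (simp only: mult.assoc mult.commute mult.left_commute)
  finally show ?thesis .
qed

text \<open>The principal curvatures come from a choice made at each point, so their continuity is not
available. Their elementary symmetric functions are, up to the volume coefficient, the coefficients in \<open>t\<close>
of the frame determinant of \<open>df + t d\<nu>\<close>, which depend continuously on the point.\<close>

lemma elementary_symmetric_density:
  "density \<A> (\<lambda>c p. elementary_symmetric (\<kappa> p) k * volume_coeff c f p)"
  unfolding density_def
proof (intro conjI ballI)
  fix c assume c: "c \<in> \<A>"
  let ?U = "image_chart c"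
  have "poly_continuous_on ?U (\<lambda>t x. frame_det (\<nu> (param c x)) (\<lambda>j. dc c f (param c x) j + t *\<^sub>R dc c \<nu> (param c x) j))"
    by (intro poly_continuous_on_frame_det C1_fun_continuous_differential C1_fun_continuous_on f_C1 \<nu>_C1 c)
  from poly_continuous_on_padded[OF this]
  obtain b d where b: "\<forall>k. continuous_on ?U (b k)" "\<forall>k>d. \<forall>x. b k x = 0"
    "\<forall>x\<in>?U. \<forall>t. frame_det (\<nu> (param c x)) (\<lambda>j. dc c f (param c x) j + t *\<^sub>R dc c \<nu> (param c x) j)
       = (\<Sum>k\<le>d. b k x * t ^ k)" by (elim exE conjE)
  have "b k x = elementary_symmetric (\<kappa> (param c x)) k * volume_coeff c f (param c x)" if x: "x \<in> ?U" for x
  proof -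
    let ?p = "param c x" let ?e = "\<lambda>k. elementary_symmetric (\<kappa> ?p) k * volume_coeff c f ?p"
    define m where "m = max (max d k) CARD('n)"
    have p: "?p \<in> dom_chart c" by (rule param_in[OF chart[OF c] x])
    have "(\<Sum>k\<le>m. b k x * t ^ k) = (\<Sum>k\<le>m. ?e k * t ^ k)" for t
    proof -
      have "(\<Sum>k\<le>m. b k x * t ^ k) = (\<Sum>k\<le>d. b k x * t ^ k)"
        by (rule sum.mono_neutral_right) (use b(2) in \<open>auto simp: m_def\<close>)
      also have "\<dots> = (\<Prod>j\<in>UNIV. 1 + t * \<kappa> ?p j) * volume_coeff c f ?p"
        using bspec[OF b(3) x] frame_det_pencil_principal_curvatures[OF c p, of 1 t] by simp
      also have "\<dots> = (\<Sum>k\<le>CARD('n). ?e k * t ^ k)"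
        unfolding prod_pencil_expansion sum_distrib_right by (simp add: mult_ac)
      also have "\<dots> = (\<Sum>k\<le>m. ?e k * t ^ k)"
        by (rule sum.mono_neutral_left) (auto simp: m_def elementary_symmetric_beyond)
      finally show ?thesis .
    qed
    then have "\<forall>k\<le>m. b k x = ?e k" using polyfun_eq_coeffs[where n = m and c = "\<lambda>k. b k x" and d = ?e] by blast
    then show ?thesis by (simp add: m_def)
  qed
  then show "continuous_on ?U ((\<lambda>p. elementary_symmetric (\<kappa> p) k * volume_coeff c f p) \<circ> param c)"
    using b(1) unfolding comp_def by (metis (no_types, lifting) continuous_on_cong)
next
  fix c d p assume c: "c \<in> \<A>" and d: "d \<in> \<A>" and "p \<in> dom_chart c \<inter> dom_chart d"
  then have p: "p \<in> dom_chart c" "p \<in> dom_chart d" by auto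
  show "elementary_symmetric (\<kappa> p) k * volume_coeff c f p =
    det (matrix (frechet_derivative (coord d \<circ> param c) (at (coord c p)))) *
    (elementary_symmetric (\<kappa> p) k * volume_coeff d f p)"
    using frame_det_pencil_transform[OF c d p f_C1 \<nu>_C1, of "\<nu> p" 1 0]
    by (simp add: volume_coeff_eq[OF c p(1)] volume_coeff_eq[OF d p(2)])
qed

lemma curvature_density_density: "density \<A> (curvature_density i)"
proof -
  let ?E = "\<lambda>k c p. elementary_symmetric (\<kappa> p) k * volume_coeff c f p"
  let ?a = "1 / real (CARD('n) choose i)" and ?b = "\<lambda>p. - (f p \<bullet> \<nu> p) / real (CARD('n) choose Suc i)"
  have fn: "C1_fun \<A> (\<lambda>p. f p \<bullet> \<nu> p)"
    using f_C1 \<nu>_C1 unfolding C1_fun_def comp_def by (auto intro: C1_diff_on_inner)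
  have "continuous_map N euclideanreal ?b"
    using continuous_map_real_mult[OF C1_fun_continuous_map[OF fn], of "\<lambda>p. - 1 / real (CARD('n) choose Suc i)"]
    by simp
  then have 1: "density \<A> (\<lambda>c p. ?a * ?E i c p)" and 2: "density \<A> (\<lambda>c p. ?b p * ?E (Suc i) c p)"
    by (intro density_times elementary_symmetric_density; simp)+
  have eq: "curvature_density i c p = ?a * ?E i c p + ?b p * ?E (Suc i) c p" for c p
    by (simp add: curvature_density_def mean_curvature_eq algebra_simps)
  have fun_eq: "curvature_density i c \<circ> param c
      = (\<lambda>x. ((\<lambda>p. ?a * ?E i c p) \<circ> param c) x + ((\<lambda>p. ?b p * ?E (Suc i) c p) \<circ> param c) x)" for c
    by (simp add: fun_eq_iff eq)
  show ?thesis
    unfolding density_def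
  proof (intro conjI ballI)
    fix c assume "c \<in> \<A>"
    then show "continuous_on (image_chart c) (curvature_density i c \<circ> param c)"
      using 1 2 unfolding fun_eq density_def by (intro continuous_on_add) blast+
  next
    fix c d p assume cd: "c \<in> \<A>" "d \<in> \<A>" "p \<in> dom_chart c \<inter> dom_chart d"
    let ?J = "det (matrix (frechet_derivative (coord d \<circ> param c) (at (coord c p))))"
    have "?a * ?E i c p = ?J * (?a * ?E i d p)" "?b p * ?E (Suc i) c p = ?J * (?b p * ?E (Suc i) d p)"
      using 1 2 cd unfolding density_def by blast+
    then show "curvature_density i c p = ?J * curvature_density i d p"
      unfolding eq by (simp only: distrib_left)
  qed
qed

theorem curvature_density_integral:
  assumes part: "partition_of_unity N \<A> B \<rho>" and i: "i \<le> CARD('n) - 1"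
  shows "(\<Sum>c\<in>B. chart_integral c (\<lambda>p. \<rho> c p * curvature_density i c p)) = 0"
proof -
  let ?n = "CARD('n)"
  let ?b = "\<lambda>i. real (?n - i) * real (?n choose i)"
  define I where "I = (\<lambda>i. \<Sum>c\<in>B. chart_integral c (\<lambda>p. \<rho> c p * curvature_density i c p))"
  have "(\<Sum>i\<le>?n - 1. (?b i * I i) * t ^ i) = 0" for t
  proof -
    have "chart_integral c (\<lambda>p. \<rho> c p * minkowski_form t f c p)
      = (\<Sum>i\<le>?n - 1. (?b i * t ^ i) * chart_integral c (\<lambda>p. \<rho> c p * curvature_density i c p))" if c: "c \<in> B" for c
    proof -
      note cA = partition_chart[OF part c]
      have "indicator (image_chart c) y *\<^sub>R ((\<lambda>p. \<rho> c p * minkowski_form t f c p) \<circ> param c) y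
        = (\<Sum>i\<le>?n - 1. (?b i * t ^ i) *
            (indicator (image_chart c) y *\<^sub>R ((\<lambda>p. \<rho> c p * curvature_density i c p) \<circ> param c) y))" for y
      proof (cases "y \<in> image_chart c")
        case True
        then show ?thesis
          using minkowski_form_curvatures[OF cA param_in[OF chart[OF cA] True], of t]
          by (simp add: sum_distrib_left mult_ac)
      qed simp
      then show ?thesis
        unfolding set_lebesgue_integral_def
        using partition_density_integrable[OF part curvature_density_density c] by (simp add: set_integrable_def)
    qed
    then have "(\<Sum>c\<in>B. chart_integral c (\<lambda>p. \<rho> c p * minkowski_form t f c p))
       = (\<Sum>i\<le>?n - 1. (?b i * t ^ i) * I i)"
      unfolding I_def sum_distrib_left by (subst sum.swap) simp
    then show ?thesis using minkowski_form_integral[OF part, of t] by (simp add: mult_ac)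
  qed
  then have "?b i * I i = 0" using polyfun_eq_0[where n = "?n - 1" and c = "\<lambda>i. ?b i * I i"] i by blast
  moreover have "?n > 0" by simp
  then have "?b i \<noteq> 0" using i by (simp, linarith)
  ultimately show ?thesis by (simp add: I_def)
qed

text \<open>Every admissible partition of unity yields the value 0, and at least one exists.\<close>

theorem volume_integral_minkowski:
  assumes i: "i \<le> CARD('n) - 1"
  shows "volume_integral N \<A> f
     (\<lambda>p. mean_curvature \<A> f \<nu> i p - (f p \<bullet> \<nu> p) * mean_curvature \<A> f \<nu> (Suc i) p) = 0"
proof -
  let ?h = "\<lambda>p. mean_curvature \<A> f \<nu> i p - (f p \<bullet> \<nu> p) * mean_curvature \<A> f \<nu> (Suc i) p"
  have h: "(\<lambda>p. \<rho> c p * ?h p * volume_coeff c f p) = (\<lambda>p. \<rho> c p * curvature_density i c p)"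
    for \<rho> :: "('a, 'n) chart \<Rightarrow> 'a \<Rightarrow> real" and c
    by (simp add: curvature_density_def mult.assoc)
  show ?thesis
    unfolding volume_integral_def h
  proof (rule the_equality)
    obtain B \<rho> where part: "partition_of_unity N \<A> B \<rho>" using exists_partition_of_unity by blast
    show "\<exists>B \<rho>. partition_of_unity N \<A> B \<rho> \<and>
       (\<forall>c\<in>B. set_integrable lborel (image_chart c) ((\<lambda>p. \<rho> c p * curvature_density i c p) \<circ> param c)) \<and>
       0 = (\<Sum>c\<in>B. chart_integral c (\<lambda>p. \<rho> c p * curvature_density i c p))"
      using partition_density_integrable[OF part curvature_density_density]
      by (intro exI[of _ B] exI[of _ \<rho>] conjI ballI part curvature_density_integral[OF part i, symmetric])
  next
    fix I
    assume "\<exists>B \<rho>. partition_of_unity N \<A> B \<rho> \<and>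
       (\<forall>c\<in>B. set_integrable lborel (image_chart c) ((\<lambda>p. \<rho> c p * curvature_density i c p) \<circ> param c)) \<and>
       I = (\<Sum>c\<in>B. chart_integral c (\<lambda>p. \<rho> c p * curvature_density i c p))"
    then show "I = 0" using curvature_density_integral[OF _ i] by blast
  qed
qed

end

theorem theorem1p1:
  fixes N :: "'a topology"
    and \<A> :: "('a, 'n::finite) chart set"
    and f \<nu> :: "'a \<Rightarrow> real ^ ('n option)"
    and P :: "real ^ ('n option) \<Rightarrow> real ^ ('n option)"
    and i :: nat
  assumes "closed_oriented_manifold N \<A>"
    and "C2_immersion \<A> f"
    and "oriented_unit_normal \<A> f \<nu>"
    and "\<And>x. P x = x"
    and "0 \<le> i" and "i \<le> CARD('n) - 1"
  shows "volume_integral N \<A> f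
           (\<lambda>p. mean_curvature \<A> f \<nu> i p - (P (f p) \<bullet> \<nu> p) * mean_curvature \<A> f \<nu> (i + 1) p) = 0"
proof -
  interpret oriented_hypersurface N \<A> f \<nu>
    using assms(1-3) by unfold_locales
  show ?thesis
    using volume_integral_minkowski[OF assms(6)] by (simp add: assms(4))
qed

end
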